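(* Suppose that $(f,X,\mu)$ is an ergodic, conservative measure preserving map on an interval $X\subset\mathbb{R}$, with $\mu$ absolutely continuous with respect to Lebesgue measure, and that $(f,X,\mu)$ is modelled by a (one-dimensional) Young tower $(F,\Delta,\nu)$ with return time function satisfying $\hat\nu\{R=n\}\sim n^{-\beta-1}$ for some $\beta\in(0,1)$, and that the measure $\mu=\pi_*\nu$ is $\sigma$-finite. Put $\alpha=1/\beta$. Then there exists a set $X'\subset X$ with $\mu(X\setminus X')=0$ with the following property. If $\{B_n\}$ is a nested (decreasing) sequence of intervals, with $\mu(B_n)<\infty$, $\bigcap_nB_n=\{\tilde x\}$, $\tilde x\in X'$, and $\sum_{k=1}^\infty\mu(B_{k^{\alpha+\varepsilon_1}})=\infty$ for some $\varepsilon_1>0$, then for all $\varepsilon\in(0,\varepsilon_1]$, $$\liminf_{n\to\infty}\frac{\sum_{k=1}^n1_{B_k}(f^k(x))}{\sum_{k=1}^{n^{\frac1{\alpha+\varepsilon}}}\mu(B_{k^{\alpha+\varepsilon}})}\ge1$$ for $\mu$-a.e. $x\in X$.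
   Context: Non-integer indices and summation limits are replaced by their integer parts. $v(n)\sim u(n)$ means $c^{-1}\le v(n)/u(n)\le c$ for some $c>0$ and all large $n$. Young tower: there is a subinterval $\Lambda\subset X$, a countable partition $\{\Lambda_i\}_{i\in\mathbb{N}}$ of $\Lambda$ into subintervals and a function $R\colon\Lambda\to\mathbb{N}$ with $R|_{\Lambda_i}=R_i$ constant, such that $f^{R_i}\colon\Lambda_i\to\Lambda$ is a bijection. The tower is $\Delta=\bigcup_{k\ge1}\bigcup_{\ell=0}^{R_k-1}\Delta_{k,\ell}$ with $\Delta_{k,\ell}=\Lambda_k\times\{\ell\}$; the base $\Delta_0=\bigcup_k\Delta_{k,0}$ is identified with $\Lambda$. The tower map $F\colon\Delta\to\Delta$ is $F(x,\ell)=(x,\ell+1)$ if $x\in\Lambda_i$ and $\ell<R_i-1$, and $F(x,\ell)=(f^{R_i}(x),0)$ if $x\in\Lambda_i$ and $\ell=R_i-1$. The base map $\hat F=F^R\colon\Lambda\to\Lambda$ is a Gibbs–Markov map: with $\mathcal{P}=\{\Lambda_i\}$ and $\mathcal{P}_n=\bigvee_{i=0}^n\hat F^{-i}\mathcal{P}$, there are $\lambda>1$, $0<\tau<1$, $C>0$ with $|(\hat F^n)'|\ge C\lambda^n$ for $n\ge1$, and $\left|\log\frac{|\hat F'(x)|}{|\hat F'(y)|}\right|\le C\tau^n$ for all $x,y\in\omega\in\mathcal{P}_n$. It admits an ergodic absolutely continuous invariant probability measure $\hat\nu$ whose density with respect to Lebesgue measure on $\Lambda$ is bounded above and bounded away from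 $0$. The measure $\nu$ on $\Delta$ is $\nu(A)=\sum_\ell\hat\nu(\{R>\ell\}\cap F^{-\ell}A)$; it is $F$-invariant. The factor map $\pi\colon\Delta\to X$, $\pi(x,\ell)=f^\ell(x)$, is surjective and satisfies $\pi\circ F=f\circ\pi$; $\pi_*\nu(A)=\nu(\pi^{-1}(A))$. "Modelled by" means that such a tower exists with $\mu=\pi_*\nu$.
   Formalization: The formal tower also requires each f^l (l<R_i) to be monotone on Λ_i, as holds when f^l is continuous there; without it, f could scramble an intermediate floor by a measure isomorphism and the liminf could be 0. *)

theory Defs
  imports "HOL-Probability.Probability"
begin

definition measure_preserving_map :: "'a measure \<Rightarrow> ('a \<Rightarrow> 'a) \<Rightarrow> bool" where
  "measure_preserving_map M f \<longleftrightarrow> f \<in> measurable M M \<and> distr M M f = M"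

definition ergodic_map :: "'a measure \<Rightarrow> ('a \<Rightarrow> 'a) \<Rightarrow> bool" where
  "ergodic_map M f \<longleftrightarrow>
     (\<forall>A\<in>sets M. f -` A \<inter> space M = A \<longrightarrow> A \<in> null_sets M \<or> space M - A \<in> null_sets M)"

text \<open>Conservativity: every wandering set is a null set.\<close>

definition conservative_map :: "'a measure \<Rightarrow> ('a \<Rightarrow> 'a) \<Rightarrow> bool" where
  "conservative_map M f \<longleftrightarrow>
     (\<forall>W\<in>sets M. disjoint_family (\<lambda>n. (f ^^ n) -` W \<inter> space M) \<longrightarrow> W \<in> null_sets M)"

text \<open>The relation written \<open>v(n) \<sim> u(n)\<close> in the source; it is weaker than asymptotic
  equivalence in the sense of the library.\<close>

definition comparable :: "(nat \<Rightarrow> real) \<Rightarrow> (nat \<Rightarrow> real) \<Rightarrow> bool" where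
  "comparable v u \<longleftrightarrow>
     (\<exists>c>0. eventually (\<lambda>n. inverse c \<le> v n / u n \<and> v n / u n \<le> c) sequentially)"

text \<open>Integer part of a nonnegative real.\<close>

definition ipart :: "real \<Rightarrow> nat" where
  "ipart x = nat \<lfloor>x\<rfloor>"

text \<open>Below, \<open>L\<close> is the base interval \<open>\<Lambda>\<close>, \<open>P i\<close> the element \<open>\<Lambda>\<^sub>i\<close> of its partition,
  \<open>R\<close> the return time and \<open>m\<close> the invariant probability measure of the base map.\<close>

definition base_map :: "(real \<Rightarrow> real) \<Rightarrow> (real \<Rightarrow> nat) \<Rightarrow> real \<Rightarrow> real" where
  "base_map f R x = (f ^^ R x) x"

definition tower :: "real set \<Rightarrow> (real \<Rightarrow> nat) \<Rightarrow> (real \<times> nat) set" where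
  "tower L R = {(x, l). x \<in> L \<and> l < R x}"

definition tower_map :: "(real \<Rightarrow> real) \<Rightarrow> (real \<Rightarrow> nat) \<Rightarrow> real \<times> nat \<Rightarrow> real \<times> nat" where
  "tower_map f R = (\<lambda>(x, l). if Suc l < R x then (x, Suc l) else (base_map f R x, 0))"

definition tower_proj :: "(real \<Rightarrow> real) \<Rightarrow> real \<times> nat \<Rightarrow> real" where
  "tower_proj f = (\<lambda>(x, l). (f ^^ l) x)"

text \<open>The base \<open>L\<close> is identified with the floor at height 0 through \<open>x \<mapsto> (x, 0)\<close>.\<close>

definition tower_measure ::
  "(real \<Rightarrow> real) \<Rightarrow> real set \<Rightarrow> (real \<Rightarrow> nat) \<Rightarrow> real measure \<Rightarrow> (real \<times> nat) measure" where
  "tower_measure f L R m =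
     measure_of (tower L R) (sets (restrict_space (borel \<Otimes>\<^sub>M count_space UNIV) (tower L R)))
       (\<lambda>A. \<Sum>l. emeasure m {x \<in> L. l < R x \<and> (tower_map f R ^^ l) (x, 0) \<in> A})"

text \<open>The join of the partitions \<open>T\<^sup>-\<^sup>iP\<close>, \<open>0 \<le> i \<le> n\<close>; its elements are indexed by
  itineraries \<open>c\<close>.\<close>

definition cylinders :: "(real \<Rightarrow> real) \<Rightarrow> real set \<Rightarrow> (nat \<Rightarrow> real set) \<Rightarrow> nat \<Rightarrow> real set set" where
  "cylinders T L P n = range (\<lambda>c. {x \<in> L. \<forall>i\<le>n. (T ^^ i) x \<in> P (c i)})"

text \<open>Gibbs--Markov property. \<open>D n x\<close> is the derivative of \<open>T\<^sup>n\<close> at \<open>x\<close>, taken within the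
  element of the partition on which \<open>T\<^sup>n\<close> is a single branch, hence one-sided at its end points.\<close>

definition gibbs_markov :: "(real \<Rightarrow> real) \<Rightarrow> real set \<Rightarrow> (nat \<Rightarrow> real set) \<Rightarrow> bool" where
  "gibbs_markov T L P \<longleftrightarrow>
     (\<exists>D. (\<forall>n. \<forall>\<omega>\<in>cylinders T L P n. \<forall>x\<in>\<omega>.
             ((T ^^ Suc n) has_real_derivative D (Suc n) x) (at x within \<omega>)) \<and>
          (\<exists>\<theta> \<tau> C. \<theta> > 1 \<and> 0 < \<tau> \<and> \<tau> < 1 \<and> C > 0 \<and>
             (\<forall>n\<ge>1. \<forall>x\<in>L. \<bar>D n x\<bar> \<ge> C * \<theta> ^ n) \<and>
             (\<forall>n. \<forall>\<omega>\<in>cylinders T L P n. \<forall>x\<in>\<omega>. \<forall>y\<in>\<omega>.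
                \<bar>ln (\<bar>D 1 x\<bar> / \<bar>D 1 y\<bar>)\<bar> \<le> C * \<tau> ^ n)))"

text \<open>Assumption \<open>branch_mono\<close> makes explicit what a one-dimensional tower means: every floor
  \<open>P i \<times> {l}\<close> is projected to the interval \<open>X\<close> monotonically, so that subintervals of \<open>X\<close>
  pull back to intervals in each floor.\<close>

locale young_tower =
  fixes X :: "real set" and f :: "real \<Rightarrow> real"
    and L :: "real set" and P :: "nat \<Rightarrow> real set" and R :: "real \<Rightarrow> nat" and m :: "real measure"
  assumes base_interval: "is_interval L" "L \<subseteq> X"
    and partition_intervals: "\<And>i. is_interval (P i)"
    and partition: "disjoint_family P" "(\<Union>i. P i) = L"
    and return_pos: "\<And>x. x \<in> L \<Longrightarrow> R x \<ge> 1"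
    and return_const: "\<And>i. R constant_on P i"
    and full_branches: "\<And>i. bij_betw (base_map f R) (P i) L"
    and branch_mono: "\<And>i x l. x \<in> P i \<Longrightarrow> l < R x \<Longrightarrow>
                        mono_on (P i) (f ^^ l) \<or> antimono_on (P i) (f ^^ l)"
    and gibbs_markov: "gibbs_markov (base_map f R) L P"
    and base_prob: "prob_space m"
    and base_density: "\<exists>h c K. h \<in> borel_measurable borel \<and> 0 < c \<and>
                         (\<forall>x\<in>L. c \<le> h x \<and> h x \<le> (K::real)) \<and>
                         m = density (restrict_space lborel L) (\<lambda>x. ennreal (h x))"
    and base_invariant: "measure_preserving_map m (base_map f R)"
    and base_ergodic: "ergodic_map m (base_map f R)"
    and proj_surj: "tower_proj f ` tower L R = X"

text \<open>The tower models \<open>(f, X, \<mu>)\<close>, i.e. \<open>\<mu> = \<pi>\<^sub>*\<nu>\<close>.\<close>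

definition modelled_by_tower ::
  "real measure \<Rightarrow> (real \<Rightarrow> real) \<Rightarrow> real set \<Rightarrow> real set \<Rightarrow> (nat \<Rightarrow> real set) \<Rightarrow> (real \<Rightarrow> nat)
    \<Rightarrow> real measure \<Rightarrow> bool" where
  "modelled_by_tower \<mu> f X L P R m \<longleftrightarrow>
     young_tower X f L P R m \<and>
     \<mu> = distr (tower_measure f L R m) (restrict_space borel X) (tower_proj f)"

lemma tower_map_base: "l < R x \<Longrightarrow> (tower_map f R ^^ l) (x, 0) = (x, l)"
  by (induction l) (auto simp: tower_map_def)

lemma tower_proj_semiconj:
  assumes "z \<in> tower L R"
  shows "tower_proj f (tower_map f R z) = f (tower_proj f z)"
proof -
  obtain x l where z: "z = (x, l)" "l < R x" using assms by (auto simp: tower_def)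
  show ?thesis
  proof (cases "Suc l < R x")
    case False
    then have "R x = Suc l" using z by simp
    then show ?thesis using z by (simp add: tower_proj_def tower_map_def base_map_def)
  qed (use z in \<open>simp add: tower_proj_def tower_map_def\<close>)
qed

text \<open>The set function defining the tower measure is countably additive, so \<open>tower_measure\<close> has the intended values.\<close>

context young_tower
begin

lemma base_sets: "L \<in> sets borel" "P i \<in> sets borel"
  using base_interval(1) partition_intervals
  by (auto simp: is_interval_convex_1 intro: real_interval_borel_measurable)

lemma space_m: "space m = L" and sets_m: "sets m = sets (restrict_space borel L)"
proof -
  obtain h where "m = density (restrict_space lborel L) h" using base_density by blast
  then show "space m = L" "sets m = sets (restrict_space borel L)"
    by (auto simp: space_restrict_space sets_restrict_space)
qed

lemma return_level_sets: "{x \<in> L. l < R x} \<in> sets borel"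
proof -
  have "{x \<in> L. l < R x} = (\<Union>i \<in> {i. \<exists>x\<in>P i. l < R x}. P i)"
  proof (intro equalityI subsetI)
    fix x assume "x \<in> (\<Union>i \<in> {i. \<exists>x\<in>P i. l < R x}. P i)"
    then obtain i y where i: "x \<in> P i" "y \<in> P i" "l < R y" by auto
    then have "R x = R y" using return_const[of i] by (auto simp: constant_on_def)
    then show "x \<in> {x \<in> L. l < R x}" using i partition(2) by auto
  qed (use partition(2) in auto)
  then show ?thesis using base_sets by (auto intro!: sets.countable_UN')
qed

lemma space_tower_measure: "space (tower_measure f L R m) = tower L R"
  and sets_tower_measure:
    "sets (tower_measure f L R m) = sets (restrict_space (borel \<Otimes>\<^sub>M count_space UNIV) (tower L R))"
  and emeasure_tower_measure:
    "A \<in> sets (tower_measure f L R m) \<Longrightarrow> emeasure (tower_measure f L R m) A =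
       (\<Sum>l. emeasure m {x \<in> L. l < R x \<and> (tower_map f R ^^ l) (x, 0) \<in> A})"
proof -
  let ?N = "restrict_space (borel \<Otimes>\<^sub>M count_space UNIV) (tower L R) :: (real \<times> nat) measure"
  let ?E = "\<lambda>l A. {x \<in> L. l < R x \<and> (tower_map f R ^^ l) (x, 0) \<in> A}"
  let ?\<mu> = "\<lambda>A. \<Sum>l. emeasure m (?E l A)"
  have sp: "space ?N = tower L R" by (auto simp: space_restrict_space space_pair_measure)
  have sub: "sets ?N \<subseteq> Pow (tower L R)" using sets.space_closed[of ?N] sp by simp
  have sa: "sigma_algebra (tower L R) (sets ?N)"
    using sets.sigma_algebra_axioms[of ?N] sp by simp
  show "space (tower_measure f L R m) = tower L R"
    unfolding tower_measure_def by (rule space_measure_of[OF sub])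
  show sets: "sets (tower_measure f L R m) = sets ?N"
    unfolding tower_measure_def using sets_measure_of[OF sub]
      sigma_algebra.sigma_sets_eq[OF sa] by simp
  have meas: "?E l A \<in> sets m" if "A \<in> sets ?N" for l A
  proof -
    obtain A' where A': "A' \<in> sets (borel \<Otimes>\<^sub>M count_space UNIV)" "A = tower L R \<inter> A'"
      using \<open>A \<in> sets ?N\<close> by (auto simp: sets_restrict_space)
    have "?E l A = L \<inter> ({x \<in> L. l < R x} \<inter> {x. (x, l) \<in> A'})"
      using A'(2) by (auto simp: tower_map_base tower_def)
    moreover have "{x. (x, l) \<in> A'} \<in> sets borel"
      using measurable_sets[OF measurable_Pair2'[of l "count_space UNIV" "borel :: real measure"]
          A'(1)] by (simp add: vimage_def)
    ultimately show ?thesis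
      using return_level_sets[of l] unfolding sets_m sets_restrict_space by auto
  qed
  have ca: "countably_additive (sets ?N) ?\<mu>"
  proof (rule countably_additiveI)
    fix A :: "nat \<Rightarrow> (real \<times> nat) set"
    assume A: "range A \<subseteq> sets ?N" "disjoint_family A"
    have "(\<Sum>i. emeasure m (?E l (A i))) = emeasure m (?E l (\<Union>i. A i))" for l
    proof -
      have "(\<Sum>i. emeasure m (?E l (A i))) = emeasure m (\<Union>i. ?E l (A i))"
      proof (rule suminf_emeasure)
        show "range (\<lambda>i. ?E l (A i)) \<subseteq> sets m" using A meas by auto
        show "disjoint_family (\<lambda>i. ?E l (A i))"
          using A(2) by (auto simp: disjoint_family_on_def)
      qed
      also have "(\<Union>i. ?E l (A i)) = ?E l (\<Union>i. A i)" by auto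
      finally show ?thesis .
    qed
    moreover have "(\<Sum>i. ?\<mu> (A i)) = (\<Sum>l. \<Sum>i. emeasure m (?E l (A i)))"
      using nn_integral_suminf[of "\<lambda>l i. emeasure m (?E l (A i))" "count_space UNIV"]
      by (simp add: nn_integral_count_space_nat)
    ultimately show "(\<Sum>i. ?\<mu> (A i)) = ?\<mu> (\<Union>i. A i)" by simp
  qed
  have pos: "positive (sets ?N) ?\<mu>" by (simp add: positive_def)
  show "emeasure (tower_measure f L R m) A = ?\<mu> A" if "A \<in> sets (tower_measure f L R m)"
    unfolding tower_measure_def
    by (rule emeasure_measure_of_sigma[OF sa pos ca]) (use that sets in simp)
qed

end

end

theory Submission
  imports Defs "HOL-Real_Asymp.Real_Asymp"
begin

text \<open>
  Seen only at its visits to the base, the orbit of a base point \<open>x\<close> is the orbit of the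
  Gibbs--Markov map \<open>T\<close>, and the \<open>j\<close>-th visit happens at time \<open>R\<^sub>j(x) = (\<Sum>i<j. R (T\<^sup>i x))\<close>.
  The return time has moments of every order \<open>p < \<beta>\<close>, so almost surely \<open>R\<^sub>j(x) \<le> j\<^sup>a\<close> for all
  large \<open>j\<close>, where \<open>a = \<alpha> + \<epsilon>\<close> (\<open>AE_return_sum_le\<close>). Put \<open>C\<^sub>j = B\<^bsub>(j+1)\<^sup>a\<^esub>\<close>. As the \<open>B\<^sub>k\<close>
  decrease, the \<open>j\<close>-th excursion from the base hits the sets \<open>B\<^sub>k\<close> at least as often as it
  enters \<open>C\<^sub>j\<close>. The number of entries is \<open>\<phi>\<^sub>j (T\<^sup>j x)\<close> for a function \<open>\<phi>\<^sub>j\<close> on the base whose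
  mean is the tower measure of the preimage of \<open>C\<^sub>j\<close>, that is \<open>\<mu>(C\<^sub>j)\<close>. Since \<open>n\<^sup>1\<^sup>/\<^sup>a\<close>
  excursions are completed by time \<open>n\<close>, the theorem follows from a strong Borel--Cantelli law
  for the functions \<open>\<phi>\<^sub>j \<circ> T\<^sup>j\<close> under the invariant probability \<open>m\<close>. Starting an orbit at
  height \<open>l\<close> of the tower instead of in the base costs at most \<open>l\<close> hits (\<open>hits_shift\<close>).

  The functions \<open>\<phi>\<^sub>j\<close> are unbounded, so only the \<open>H\<close> lowest floors of the tower are counted.
  The share of \<open>\<mu>(C\<^sub>j)\<close> that is lost lies on the floors above \<open>H\<close>. By a maximal inequality on
  the line it is, for \<open>\<mu>\<close>-almost every centre, as small as desired on all small intervals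
  around this centre once \<open>H\<close> is large (\<open>high_part_small\<close>); the remaining centres form the
  exceptional set.

  The truncated functions are sums of indicators of sets that meet every branch domain of \<open>T\<close>
  in an interval. Up to two cylinders of each generation in each branch domain, such a set is
  a union of cylinders, and on cylinders \<open>T\<close> is exponentially mixing, with an error
  proportional to the product of the two measures. The reason is bounded distortion: the image
  of a normalised cylinder under the iterate that maps it onto the base is a probability that
  is comparable with \<open>m\<close> and whose density has an oscillation on cylinders that decays
  exponentially with their generation. A fixed multiple of \<open>m\<close> can be subtracted from it, and
  after a fixed number of further iterates the remainder, normalised, is of the same kind
  (\<open>regular_step\<close>). So the distance to \<open>m\<close> decays geometrically (\<open>cylinder_mixing\<close>,
  \<open>few_boundary_mixing\<close>). Distortion is known for Lebesgue measure; to transfer it to \<open>m\<close>,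
  whose density is only measurable and bounded, the density is approximated in \<open>L\<^sup>1\<close> by
  functions that are constant on cylinders. Their images under high iterates of \<open>T\<close> obey one
  common oscillation bound, which \<open>m\<close> inherits by invariance (\<open>invariant_density_regular\<close>).

  Mixing bounds the variance of the partial sums by a multiple of their mean, and Chebyshev's
  inequality along a subsequence with quadratically growing means finishes the proof
  (\<open>AE_liminf_sums\<close>, \<open>AE_hits\<close>).
\<close>

section \<open>Full-branch maps and their cylinders\<close>

text \<open>
  That every branch of \<open>T\<close> on an element of the partition \<open>P\<close> covers the whole space, up to null
  sets, is expressed by the distortion inequality below: it compares the preimage of a set in
  one branch with the preimage of the space.
\<close>

locale full_branch_system = finite_measure M for M :: "'a measure" +
  fixes T :: "'a \<Rightarrow> 'a" and P :: "nat \<Rightarrow> 'a set"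
  assumes T_measurable [measurable]: "T \<in> measurable M M"
    and P_sets [measurable]: "\<And>i. P i \<in> sets M"
    and P_disjoint: "disjoint_family P"
    and P_cover: "(\<Union>i. P i) = space M"
    and mass_pos: "0 < measure M (space M)"
begin

text \<open>
  \<open>pull w A\<close> is the set of points that follow the itinerary \<open>w\<close> through the partition and are
  then in \<open>A\<close>: the inverse image of \<open>A\<close> under one inverse branch of \<open>T ^^ length w\<close>. The
  recursion over words makes every statement about iterates an induction over single steps.
\<close>

fun pull :: "nat list \<Rightarrow> 'a set \<Rightarrow> 'a set" where
  "pull [] A = A"
| "pull (i # w) A = P i \<inter> T -` pull w A"

abbreviation cyl :: "nat list \<Rightarrow> 'a set" where
  "cyl w \<equiv> pull w (space M)"

lemma P_subset: "P i \<subseteq> space M"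
  using P_cover by auto

lemma branch_sets [measurable]: "A \<in> sets M \<Longrightarrow> P i \<inter> T -` A \<in> sets M"
proof -
  assume "A \<in> sets M"
  then have "P i \<inter> (T -` A \<inter> space M) \<in> sets M"
    by measurable
  moreover have "P i \<inter> (T -` A \<inter> space M) = P i \<inter> T -` A"
    using P_subset[of i] by auto
  ultimately show ?thesis by simp
qed

lemma pull_sets [measurable]: "A \<in> sets M \<Longrightarrow> pull w A \<in> sets M"
  by (induction w) (simp_all add: branch_sets)

lemma pull_append: "pull (v @ w) A = pull v (pull w A)"
  by (induction v) auto

lemma pull_mono: "A \<subseteq> B \<Longrightarrow> pull w A \<subseteq> pull w B"
  by (induction w) auto

lemma pull_subset: "A \<subseteq> space M \<Longrightarrow> pull w A \<subseteq> space M"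
  using P_subset by (cases w) auto

lemma pull_Diff: "pull w (A - B) = pull w A - pull w B"
  by (induction w) auto

lemma pull_disjoint: "length v = length w \<Longrightarrow> v \<noteq> w \<Longrightarrow> pull v A \<inter> pull w B = {}"
proof (induction v w rule: list_induct2)
  case (Cons i v j w)
  show ?case
  proof (cases "i = j")
    case True
    then show ?thesis using Cons by auto
  next
    case False
    then have "P i \<inter> P j = {}" using P_disjoint by (auto simp: disjoint_family_on_def)
    then show ?thesis by auto
  qed
qed simp

lemma pull_eq: "A \<subseteq> space M \<Longrightarrow> pull w A = cyl w \<inter> (T ^^ length w) -` A"
proof (induction w)
  case (Cons i w)
  then show ?case by (auto simp: funpow_swap1)
qed auto

lemma cyl_exists: "x \<in> space M \<Longrightarrow> \<exists>w. length w = n \<and> x \<in> cyl w"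
proof (induction n arbitrary: x)
  case (Suc n)
  have "T x \<in> space M" using Suc.prems by (rule measurable_space[OF T_measurable])
  then obtain w where w: "length w = n" "T x \<in> cyl w" using Suc.IH by blast
  obtain i where "x \<in> P i" using Suc.prems P_cover by blast
  then have "x \<in> cyl (i # w)" using w by simp
  then show ?case using w by (intro exI[of _ "i # w"]) auto
qed auto

lemma funpow_measurable [measurable]: "T ^^ n \<in> measurable M M"
  by (induction n) (auto intro: measurable_comp[OF _ T_measurable] simp: comp_def)

lemma vimage_funpow_Suc:
  "(T ^^ n) -` (T -` A \<inter> space M) \<inter> space M = (T ^^ Suc n) -` A \<inter> space M"
  using measurable_space[OF funpow_measurable[of n]] by auto

lemma invariant_vimage_funpow:
  assumes "\<And>A. A \<in> sets M \<Longrightarrow> \<rho> (T -` A \<inter> space M) = \<rho> A" and "A \<in> sets M"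
  shows "\<rho> ((T ^^ n) -` A \<inter> space M) = \<rho> A"
  using assms(2)
proof (induction n arbitrary: A)
  case 0
  then show ?case by (simp add: sets.Int_space_eq2)
next
  case (Suc n)
  have "T -` A \<inter> space M \<in> sets M" using T_measurable Suc.prems by (rule measurable_sets)
  then show ?case
    using Suc.IH[of "T -` A \<inter> space M"] assms(1)[OF Suc.prems] unfolding vimage_funpow_Suc
        by (simp del: funpow.simps)
qed

lemma vimage_sets [measurable]: "A \<in> sets M \<Longrightarrow> (T ^^ n) -` A \<inter> space M \<in> sets M"
  by measurable

end

section \<open>Bounded distortion and regular set functions\<close>

text \<open>
  Two comparisons of ratios, \<open>a / b \<le> x r / s\<close> and \<open>r / s \<le> y d / e\<close>, compose to
  \<open>a / b \<le> x y d / e\<close>. In product form the masses may vanish; if \<open>r\<close> does, \<open>a\<close> must vanish too,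
  which is absolute continuity in the applications.
\<close>

lemma cancel_chain:
  fixes a s x b r e y d :: real
  assumes "a * s \<le> x * (b * r)" "r * e \<le> y * (s * d)" "r = 0 \<Longrightarrow> a = 0"
    and "0 \<le> a" "0 \<le> s" "0 \<le> x" "0 \<le> b" "0 \<le> r" "0 \<le> e" "0 \<le> y" "0 \<le> d"
  shows "a * e \<le> x * y * (b * d)"
proof (cases "r = 0 \<or> s = 0")
  case True
  then have "a * e = 0"
    using assms by (cases "r = 0") (auto simp: mult_le_0_iff)
  then show ?thesis using assms by (metis mult_nonneg_nonneg)
next
  case False
  then have pos: "r * s > 0" using assms by auto
  have "(a * s) * (r * e) \<le> (x * (b * r)) * (y * (s * d))"
    by (intro mult_mono assms mult_nonneg_nonneg)
  then have "(a * e) * (r * s) \<le> (x * y * (b * d)) * (r * s)"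
    by (simp add: mult_ac)
  from mult_right_le_imp_le[OF this] show ?thesis using pos by (simp add: mult_ac)
qed

text \<open>
  Bounded distortion in terms of masses: within a cylinder of generation \<open>n\<close>, an inverse branch
  of \<open>T\<close> changes the ratio of the masses of two sets by a factor of at most \<open>exp (K * \<tau> ^ n)\<close>.
  This form mentions neither derivatives nor densities, so it can be used for Lebesgue measure
  and for an invariant measure alike. The empty word, whose cylinder is the whole space, gives
  the factor \<open>exp K\<close>.
\<close>

locale distortion_system = full_branch_system +
  fixes \<tau> K :: real
  assumes \<tau>: "0 < \<tau>" "\<tau> < 1" and K: "0 < K"
    and distortion: "\<And>i v D E. D \<in> sets M \<Longrightarrow> E \<in> sets M \<Longrightarrow> D \<subseteq> cyl v \<Longrightarrow> E \<subseteq> cyl v \<Longrightarrow>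
      measure M (P i \<inter> T -` D) * measure M E
        \<le> exp (K * \<tau> ^ length v) * (measure M (P i \<inter> T -` E) * measure M D)"
begin

text \<open>
  The distortion constant of all iterates at once: the errors \<open>K * \<tau> ^ k\<close> of the single steps
  form a geometric series.
\<close>

definition K1 where "K1 = K / (1 - \<tau>)"

lemma K1: "K1 > 0" "K + \<tau> * K1 = K1"
  using \<tau> K by (auto simp: K1_def field_simps)

lemma branch_null:
  assumes "D \<in> sets M" "measure M D = 0"
  shows "measure M (P i \<inter> T -` D) = 0"
proof -
  have "measure M (P i \<inter> T -` D) * measure M (space M) \<le> 0"
    using distortion[of D "space M" "[]" i] assms sets.sets_into_space[OF assms(1)] by simp
  then show ?thesis using mass_pos by (simp add: mult_le_0_iff measure_le_0_iff)
qed

text \<open>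
  Along the word \<open>w\<close> the sets are contracted, so that the step which follows \<open>k\<close> further letters
  sees a cylinder of generation \<open>k + length v\<close> and adds only \<open>K * \<tau> ^ (k + length v)\<close> to the
  exponent.
\<close>

lemma pull_distortion:
  assumes "D \<in> sets M" "E \<in> sets M" "D \<subseteq> cyl v" "E \<subseteq> cyl v"
  shows "measure M (pull w D) * measure M E
    \<le> exp (K1 * \<tau> ^ length v) * (measure M (pull w E) * measure M D)"
proof -
  let ?S = "\<lambda>n. K * \<tau> ^ length v * (\<Sum>k<n. \<tau> ^ k)"
  have "measure M (pull w D) * measure M E
    \<le> exp (?S (length w)) * (measure M (pull w E) * measure M D)"
  proof (induction w)
    case (Cons i w)
    have "measure M (P i \<inter> T -` pull w D) * measure M (pull w E)
      \<le> exp (K * \<tau> ^ length (w @ v)) * (measure M (P i \<inter> T -` pull w E) * measure M (pull w D))"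
      using assms by (intro distortion) (auto simp: pull_append intro!: pull_mono)
    from cancel_chain[OF this Cons branch_null]
    show ?case using assms
      by (simp add: exp_add[symmetric] power_add algebra_simps)
  qed simp
  also have "?S (length w) \<le> K1 * \<tau> ^ length v"
  proof -
    have "(\<Sum>k<length w. \<tau> ^ k) = (1 - \<tau> ^ length w) / (1 - \<tau>)"
      using \<tau> by (subst sum_gp_strict) auto
    also have "\<dots> \<le> 1 / (1 - \<tau>)"
      using \<tau> by (intro divide_right_mono) auto
    finally have "K * \<tau> ^ length v * (\<Sum>k<length w. \<tau> ^ k) \<le> K * \<tau> ^ length v * (1 / (1 - \<tau>))"
      using \<tau> K by (intro mult_left_mono) auto
    then show ?thesis by (simp add: K1_def)
  qed
  finally show ?thesis by (simp add: mult_right_mono)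
qed

lemma shrink_rate:
  assumes "p \<le> 1" "measure M (P s) \<le> p * measure M (space M)"
  shows "0 \<le> 1 - exp (- K1) * (1 - p)" "p < 1 \<Longrightarrow> 1 - exp (- K1) * (1 - p) < 1"
proof -
  have "0 \<le> p" using assms(2) mass_pos measure_nonneg[of M "P s"]
    by (meson order_trans zero_le_mult_iff not_less)
  then have "exp (- K1) * (1 - p) \<le> 1 * 1"
    using K1 assms(1) by (intro mult_mono) auto
  then show "0 \<le> 1 - exp (- K1) * (1 - p)" by simp
qed simp

text \<open>
  Every branch domain leaves a fixed proportion of the space uncovered. By distortion, so does
  its copy inside a cylinder, and each further letter loses a fixed proportion of the mass.
\<close>

lemma cyl_shrink:
  assumes p: "p \<le> 1" "\<And>s. measure M (P s) \<le> p * measure M (space M)"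
  shows "measure M (cyl (i # w)) \<le> (1 - exp (- K1) * (1 - p)) ^ length w * measure M (P i)"
proof (induction w rule: rev_induct)
  case Nil
  then show ?case using P_subset[of i] measurable_space[OF T_measurable]
    by (auto intro!: finite_measure_mono)
next
  case (snoc s w)
  let ?w = "i # w" and ?\<gamma> = "1 - exp (- K1) * (1 - p)"
  let ?Q = "space M - P s"
  have "measure M ?Q = measure M (space M) - measure M (P s)"
    by (rule finite_measure_compl) simp
  then have Q: "measure M ?Q \<ge> (1 - p) * measure M (space M)"
    using p(2)[of s] by (simp add: algebra_simps)
  have "measure M (cyl ?w) * measure M ?Q
      \<le> exp (K1 * \<tau> ^ length ([] :: nat list)) * (measure M (pull ?w ?Q) * measure M (space M))"
    by (rule pull_distortion) (auto simp del: pull.simps(2))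
  then have "measure M (cyl ?w) * ((1 - p) * measure M (space M))
      \<le> exp K1 * (measure M (pull ?w ?Q) * measure M (space M))"
    using mult_left_mono[OF Q, of "measure M (cyl ?w)"] by simp
  then have "measure M (cyl ?w) * (1 - p) \<le> exp K1 * measure M (pull ?w ?Q)"
    using mass_pos by (simp add: mult_ac)
  then have 1: "exp (- K1) * (1 - p) * measure M (cyl ?w) \<le> measure M (pull ?w ?Q)"
    by (simp add: exp_minus field_simps)
  have "pull ?w ?Q = cyl ?w - pull ?w (P s)" by (rule pull_Diff)
  moreover have "pull ?w (P s) \<subseteq> cyl ?w" by (rule pull_mono[OF P_subset])
  ultimately have "measure M (pull ?w ?Q) = measure M (cyl ?w) - measure M (pull ?w (P s))"
    by (simp add: finite_measure_Diff del: pull.simps)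
  with 1 have "measure M (pull ?w (P s)) \<le> ?\<gamma> * measure M (cyl ?w)"
    by (simp add: algebra_simps)
  also have "\<dots> \<le> ?\<gamma> * (?\<gamma> ^ length w * measure M (P i))"
    by (intro mult_left_mono[OF snoc] shrink_rate(1)[OF p])
  finally have "measure M (pull ?w (P s)) \<le> ?\<gamma> ^ length (w @ [s]) * measure M (P i)" by simp
  moreover have "measure M (cyl (i # w @ [s])) \<le> measure M (pull ?w (P s))"
  proof -
    have "cyl (i # w @ [s]) = pull ?w (P s \<inter> T -` space M)"
      using pull_append[of ?w "[s]" "space M"] by simp
    also have "\<dots> \<subseteq> pull ?w (P s)" by (rule pull_mono) auto
    finally show ?thesis by (intro finite_measure_mono pull_sets P_sets)
  qed
  ultimately show ?case by simp
qed

text \<open>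
  The set functions \<open>\<rho>\<close> whose density with respect to \<open>M\<close> oscillates by at most the factor
  \<open>exp (\<kappa> * \<tau> ^ n)\<close> on cylinders of generation \<open>n\<close>. Real set functions instead of measures make
  it possible to form differences; the cross-multiplied inequality avoids densities and
  division.
\<close>

definition regular :: "real \<Rightarrow> ('a set \<Rightarrow> real) \<Rightarrow> bool" where
  "regular \<kappa> \<rho> \<longleftrightarrow> (\<forall>A\<in>sets M. 0 \<le> \<rho> A) \<and>
     (\<forall>A::nat \<Rightarrow> 'a set. range A \<subseteq> sets M \<and> disjoint_family A \<longrightarrow> (\<lambda>i. \<rho> (A i)) sums \<rho> (\<Union>i. A i)) \<and>
     (\<forall>v D E. D \<in> sets M \<and> E \<in> sets M \<and> D \<subseteq> cyl v \<and> E \<subseteq> cyl v \<longrightarrow>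
        \<rho> D * measure M E \<le> exp (\<kappa> * \<tau> ^ length v) * (\<rho> E * measure M D))"

lemma regular_nonneg: "regular \<kappa> \<rho> \<Longrightarrow> A \<in> sets M \<Longrightarrow> 0 \<le> \<rho> A"
  by (simp add: regular_def)

lemma regular_sums:
  "regular \<kappa> \<rho> \<Longrightarrow> range A \<subseteq> sets M \<Longrightarrow> disjoint_family (A :: nat \<Rightarrow> _) \<Longrightarrow>
     (\<lambda>i. \<rho> (A i)) sums \<rho> (\<Union>i. A i)"
  by (simp add: regular_def)

lemma regular_ineq:
  "regular \<kappa> \<rho> \<Longrightarrow> D \<in> sets M \<Longrightarrow> E \<in> sets M \<Longrightarrow> D \<subseteq> cyl v \<Longrightarrow> E \<subseteq> cyl v \<Longrightarrow>
     \<rho> D * measure M E \<le> exp (\<kappa> * \<tau> ^ length v) * (\<rho> E * measure M D)"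
  by (simp add: regular_def)

lemma regular_bounds:
  assumes "regular \<kappa> \<rho>" "A \<in> sets M"
  shows "\<rho> A * measure M (space M) \<le> exp \<kappa> * (\<rho> (space M) * measure M A)"
    and "\<rho> (space M) * measure M A \<le> exp \<kappa> * (\<rho> A * measure M (space M))"
  using regular_ineq[OF assms(1), of A "space M" "[]"] regular_ineq[OF assms(1), of "space M" A
      "[]"]
    assms(2) sets.sets_into_space[OF assms(2)] by simp_all

lemma regular_null:
  assumes "regular \<kappa> \<rho>" "A \<in> sets M" "measure M A = 0"
  shows "\<rho> A = 0"
  using regular_bounds(1)[OF assms(1,2)] regular_nonneg[OF assms(1,2)] mass_pos assms(3)
  by (simp add: mult_le_0_iff)

lemma regular_mono:
  assumes "regular \<kappa> \<rho>" "\<kappa> \<le> \<kappa>'"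
  shows "regular \<kappa>' \<rho>"
  unfolding regular_def
proof (intro conjI allI impI)
  fix v D E assume *: "D \<in> sets M \<and> E \<in> sets M \<and> D \<subseteq> cyl v \<and> E \<subseteq> cyl v"
  then have "\<rho> D * measure M E \<le> exp (\<kappa> * \<tau> ^ length v) * (\<rho> E * measure M D)"
    using regular_ineq[OF assms(1)] by blast
  also have "\<dots> \<le> exp (\<kappa>' * \<tau> ^ length v) * (\<rho> E * measure M D)"
    using assms \<tau> * by (intro mult_right_mono) (auto simp: regular_nonneg intro!: mult_right_mono
        mult_nonneg_nonneg)
  finally show "\<rho> D * measure M E \<le> exp (\<kappa>' * \<tau> ^ length v) * (\<rho> E * measure M D)" .
qed (use assms in \<open>auto simp: regular_def\<close>)

text \<open>
  Passing to the image under \<open>T\<close> moves a cylinder of generation \<open>n + 1\<close> to one of generation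
  \<open>n\<close>, which multiplies the old constant by \<open>\<tau>\<close>; the distortion of the branch adds \<open>K\<close>. As
  \<open>\<kappa> * \<tau> + K\<close> has an attracting fixed point, iterates forget the initial constant.
\<close>

lemma regular_push:
  assumes "regular \<kappa> \<rho>"
  shows "regular (\<kappa> * \<tau> + K) (\<lambda>A. \<rho> (T -` A \<inter> space M))"
  unfolding regular_def
proof (intro conjI allI impI ballI)
  fix A assume "A \<in> sets M"
  then show "0 \<le> \<rho> (T -` A \<inter> space M)"
    by (intro regular_nonneg[OF assms]) measurable
next
  fix A :: "nat \<Rightarrow> 'a set" assume A: "range A \<subseteq> sets M \<and> disjoint_family A"
  have "(\<lambda>i. \<rho> (T -` A i \<inter> space M)) sums \<rho> (\<Union>i. T -` A i \<inter> space M)"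
    using A by (intro regular_sums[OF assms])
      (auto simp: disjoint_family_on_def intro!: measurable_sets[OF T_measurable])
  moreover have "(\<Union>i. T -` A i \<inter> space M) = T -` (\<Union>i. A i) \<inter> space M" by auto
  ultimately show "(\<lambda>i. \<rho> (T -` A i \<inter> space M)) sums \<rho> (T -` (\<Union>i. A i) \<inter> space M)" by simp
next
  fix v D E assume *: "D \<in> sets M \<and> E \<in> sets M \<and> D \<subseteq> cyl v \<and> E \<subseteq> cyl v"
  let ?e = "exp ((\<kappa> * \<tau> + K) * \<tau> ^ length v)"
  have branch: "\<rho> (P i \<inter> T -` D) * measure M E \<le> ?e * (\<rho> (P i \<inter> T -` E) * measure M D)" for i
  proof -
    have 1: "\<rho> (P i \<inter> T -` D) * measure M (P i \<inter> T -` E)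
      \<le> exp (\<kappa> * \<tau> ^ length (i # v)) * (\<rho> (P i \<inter> T -` E) * measure M (P i \<inter> T -` D))"
      using * by (intro regular_ineq[OF assms]) (auto simp: branch_sets)
    have 2: "measure M (P i \<inter> T -` D) * measure M E
        \<le> exp (K * \<tau> ^ length v) * (measure M (P i \<inter> T -` E) * measure M D)"
      using * distortion by blast
    from cancel_chain[OF 1 2 regular_null[OF assms]] *
    show ?thesis
      by (simp add: regular_nonneg[OF assms] branch_sets exp_add[symmetric] algebra_simps)
  qed
  have sums: "(\<lambda>i. \<rho> (P i \<inter> T -` A)) sums \<rho> (T -` A \<inter> space M)" if "A \<in> sets M" for A
  proof -
    have "(\<lambda>i. \<rho> (P i \<inter> T -` A)) sums \<rho> (\<Union>i. P i \<inter> T -` A)"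
      using that P_disjoint by (intro regular_sums[OF assms])
        (auto simp: disjoint_family_on_def branch_sets)
    moreover have "(\<Union>i. P i \<inter> T -` A) = T -` A \<inter> space M" using P_cover by auto
    ultimately show ?thesis by simp
  qed
  have l: "(\<lambda>i. \<rho> (P i \<inter> T -` D) * measure M E) sums (\<rho> (T -` D \<inter> space M) * measure M E)"
    using * by (intro sums_mult2 sums) auto
  have r: "(\<lambda>i. ?e * (\<rho> (P i \<inter> T -` E) * measure M D)) sums
      (?e * (\<rho> (T -` E \<inter> space M) * measure M D))"
    using * by (intro sums_mult2 sums_mult sums) auto
  show "\<rho> (T -` D \<inter> space M) * measure M E \<le> ?e * (\<rho> (T -` E \<inter> space M) * measure M D)"
    by (rule sums_le[OF branch l r])
qed

lemma regular_push_funpow: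
  assumes "regular \<kappa> \<rho>"
  shows "regular (\<kappa> * \<tau> ^ n + K1) (\<lambda>A. \<rho> ((T ^^ n) -` A \<inter> space M))"
proof (induction n)
  case 0
  have "regular (\<kappa> + K1) (\<lambda>A. \<rho> A)" by (rule regular_mono[OF assms]) (use K1 in simp)
  moreover have "A \<inter> space M = A" if "A \<in> sets M" for A
    using that by (rule sets.Int_space_eq2)
  ultimately show ?case
    by (auto simp: regular_def image_subset_iff sets.Int_space_eq2 sets.countable_UN)
next
  case (Suc n)
  have "(\<kappa> * \<tau> ^ n + K1) * \<tau> + K = \<kappa> * \<tau> ^ Suc n + K1"
    using K1(2) by (simp add: algebra_simps)
  with regular_push[OF Suc] show ?case unfolding vimage_funpow_Suc by (simp only:)
qed

lemma regular_pull: "regular K1 (\<lambda>A. measure M (pull w A))"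
  unfolding regular_def
proof (intro conjI allI impI)
  fix A :: "nat \<Rightarrow> 'a set" assume A: "range A \<subseteq> sets M \<and> disjoint_family A"
  have "pull w (\<Union>i. A i) = (\<Union>i. pull w (A i))" by (induction w) auto
  moreover have "disjoint_family (\<lambda>i. pull w (A i))"
  proof -
    have "pull w C \<inter> pull w D = pull w (C \<inter> D)" for C D by (induction w) auto
    moreover have "pull w {} = {}" by (induction w) auto
    ultimately show ?thesis using A by (auto simp: disjoint_family_on_def)
  qed
  ultimately show "(\<lambda>i. measure M (pull w (A i))) sums measure M (pull w (\<Union>i. A i))"
    using A finite_measure_UNION[of "\<lambda>i. pull w (A i)"] by (auto simp: pull_sets image_subset_iff)
qed (use pull_distortion in auto)

end

section \<open>Exponential mixing\<close>

locale mixing_system = distortion_system +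
  assumes prob: "measure M (space M) = 1"
    and invariant: "\<And>A. A \<in> sets M \<Longrightarrow> measure M (T -` A \<inter> space M) = measure M A"
begin

lemma invariant_funpow: "A \<in> sets M \<Longrightarrow> measure M ((T ^^ n) -` A \<inter> space M) = measure M A"
  by (rule invariant_vimage_funpow[where \<rho> = "measure M", OF invariant])

text \<open>
  A regular probability with constant \<open>2 * K1\<close> has density at least \<open>exp (- (2 * K1))\<close>. Half of
  this bound is split off, so that the remainder still has a positive lower bound.
\<close>

definition overlap where "overlap = exp (- (2 * K1)) / 2"

lemma overlap: "0 < overlap" "overlap < 1"
proof -
  show "0 < overlap" by (simp add: overlap_def)
  have "exp (- (2 * K1)) \<le> 1" using K1 by simp
  then show "overlap < 1" unfolding overlap_def by linarith
qed

text \<open>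
  Removing half of the guaranteed part of the density at most doubles its logarithmic
  oscillation: if \<open>x\<close> bounds the ratio of two values that are at least \<open>2 * overlap\<close>, then \<open>x\<^sup>2\<close>
  bounds the ratio of the values reduced by \<open>overlap\<close>, because \<open>2 * x - 1 \<le> x\<^sup>2\<close>.
\<close>

lemma regular_subtract:
  assumes \<rho>: "regular (2 * K1) \<rho>" "\<rho> (space M) = 1"
  shows "regular (4 * K1) (\<lambda>A. (\<rho> A - overlap * measure M A) / (1 - overlap))"
  unfolding regular_def
proof (intro conjI allI impI ballI)
  have lower: "2 * overlap * measure M A \<le> \<rho> A" if "A \<in> sets M" for A
    using regular_bounds(2)[OF \<rho>(1) that] \<rho>(2) prob
    by (simp add: overlap_def exp_minus field_simps)
  {
    fix A assume A: "A \<in> sets M"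
    have "overlap * measure M A \<le> 2 * overlap * measure M A" using overlap by simp
    then show "0 \<le> (\<rho> A - overlap * measure M A) / (1 - overlap)"
      using lower[OF A] overlap by (intro divide_nonneg_pos) linarith+
  next
    fix A :: "nat \<Rightarrow> 'a set" assume "range A \<subseteq> sets M \<and> disjoint_family A"
    then show "(\<lambda>i. (\<rho> (A i) - overlap * measure M (A i)) / (1 - overlap)) sums
        ((\<rho> (\<Union>i. A i) - overlap * measure M (\<Union>i. A i)) / (1 - overlap))"
      by (intro sums_divide sums_diff sums_mult regular_sums[OF \<rho>(1)] finite_measure_UNION) auto
  next
    fix v D E assume *: "D \<in> sets M \<and> E \<in> sets M \<and> D \<subseteq> cyl v \<and> E \<subseteq> cyl v"
    let ?a = "2 * K1 * \<tau> ^ length v" and ?m = "measure M"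
    define x where "x = exp ?a"
    have x: "1 \<le> x" using K1 \<tau> by (simp add: x_def)
    have 1: "\<rho> D * ?m E \<le> x * (\<rho> E * ?m D)"
      unfolding x_def using * by (intro regular_ineq[OF \<rho>(1)]) auto
    have 2: "2 * overlap * ?m E * ?m D \<le> \<rho> E * ?m D"
      using lower[of E] * by (intro mult_right_mono) auto
    have "(x * x - x) * (2 * overlap * ?m E * ?m D) \<le> (x * x - x) * (\<rho> E * ?m D)"
      using x by (intro mult_left_mono[OF 2]) (auto simp: mult_le_cancel_left1)
    moreover have "(x * x - 1) * overlap * ?m E * ?m D + (x - 1) * (x - 1) * overlap * ?m E * ?m D
        = (x * x - x) * (2 * overlap * ?m E * ?m D)"
      by (simp add: algebra_simps)
    moreover have "0 \<le> (x - 1) * (x - 1) * overlap * ?m E * ?m D"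
      using x overlap by auto
    ultimately have "(x * x - 1) * overlap * ?m E * ?m D \<le> (x * x - x) * (\<rho> E * ?m D)" by linarith
    with 1 have "(\<rho> D - overlap * ?m D) * ?m E \<le> (x * x) * ((\<rho> E - overlap * ?m E) * ?m D)"
      by (simp add: algebra_simps)
    then have "((\<rho> D - overlap * ?m D) * ?m E) / (1 - overlap)
        \<le> ((x * x) * ((\<rho> E - overlap * ?m E) * ?m D)) / (1 - overlap)"
      using overlap by (intro divide_right_mono) auto
    moreover have "x * x = exp (4 * K1 * \<tau> ^ length v)"
      by (simp add: x_def exp_add[symmetric])
    ultimately show "(\<rho> D - overlap * ?m D) / (1 - overlap) * ?m E
        \<le> exp (4 * K1 * \<tau> ^ length v) * ((\<rho> E - overlap * ?m E) / (1 - overlap) * ?m D)"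
      by simp
  }
qed

text \<open>
  The number of iterates after which the constant \<open>4 * K1\<close> of the remainder has fallen back to
  \<open>2 * K1\<close>.
\<close>

definition block :: nat where "block = (SOME n. 0 < n \<and> 4 * \<tau> ^ n \<le> 1)"

lemma block: "0 < block" "4 * \<tau> ^ block \<le> 1"
proof -
  have "(\<lambda>n. \<tau> ^ n) \<longlonglongrightarrow> 0" using \<tau> by (intro LIMSEQ_realpow_zero) auto
  then have "eventually (\<lambda>n. \<tau> ^ n < 1 / 4) sequentially" by (rule order_tendstoD) simp
  then have "eventually (\<lambda>n. 0 < n \<and> 4 * \<tau> ^ n \<le> 1) sequentially"
    using eventually_gt_at_top[of 0] by eventually_elim auto
  then have "\<exists>n. 0 < n \<and> 4 * \<tau> ^ n \<le> 1" by (rule eventually_happens'[rotated]) simp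
  from someI_ex[OF this] show "0 < block" "4 * \<tau> ^ block \<le> 1" by (auto simp: block_def)
qed

text \<open>
  The coupling step: after \<open>block\<close> iterates a regular probability is a convex combination of the
  invariant one, with the fixed weight \<open>overlap\<close>, and another probability from the same class.
\<close>

lemma regular_step:
  assumes \<rho>: "regular (2 * K1) \<rho>" "\<rho> (space M) = 1"
  obtains \<rho>' where "regular (2 * K1) \<rho>'" "\<rho>' (space M) = 1"
    "\<And>A. A \<in> sets M \<Longrightarrow> \<rho> ((T ^^ block) -` A \<inter> space M) = overlap * measure M A
        + (1 - overlap) * \<rho>' A"
proof
  define \<sigma> where "\<sigma> = (\<lambda>A. (\<rho> A - overlap * measure M A) / (1 - overlap))"
  define \<rho>' where "\<rho>' = (\<lambda>A. \<sigma> ((T ^^ block) -` A \<inter> space M))"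
  have "regular (4 * K1 * \<tau> ^ block + K1) \<rho>'"
    unfolding \<rho>'_def by (rule regular_push_funpow) (use regular_subtract[OF \<rho>] in \<open>simp add: \<sigma>_def\<close>)
  moreover have "4 * K1 * \<tau> ^ block + K1 \<le> 2 * K1"
    using mult_left_mono[OF block(2), of K1] K1 by (simp add: algebra_simps)
  ultimately show "regular (2 * K1) \<rho>'" by (rule regular_mono)
  have "(T ^^ block) -` space M \<inter> space M = space M"
    using measurable_space[OF funpow_measurable] by auto
  then show "\<rho>' (space M) = 1" using overlap \<rho>(2) prob by (simp add: \<rho>'_def \<sigma>_def)
  show "\<rho> ((T ^^ block) -` A \<inter> space M) = overlap * measure M A + (1 - overlap) * \<rho>' A"
      if "A \<in> sets M" for A
    using overlap invariant_funpow[OF that] by (simp add: \<rho>'_def \<sigma>_def)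
qed

lemma regular_converge_block:
  assumes "regular (2 * K1) \<rho>" "\<rho> (space M) = 1" "A \<in> sets M"
  shows "\<rho> ((T ^^ (block * k)) -` A \<inter> space M) \<le> (1
      + exp (2 * K1) * (1 - overlap) ^ k) * measure M A"
  using assms
proof (induction k arbitrary: \<rho>)
  case 0
  have "\<rho> A \<le> exp (2 * K1) * measure M A"
    using regular_bounds(1)[OF 0(1,3)] 0(2) prob by simp
  also have "\<dots> \<le> (1 + exp (2 * K1)) * measure M A"
    by (intro mult_right_mono) auto
  finally show ?case using 0(3) by (simp add: sets.Int_space_eq2)
next
  case (Suc k)
  obtain \<rho>' where \<rho>': "regular (2 * K1) \<rho>'" "\<rho>' (space M) = 1"
    "\<And>A. A \<in> sets M \<Longrightarrow> \<rho> ((T ^^ block) -` A \<inter> space M) = overlap * measure M A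
        + (1 - overlap) * \<rho>' A"
    using regular_step[OF Suc.prems(1,2)] by blast
  let ?B = "(T ^^ (block * k)) -` A \<inter> space M"
  have B: "?B \<in> sets M" using Suc.prems(3) by measurable
  have "(T ^^ (block * Suc k)) -` A \<inter> space M = (T ^^ block) -` ?B \<inter> space M"
    using measurable_space[OF funpow_measurable[of block]]
    using funpow_add[of "block * k" block T] by (auto simp: add.commute)
  then have "\<rho> ((T ^^ (block * Suc k)) -` A \<inter> space M) = overlap * measure M A
      + (1 - overlap) * \<rho>' ?B"
    using \<rho>'(3)[OF B] invariant_funpow[OF Suc.prems(3)] by simp
  also have "\<dots> \<le> overlap * measure M A + (1 - overlap) * ((1
      + exp (2 * K1) * (1 - overlap) ^ k) * measure M A)"
    using Suc.IH[OF \<rho>'(1,2) Suc.prems(3)] overlap by (intro add_left_mono mult_left_mono) auto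
  also have "\<dots> = (1 + exp (2 * K1) * (1 - overlap) ^ Suc k) * measure M A"
    by (simp add: algebra_simps)
  finally show ?case .
qed

lemma regular_converge:
  assumes "regular (2 * K1) \<rho>" "\<rho> (space M) = 1" "A \<in> sets M"
  shows "\<rho> ((T ^^ n) -` A \<inter> space M) \<le> (1 + exp (2 * K1) * (1 - overlap) ^ (n div block)) *
      measure M A"
proof -
  let ?B = "(T ^^ (n mod block)) -` A \<inter> space M"
  have B: "?B \<in> sets M" using assms(3) by measurable
  have n: "(T ^^ n) x = (T ^^ (n mod block)) ((T ^^ (block * (n div block))) x)" for x
    using funpow_add[of "n mod block" "block * (n div block)" T] by simp
  have "(T ^^ n) -` A \<inter> space M = (T ^^ (block * (n div block))) -` ?B \<inter> space M"
    using measurable_space[OF funpow_measurable[of "block * (n div block)"]]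
    by (auto simp: n)
  then show ?thesis
    using regular_converge_block[OF assms(1,2) B, of "n div block"] invariant_funpow[OF assms(3)]
        by simp
qed

text \<open>
  The normalised image of a cylinder is regular with constant \<open>K1\<close>, whatever the cylinder is,
  and therefore converges to the invariant measure at a common geometric rate. The upper bound
  suffices, since variances are only to be bounded from above.
\<close>

lemma cylinder_mixing:
  "\<exists>C\<ge>1. \<exists>\<theta>. 0 < \<theta> \<and> \<theta> < 1 \<and> (\<forall>w n A. A \<in> sets M \<longrightarrow>
     measure M (pull w ((T ^^ n) -` A \<inter> space M)) \<le> (1
         + C * \<theta> ^ n) * (measure M (cyl w) * measure M A))"
proof -
  define \<theta> where "\<theta> = root block (1 - overlap)"
  define C where "C = exp (2 * K1) / (1 - overlap)"
  have \<theta>: "0 < \<theta>" "\<theta> < 1" "\<theta> ^ block = 1 - overlap"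
    using overlap block by (auto simp: \<theta>_def)
  have C: "1 \<le> C" 
  proof -
    have "1 \<le> exp (2 * K1)" using K1 by simp
    then have "1 - overlap \<le> exp (2 * K1)" using overlap by linarith
    then show ?thesis using overlap by (simp add: C_def)
  qed
  have rate: "exp (2 * K1) * (1 - overlap) ^ (n div block) \<le> C * \<theta> ^ n" for n
  proof -
    have "(1 - overlap) ^ Suc (n div block) = \<theta> ^ (block * Suc (n div block))"
      by (simp only: power_mult \<theta>(3))
    also have "\<dots> \<le> \<theta> ^ n"
    proof (rule power_decreasing)
      show "n \<le> block * Suc (n div block)"
        using block(1) by (metis dividend_less_times_div less_imp_le mult_Suc_right add.commute)
    qed (use \<theta> in auto)
    finally have "(1 - overlap) ^ (n div block) \<le> \<theta> ^ n / (1 - overlap)" using overlap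
        by (simp add: field_simps)
    then show ?thesis using mult_left_mono[of _ _ "exp (2 * K1)"] by (fastforce simp: C_def)
  qed
  show ?thesis
  proof (rule exI[of _ C], intro conjI C, rule exI[of _ \<theta>], intro conjI allI impI \<theta>)
    fix w n A assume A: "A \<in> sets M"
    show "measure M (pull w ((T ^^ n) -` A \<inter> space M)) \<le> (1
        + C * \<theta> ^ n) * (measure M (cyl w) * measure M A)"
    proof (cases "measure M (cyl w) = 0")
      case True
      have "measure M (pull w ((T ^^ n) -` A \<inter> space M)) \<le> measure M (cyl w)"
        by (intro finite_measure_mono pull_mono) auto
      then show ?thesis using True by simp
    next
      case False
      then have pos: "0 < measure M (cyl w)" by (simp add: zero_less_measure_iff)
      define \<rho> where "\<rho> = (\<lambda>A. measure M (pull w A) / measure M (cyl w))"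
      have "regular K1 \<rho>"
        unfolding regular_def
      proof (intro conjI allI impI ballI)
        fix A :: "nat \<Rightarrow> 'a set" assume "range A \<subseteq> sets M \<and> disjoint_family A"
        then show "(\<lambda>i. \<rho> (A i)) sums \<rho> (\<Union>i. A i)"
          unfolding \<rho>_def by (intro sums_divide regular_sums[OF regular_pull]) auto
      next
        fix v D E assume *: "D \<in> sets M \<and> E \<in> sets M \<and> D \<subseteq> cyl v \<and> E \<subseteq> cyl v"
        have "measure M (pull w D) * measure M E / measure M (cyl w)
          \<le> exp (K1 * \<tau> ^ length v) * (measure M (pull w E) * measure M D) / measure M (cyl w)"
          using * by (intro divide_right_mono regular_ineq[OF regular_pull]) auto
        then show "\<rho> D * measure M E \<le> exp (K1 * \<tau> ^ length v) * (\<rho> E * measure M D)"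
          by (simp add: \<rho>_def)
      qed (auto simp: \<rho>_def)
      then have "regular (2 * K1) \<rho>" using K1 by (rule_tac regular_mono) auto
      moreover have "\<rho> (space M) = 1" using pos by (simp add: \<rho>_def)
      ultimately have "\<rho> ((T ^^ n) -` A \<inter> space M)
          \<le> (1 + exp (2 * K1) * (1 - overlap) ^ (n div block)) * measure M A"
        using A by (rule regular_converge)
      also have "\<dots> \<le> (1 + C * \<theta> ^ n) * measure M A"
        using rate[of n] by (intro mult_right_mono) auto
      finally show ?thesis using pos by (simp add: \<rho>_def field_simps)
    qed
  qed
qed

lemma union_cyl_mixing:
  assumes mix: "\<And>w n A. A \<in> sets M \<Longrightarrow>
      measure M (pull w ((T ^^ n) -` A \<inter> space M)) \<le> (1
          + C * \<theta> ^ n) * (measure M (cyl w) * measure M A)"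
    and "0 \<le> C" "0 \<le> \<theta>" and A: "A \<in> sets M" and W: "\<And>w. w \<in> W \<Longrightarrow> length w = n"
  shows "measure M ((\<Union>w\<in>W. cyl w) \<inter> (T ^^ (n + k)) -` A)
    \<le> (1 + C * \<theta> ^ k) * (measure M (\<Union>w\<in>W. cyl w) * measure M A)"
proof -
  let ?A = "(T ^^ k) -` A \<inter> space M" and ?q = "(1 + C * \<theta> ^ k) * measure M A"
  have A': "?A \<in> sets M" using A by measurable
  have q: "0 \<le> ?q" using assms by simp
  have eq: "(\<Union>w\<in>W. cyl w) \<inter> (T ^^ (n + k)) -` A = (\<Union>w\<in>W. pull w ?A)"
  proof -
    have "pull w ?A = cyl w \<inter> (T ^^ (n + k)) -` A" if "w \<in> W" for w
    proof -
      have "(T ^^ n) x \<in> space M" if "x \<in> cyl w" for x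
        using that pull_subset[of "space M" w] measurable_space[OF funpow_measurable] by auto
      then show ?thesis
        using W[OF that] pull_eq[of ?A w] by (auto simp: add.commute[of n k] funpow_add)
    qed
    then show ?thesis by auto
  qed
  have disj: "disjoint_family_on (\<lambda>w. pull w B) W" for B
    using W pull_disjoint by (auto simp: disjoint_family_on_def)
  have "emeasure M (\<Union>w\<in>W. pull w ?A) = (\<integral>\<^sup>+w. emeasure M (pull w ?A) \<partial>count_space W)"
    using A' by (intro emeasure_UN_countable disj) auto
  also have "\<dots> \<le> (\<integral>\<^sup>+w. ennreal ?q * emeasure M (cyl w) \<partial>count_space W)"
  proof (intro nn_integral_mono)
    fix w
    have "measure M (pull w ?A) \<le> ?q * measure M (cyl w)"
      using mix[OF A, of w k] by (simp add: mult_ac)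
    then show "emeasure M (pull w ?A) \<le> ennreal ?q * emeasure M (cyl w)"
      using q by (simp add: emeasure_eq_measure ennreal_mult'[symmetric] ennreal_leI)
  qed
  also have "\<dots> = ennreal ?q * emeasure M (\<Union>w\<in>W. cyl w)"
    by (subst emeasure_UN_countable[OF _ _ disj]) (auto simp: nn_integral_cmult)
  finally have "ennreal (measure M (\<Union>w\<in>W. pull w ?A)) \<le> ennreal (?q * measure M (\<Union>w\<in>W. cyl w))"
    using q by (simp add: emeasure_eq_measure ennreal_mult')
  then have "measure M (\<Union>w\<in>W. pull w ?A) \<le> ?q * measure M (\<Union>w\<in>W. cyl w)"
    using q by (subst (asm) ennreal_le_iff) auto
  then show ?thesis unfolding eq by (simp add: mult_ac)
qed

text \<open>
  Within each branch domain all but at most two cylinders of a given generation lie either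
  inside \<open>A\<close> or outside of it. This is what remains of the geometry of intervals in the mixing
  argument.
\<close>

definition few_boundary :: "'a set \<Rightarrow> bool" where
  "few_boundary A \<longleftrightarrow> (\<forall>i n. \<exists>u v. \<forall>w. length w = n \<and> cyl (i # w) \<inter> A \<noteq> {} \<and> \<not> cyl (i # w) \<subseteq> A
      \<longrightarrow> w = u \<or> w = v)"

lemma boundary_measure:
  assumes p: "p < 1" "\<And>s. measure M (P s) \<le> p" and A: "A \<in> sets M" "few_boundary A"
  defines "\<gamma> \<equiv> 1 - exp (- K1) * (1 - p)"
  shows "measure M (\<Union>w\<in>{w. length w = Suc n \<and> cyl w \<inter> A \<noteq> {} \<and> \<not> cyl w \<subseteq> A}. cyl w) \<le> 2 * \<gamma> ^ n"
proof -
  let ?Bd = "{w. length w = Suc n \<and> cyl w \<inter> A \<noteq> {} \<and> \<not> cyl w \<subseteq> A}"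
  let ?U = "\<lambda>i. \<Union>w\<in>{w. i # w \<in> ?Bd}. cyl (i # w)"
  have eq: "(\<Union>w\<in>?Bd. cyl w) = (\<Union>i. ?U i)"
  proof (intro equalityI subsetI)
    fix x assume "x \<in> (\<Union>w\<in>?Bd. cyl w)"
    then obtain w where w: "w \<in> ?Bd" "x \<in> cyl w" by blast
    then obtain i w' where "w = i # w'" by (cases w) auto
    with w show "x \<in> (\<Union>i. ?U i)" by blast
  qed blast
  have shrink: "measure M (cyl (i # w)) \<le> \<gamma> ^ length w * measure M (P i)" for i w
    unfolding \<gamma>_def using p prob by (intro cyl_shrink) auto
  have \<gamma>: "0 \<le> \<gamma>" unfolding \<gamma>_def using p prob by (intro shrink_rate(1)) auto
  have Usets: "?U i \<in> sets M" for i
    by (intro sets.countable_UN' ) auto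
  have U: "measure M (?U i) \<le> 2 * \<gamma> ^ n * measure M (P i)" for i
  proof -
    obtain u v where uv: "\<And>w. length w = n \<and> cyl (i # w) \<inter> A \<noteq> {} \<and> \<not> cyl (i # w) \<subseteq> A
      \<Longrightarrow> w = u \<or> w = v" using A(2) unfolding few_boundary_def by metis
    let ?S = "{w. i # w \<in> ?Bd}"
    have S: "?S \<subseteq> {u, v}" using uv by auto
    have fin: "finite ?S" and card: "card ?S \<le> 2"
      using finite_subset[OF S] card_mono[OF _ S] card_insert_le_m1[of 2 "{v}" u]
      by (auto intro: order_trans)
    have "measure M (?U i) \<le> (\<Sum>w\<in>?S. measure M (cyl (i # w)))"
      using fin by (intro measure_UNION_le) auto
    also have "\<dots> \<le> (\<Sum>w\<in>?S. \<gamma> ^ n * measure M (P i))"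
    proof (rule sum_mono)
      fix w assume "w \<in> ?S"
      then show "measure M (cyl (i # w)) \<le> \<gamma> ^ n * measure M (P i)"
        using shrink[of i w] by simp
    qed
    also have "\<dots> \<le> 2 * (\<gamma> ^ n * measure M (P i))"
      using card \<gamma> by (simp add: mult_right_mono)
    finally show ?thesis by simp
  qed
  have sums: "(\<lambda>i. measure M (P i)) sums 1"
    using finite_measure_UNION[of P] P_disjoint P_cover prob by (auto simp: image_subset_iff)
  then have sums2: "(\<lambda>i. 2 * \<gamma> ^ n * measure M (P i)) sums (2 * \<gamma> ^ n)"
    using sums_mult[OF sums, of "2 * \<gamma> ^ n"] by simp
  have summ: "summable (\<lambda>i. measure M (?U i))"
    by (rule summable_comparison_test'[OF sums_summable[OF sums2]]) (use U in auto)
  have "measure M (\<Union>i. ?U i) \<le> (\<Sum>i. measure M (?U i))"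
    using Usets summ by (intro finite_measure_subadditive_countably) auto
  also have "\<dots> \<le> 2 * \<gamma> ^ n"
    using suminf_le[OF U summ sums_summable[OF sums2]] sums_unique[OF sums2] by simp
  finally show ?thesis unfolding eq .
qed

text \<open>
  Half of the \<open>k\<close> iterates are used to resolve \<open>A\<close> into cylinders and half for mixing. On the
  cylinders that cross the boundary of \<open>A\<close> the trivial factor \<open>1 + C\<close> suffices, because their
  total mass is exponentially small. The error is proportional to the measure of \<open>B\<close>, which
  makes the correlations of rare events summable.
\<close>

theorem few_boundary_mixing:
  assumes p: "p < 1" "\<And>s. measure M (P s) \<le> p"
  shows "\<exists>C\<ge>0. \<exists>\<theta>. 0 < \<theta> \<and> \<theta> < 1 \<and> (\<forall>A B k. A \<in> sets M \<longrightarrow> few_boundary A \<longrightarrow> B \<in> sets M \<longrightarrow>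
     measure M (A \<inter> (T ^^ k) -` B) \<le> measure M A * measure M B + C * \<theta> ^ k * measure M B)"
proof -
  obtain C \<theta> where C: "C \<ge> 1" and \<theta>: "0 < \<theta>" "\<theta> < 1" and mix: "\<And>w n A. A \<in> sets M \<Longrightarrow>
     measure M (pull w ((T ^^ n) -` A \<inter> space M)) \<le> (1
         + C * \<theta> ^ n) * (measure M (cyl w) * measure M A)"
    using cylinder_mixing by blast
  define \<gamma> where "\<gamma> = 1 - exp (- K1) * (1 - p)"
  define \<eta> where "\<eta> = max \<theta> \<gamma>"
  have \<eta>: "0 < \<eta>" "\<eta> < 1" using \<theta> p by (auto simp: \<eta>_def \<gamma>_def)
  have \<gamma>: "0 \<le> \<gamma>" unfolding \<gamma>_def using p prob by (intro shrink_rate(1)) auto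
  \<comment> \<open>only half of the iterates contribute to each of the two rates, hence the square root\<close>
  define r where "r = sqrt \<eta>"
  have r: "0 < r" "r < 1" "r ^ 2 = \<eta>" using \<eta> by (auto simp: r_def)
  \<comment> \<open>the factor \<open>r ^ 3\<close> compensates the rounding in \<open>k div 2\<close> and the first letter of a
    word, which does not contribute to the shrinking of its cylinder\<close>
  define D where "D = (C + (1 + C) * 2) / r ^ 3"
  have D: "0 \<le> D" using C r by (auto simp: D_def)
  have main: "measure M (A \<inter> (T ^^ k) -` B) \<le> measure M A * measure M B + D * r ^ k * measure M B"
    if A: "A \<in> sets M" "few_boundary A" and B: "B \<in> sets M" for A B k
  proof -
    define n where "n = k div 2"
    define j where "j = k - n"
    let ?I = "{w. length w = n \<and> cyl w \<subseteq> A}"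
    let ?Bd = "{w. length w = n \<and> cyl w \<inter> A \<noteq> {} \<and> \<not> cyl w \<subseteq> A}"
    have k: "k = n + j" by (simp add: n_def j_def)
    have Usets: "(\<Union>w\<in>W. cyl w) \<in> sets M" for W :: "nat list set"
      by (intro sets.countable_UN') auto
    have BS: "(\<Union>w\<in>W. cyl w) \<inter> (T ^^ k) -` B \<in> sets M" for W :: "nat list set"
    proof -
      have "(\<Union>w\<in>W. cyl w) \<inter> ((T ^^ k) -` B \<inter> space M) \<in> sets M"
        using Usets B by (intro sets.Int vimage_sets)
      moreover have "(\<Union>w\<in>W. cyl w) \<inter> ((T ^^ k) -` B \<inter> space M) = (\<Union>w\<in>W. cyl w) \<inter> (T ^^ k) -` B"
        using pull_subset by blast
      ultimately show ?thesis by simp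
    qed
    have sub: "A \<inter> (T ^^ k) -` B \<subseteq> ((\<Union>w\<in>?I. cyl w) \<inter> (T ^^ k) -` B) \<union> ((\<Union>w\<in>?Bd. cyl w) \<inter> (T ^^ k)
        -` B)"
    proof
      fix x assume x: "x \<in> A \<inter> (T ^^ k) -` B"
      then have "x \<in> space M" using A sets.sets_into_space by auto
      then obtain w where "length w = n" "x \<in> cyl w" using cyl_exists by blast
      with x show "x \<in> ((\<Union>w\<in>?I. cyl w) \<inter> (T ^^ k) -` B) \<union> ((\<Union>w\<in>?Bd. cyl w) \<inter> (T ^^ k) -` B)"
        by (cases "cyl w \<subseteq> A") auto
    qed
    have \<theta>\<eta>: "\<theta> ^ j \<le> r ^ k"
    proof -
      have "\<theta> ^ j \<le> \<eta> ^ j" using \<theta> by (intro power_mono) (auto simp: \<eta>_def)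
      also have "\<dots> = r ^ (2 * j)" by (simp add: r(3)[symmetric] power_mult)
      also have "\<dots> \<le> r ^ k" using r by (intro power_decreasing) (auto simp: j_def n_def)
      finally show ?thesis .
    qed
    have bd: "measure M (\<Union>w\<in>?Bd. cyl w) \<le> 2 * (r ^ k / r ^ 3)"
    proof (cases n)
      case 0
      have "measure M (\<Union>w\<in>?Bd. cyl w) \<le> measure M (space M)"
        using pull_subset by (intro finite_measure_mono) auto
      moreover have "r ^ 3 \<le> r ^ k" using 0 r by (intro power_decreasing) (auto simp: n_def)
      then have "1 \<le> r ^ k / r ^ 3" using r by simp
      ultimately show ?thesis using prob by linarith
    next
      case (Suc n')
      have "measure M (\<Union>w\<in>?Bd. cyl w) \<le> 2 * \<gamma> ^ n'"
        unfolding Suc \<gamma>_def by (rule boundary_measure[OF p A])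
      also have "\<gamma> ^ n' \<le> \<eta> ^ n'" using \<gamma> by (intro power_mono) (auto simp: \<eta>_def)
      also have "\<eta> ^ n' = r ^ (2 * n')" by (simp add: r(3)[symmetric] power_mult)
      also have "r ^ (2 * n') = r ^ (2 * n' + 3) / r ^ 3" using r by (simp add: power_add)
      also have "\<dots> \<le> r ^ k / r ^ 3"
        using r Suc by (intro divide_right_mono power_decreasing) (auto simp: n_def)
      finally show ?thesis by simp
    qed
    have U: "measure M ((\<Union>w\<in>W. cyl w) \<inter> (T ^^ k) -` B)
        \<le> (1 + C * \<theta> ^ j) * (measure M (\<Union>w\<in>W. cyl w) * measure M B)"
      if "\<And>w. w \<in> W \<Longrightarrow> length w = n" for W
      unfolding k by (rule union_cyl_mixing[OF mix _ _ B that]) (use C \<theta> in auto)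
    have "measure M (A \<inter> (T ^^ k) -` B)
        \<le> measure M ((\<Union>w\<in>?I. cyl w) \<inter> (T ^^ k) -` B) + measure M ((\<Union>w\<in>?Bd. cyl w) \<inter> (T ^^ k) -` B)"
      by (intro order_trans[OF finite_measure_mono[OF sub]] measure_Un_le sets.Un BS)
    also have "measure M ((\<Union>w\<in>?I. cyl w) \<inter> (T ^^ k) -` B) \<le> measure M A * measure M B
        + C * r ^ k * measure M B"
    proof -
      have I: "measure M (\<Union>w\<in>?I. cyl w) \<le> measure M A"
        using A by (intro finite_measure_mono) auto
      have "measure M A \<le> 1" using prob bounded_measure[of A] by simp
      have "measure M ((\<Union>w\<in>?I. cyl w) \<inter> (T ^^ k) -` B)
          \<le> (1 + C * \<theta> ^ j) * (measure M (\<Union>w\<in>?I. cyl w) * measure M B)"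
        by (rule U) auto
      also have "\<dots> \<le> (1 + C * r ^ k) * (measure M A * measure M B)"
        using I \<theta>\<eta> C \<theta> r by (intro mult_mono add_left_mono mult_left_mono) auto
      also have "\<dots> = measure M A * measure M B + C * r ^ k * measure M B * measure M A"
        by (simp add: algebra_simps)
      also have "\<dots> \<le> measure M A * measure M B + C * r ^ k * measure M B * 1"
        using C r \<open>measure M A \<le> 1\<close> by (intro add_left_mono mult_left_mono) auto
      finally show ?thesis by simp
    qed
    also have "measure M ((\<Union>w\<in>?Bd. cyl w) \<inter> (T ^^ k) -` B) \<le> (1
        + C) * 2 / r ^ 3 * r ^ k * measure M B"
    proof -
      have "\<theta> ^ j \<le> 1" using \<theta> by (simp add: power_le_one)
      have "measure M ((\<Union>w\<in>?Bd. cyl w) \<inter> (T ^^ k) -` B)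
          \<le> (1 + C * \<theta> ^ j) * (measure M (\<Union>w\<in>?Bd. cyl w) * measure M B)"
        by (rule U) auto
      also have "\<dots> \<le> (1 + C * 1) * (2 * (r ^ k / r ^ 3) * measure M B)"
        using bd \<open>\<theta> ^ j \<le> 1\<close> C \<theta> r by (intro mult_mono add_left_mono mult_left_mono) auto
      finally show ?thesis by (simp add: field_simps)
    qed
    also have "C * r ^ k * measure M B \<le> C / r ^ 3 * r ^ k * measure M B"
    proof -
      have "r ^ 3 \<le> 1" using r by (simp add: power_le_one)
      then have "C \<le> C / r ^ 3" using r C by (simp add: field_simps)
      then show ?thesis using r by (intro mult_right_mono) auto
    qed
    finally show ?thesis by (simp add: D_def add_divide_distrib algebra_simps)
  qed
  show ?thesis
    by (rule exI[of _ D], intro conjI D, rule exI[of _ r]) (use r main in auto)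
qed

end

section \<open>Interval maps: cylinders and invariant densities\<close>

context distortion_system
begin

text \<open>
  Distortion of a branch with respect to \<open>M\<close> turns into distortion with respect to \<open>\<rho>\<close> by two
  changes of the reference measure: one in the preimage, at generation \<open>n + 1\<close>, and one in the
  image, at generation \<open>n\<close>.
\<close>

lemma regular_distortion:
  assumes \<rho>: "regular \<kappa> \<rho>"
    and DE: "D \<in> sets M" "E \<in> sets M" "D \<subseteq> cyl v" "E \<subseteq> cyl v"
  shows "\<rho> (P i \<inter> T -` D) * \<rho> E
    \<le> exp ((\<kappa> * \<tau> + K + \<kappa>) * \<tau> ^ length v) * (\<rho> (P i \<inter> T -` E) * \<rho> D)"
proof -
  have 1: "\<rho> (P i \<inter> T -` D) * measure M (P i \<inter> T -` E)
      \<le> exp (\<kappa> * \<tau> ^ length (i # v)) * (\<rho> (P i \<inter> T -` E) * measure M (P i \<inter> T -` D))"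
    using DE by (intro regular_ineq[OF \<rho>]) (auto simp: branch_sets)
  have 2: "measure M (P i \<inter> T -` D) * measure M E
        \<le> exp (K * \<tau> ^ length v) * (measure M (P i \<inter> T -` E) * measure M D)"
    using DE distortion by blast
  have nn: "0 \<le> \<rho> (P i \<inter> T -` D)" "0 \<le> \<rho> (P i \<inter> T -` E)" "0 \<le> \<rho> D" "0 \<le> \<rho> E"
    using DE by (auto intro!: regular_nonneg[OF \<rho>] branch_sets)
  have 3: "\<rho> (P i \<inter> T -` D) * measure M E
      \<le> exp (\<kappa> * \<tau> ^ length (i # v)) * exp (K * \<tau> ^ length v) * (\<rho> (P i \<inter> T -` E) * measure M D)"
    by (rule cancel_chain[OF 1 2 regular_null[OF \<rho>]]) (use nn DE in \<open>auto intro: branch_sets\<close>)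
  have 4: "measure M D * \<rho> E \<le> exp (\<kappa> * \<tau> ^ length v) * (measure M E * \<rho> D)"
    using regular_ineq[OF \<rho> DE(2,1,4,3)] by (simp add: mult_ac)
  have 5: "\<rho> (P i \<inter> T -` D) = 0" if "measure M D = 0"
    using regular_null[OF \<rho> branch_sets[OF DE(1)] branch_null[OF DE(1) that]] .
  have "\<rho> (P i \<inter> T -` D) * \<rho> E \<le> exp (\<kappa> * \<tau> ^ length (i # v)) * exp (K * \<tau> ^ length v)
      * exp (\<kappa> * \<tau> ^ length v) * (\<rho> (P i \<inter> T -` E) * \<rho> D)"
    by (rule cancel_chain[OF 3 4 5]) (use nn in auto)
  then show ?thesis by (simp add: exp_add[symmetric] algebra_simps)
qed

end

text \<open>
  Monotone branches on intervals make all cylinders intervals, hence ordered along the line.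
\<close>

locale interval_branches = full_branch_system M T P for M :: "real measure" and T P +
  assumes sets_borel: "sets M = sets (restrict_space borel (space M))"
    and space_interval: "is_interval (space M)"
    and P_interval: "\<And>i. is_interval (P i)"
    and T_monotone: "\<And>i. mono_on (P i) T \<or> antimono_on (P i) T"
begin

lemma cyl_interval: "is_interval (cyl w)"
proof (induction w)
  case (Cons i w)
  show ?case
    unfolding is_interval_1
  proof (intro ballI allI impI)
    fix x y z assume x: "x \<in> cyl (i # w)" and y: "y \<in> cyl (i # w)" and z: "x \<le> z \<and> z \<le> y"
    have zP: "z \<in> P i" using P_interval[of i] x y z unfolding is_interval_1 by simp blast
    have "T x \<le> T z \<and> T z \<le> T y \<or> T y \<le> T z \<and> T z \<le> T x"
      using T_monotone[of i] x y z zP by (auto simp: monotone_on_def)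
    then have "T z \<in> cyl w"
      using Cons x y unfolding is_interval_1 by auto
    then show "z \<in> cyl (i # w)" using zP by simp
  qed
qed (simp add: space_interval)

lemma between_cyl:
  assumes "length u = length v" "length v = length w" "u \<noteq> v" "v \<noteq> w"
    "x \<in> cyl u" "y \<in> cyl v" "z \<in> cyl w" "x \<le> y" "y \<le> z" "t \<in> cyl v"
  shows "x \<le> t" "t \<le> z"
proof -
  have "x \<notin> cyl v" "z \<notin> cyl v"
    using pull_disjoint[of u v] pull_disjoint[of v w] assms by blast+
  then show "x \<le> t" "t \<le> z"
    using cyl_interval[of v] assms unfolding is_interval_1 by (meson linear)+
qed

text \<open>
  Of three disjoint intervals that meet an order-convex set, the middle one is contained in it;
  so three cylinders cannot all cross the boundary.
\<close>

lemma few_boundary_cylinders: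
  assumes conv: "\<And>x y z. x \<in> A \<inter> P i \<Longrightarrow> y \<in> A \<inter> P i \<Longrightarrow> z \<in> P i \<Longrightarrow> x \<le> z \<Longrightarrow> z \<le> y \<Longrightarrow> z \<in> A"
  shows "\<exists>u v. \<forall>w. length w = n \<and> cyl (i # w) \<inter> A \<noteq> {} \<and> \<not> cyl (i # w) \<subseteq> A \<longrightarrow> w = u \<or> w = v"
proof (rule ccontr)
  let ?W = "{w. length w = n \<and> cyl (i # w) \<inter> A \<noteq> {} \<and> \<not> cyl (i # w) \<subseteq> A}"
  assume neg: "\<not> ?thesis"
  then have *: "\<exists>w\<in>?W. w \<noteq> u \<and> w \<noteq> v" for u v by blast
  obtain w1 where w1: "w1 \<in> ?W" using * by blast
  obtain w2 where w2: "w2 \<in> ?W" "w2 \<noteq> w1" using * by blast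
  obtain w3 where w3: "w3 \<in> ?W" "w3 \<noteq> w1" "w3 \<noteq> w2" using * by blast
  have key: False if "u \<in> ?W" "v \<in> ?W" "w \<in> ?W" "u \<noteq> v" "v \<noteq> w"
    "x \<in> cyl (i # u) \<inter> A" "y \<in> cyl (i # v) \<inter> A" "z \<in> cyl (i # w) \<inter> A" "x \<le> y" "y \<le> z"
        for u v w x y z
  proof -
    obtain t where t: "t \<in> cyl (i # v)" "t \<notin> A" using \<open>v \<in> ?W\<close> by blast
    have "x \<le> t" "t \<le> z"
      using between_cyl[of "i # u" "i # v" "i # w" x y z t] that t by (auto simp del: pull.simps)
    then have "t \<in> A" using conv[of x z t] that t by auto
    then show False using t by simp
  qed
  obtain x1 x2 x3 where x: "x1 \<in> cyl (i # w1) \<inter> A" "x2 \<in> cyl (i # w2) \<inter> A" "x3 \<in> cyl (i # w3) \<inter> A"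
    using w1 w2 w3 by blast
  consider "x1 \<le> x2" "x2 \<le> x3" | "x1 \<le> x3" "x3 \<le> x2" | "x2 \<le> x1" "x1 \<le> x3"
    | "x2 \<le> x3" "x3 \<le> x1" | "x3 \<le> x1" "x1 \<le> x2" | "x3 \<le> x2" "x2 \<le> x1" by linarith
  then show False
  proof cases
    case 1
    then show ?thesis using key[OF w1 w2(1) w3(1) _ _ x(1) x(2) x(3)] w2(2) w3(2,3) by blast
  next
    case 2
    then show ?thesis using key[OF w1 w3(1) w2(1) _ _ x(1) x(3) x(2)] w2(2) w3(2,3) by blast
  next
    case 3
    then show ?thesis using key[OF w2(1) w1 w3(1) _ _ x(2) x(1) x(3)] w2(2) w3(2,3) by blast
  next
    case 4
    then show ?thesis using key[OF w2(1) w3(1) w1 _ _ x(2) x(3) x(1)] w2(2) w3(2,3) by blast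
  next
    case 5
    then show ?thesis using key[OF w3(1) w1 w2(1) _ _ x(3) x(1) x(2)] w2(2) w3(2,3) by blast
  next
    case 6
    then show ?thesis using key[OF w3(1) w2(1) w1 _ _ x(3) x(2) x(1)] w2(2) w3(2,3) by blast
  qed
qed

text \<open>
  The unions of cylinders of generation \<open>n\<close>, in a form that is closed under complements.
\<close>

definition saturated :: "nat \<Rightarrow> real set \<Rightarrow> bool" where
  "saturated n B \<longleftrightarrow> B \<in> sets M \<and> (\<forall>w. length w = n \<longrightarrow> cyl w \<subseteq> B \<or> cyl w \<inter> B = {})"

lemma cyl_append_subset: "cyl (v @ w) \<subseteq> cyl v"
  unfolding pull_append by (rule pull_mono) (rule pull_subset, simp)

lemma cyl_take_subset: "cyl w \<subseteq> cyl (take n w)"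
  using cyl_append_subset[of "take n w" "drop n w"] by simp

lemma saturated_mono:
  assumes "saturated n B" "n \<le> n'"
  shows "saturated n' B"
  unfolding saturated_def
proof (intro conjI allI impI)
  fix w :: "nat list" assume "length w = n'"
  then have "length (take n w) = n" using assms(2) by simp
  then show "cyl w \<subseteq> B \<or> cyl w \<inter> B = {}"
    using assms(1) cyl_take_subset[of w n] unfolding saturated_def by blast
qed (use assms in \<open>simp add: saturated_def\<close>)

text \<open>
  The sets that are approximated by unions of cylinders form a \<open>\<sigma>\<close>-algebra. It contains the
  half-lines, since only the single cylinder around the end point is cut.
\<close>

lemma saturated_approx:
  assumes small: "\<And>\<epsilon>. 0 < \<epsilon> \<Longrightarrow> \<exists>n. \<forall>w. length w = n \<longrightarrow> measure M (cyl w) < \<epsilon>"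
    and "A \<in> sets borel" "0 < \<epsilon>"
  shows "\<exists>n B. saturated n B \<and> measure M (sym_diff (space M \<inter> A) B) < \<epsilon>"
proof -
  have MI: "space M \<inter> A \<in> sets M" if "A \<in> sets borel" for A
    using that by (subst sets_borel) (auto simp: sets_restrict_space)
  have "A \<in> sigma_sets UNIV (range atMost)"
    using assms(2) unfolding borel_eq_atMost by simp
  then show ?thesis using \<open>0 < \<epsilon>\<close>
  proof (induction A arbitrary: \<epsilon>)
    case (Basic A)
    then obtain a where a: "A = {..a}" by auto
    obtain n where n: "\<And>w. length w = n \<Longrightarrow> measure M (cyl w) < \<epsilon>" using small Basic by blast
    define B where "B = (\<Union>w\<in>{w. length w = n \<and> cyl w \<subseteq> {..a}}. cyl w)"
    have "saturated n B"
      unfolding saturated_def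
    proof (intro conjI allI impI)
      show "B \<in> sets M" unfolding B_def by (intro sets.countable_UN') auto
      fix w :: "nat list" assume "length w = n"
      then show "cyl w \<subseteq> B \<or> cyl w \<inter> B = {}"
        using pull_disjoint[of w] unfolding B_def by (cases "cyl w \<subseteq> {..a}") blast+
    qed
    moreover have "\<exists>w. length w = n \<and> sym_diff (space M \<inter> A) B \<subseteq> cyl w"
    proof -
      have BA: "B \<subseteq> space M \<inter> A" using pull_subset unfolding B_def a by blast
      have aw: "a \<in> cyl w" if "length w = n" "x \<in> cyl w" "x \<le> a" "x \<notin> B" for w x
      proof -
        have "\<not> cyl w \<subseteq> {..a}" using that unfolding B_def by blast
        then obtain y where "y \<in> cyl w" "a < y" by (metis atMost_iff not_le subsetI)
        then show ?thesis using cyl_interval[of w] that unfolding is_interval_1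
            by (meson less_imp_le)
      qed
      show ?thesis
      proof (cases "sym_diff (space M \<inter> A) B = {}")
        case True
        then show ?thesis by (metis empty_subsetI length_replicate)
      next
        case False
        then obtain x where x: "x \<in> space M" "x \<le> a" "x \<notin> B" using BA a by auto
        obtain w where w: "length w = n" "x \<in> cyl w" using cyl_exists[OF x(1)] by blast
        have "sym_diff (space M \<inter> A) B \<subseteq> cyl w"
        proof
          fix y assume "y \<in> sym_diff (space M \<inter> A) B"
          then have y: "y \<in> space M" "y \<le> a" "y \<notin> B" using BA a by auto
          obtain v where v: "length v = n" "y \<in> cyl v" using cyl_exists[OF y(1)] by blast
          have "a \<in> cyl v" "a \<in> cyl w" using aw[OF v y(2,3)] aw[OF w x(2,3)] by auto
          then have "v = w" using pull_disjoint[of v w "space M" "space M"] v w by auto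
          then show "y \<in> cyl w" using v by simp
        qed
        then show ?thesis using w by blast
      qed
    qed
    ultimately obtain w where sat: "saturated n B" and w: "length w = n" "sym_diff (space M \<inter> A) B
        \<subseteq> cyl w"
      by blast
    have "measure M (sym_diff (space M \<inter> A) B) \<le> measure M (cyl w)"
      by (rule finite_measure_mono[OF w(2)]) simp
    also have "\<dots> < \<epsilon>" by (rule n[OF w(1)])
    finally show ?case using sat by blast
  next
    case Empty
    have "saturated 0 {}" by (simp add: saturated_def)
    then show ?case using Empty by (intro exI[of _ 0] exI[of _ "{}"]) simp
  next
    case (Compl A)
    obtain n B where B: "saturated n B" "measure M (sym_diff (space M \<inter> A) B) < \<epsilon>"
      using Compl by blast
    have "B \<subseteq> space M" using B(1) sets.sets_into_space by (auto simp: saturated_def)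
    then have "sym_diff (space M \<inter> (UNIV - A)) (space M - B) = sym_diff (space M \<inter> A) B" by auto
    moreover have "saturated n (space M - B)"
      using B(1) pull_subset[of "space M"] unfolding saturated_def by blast
    ultimately show ?case using B(2) by (intro exI[of _ n] exI[of _ "space M - B"]) simp
  next
    case (Union A)
    have Ab: "A i \<in> sets borel" for i
      using Union.hyps unfolding borel_eq_atMost by simp
    define V where "V i = space M \<inter> A i" for i
    have Vs [measurable]: "V i \<in> sets M" for i unfolding V_def by (rule MI[OF Ab])
    let ?U = "\<lambda>n. \<Union>i\<le>n. V i" and ?W = "\<Union>i. V i"
    have W: "space M \<inter> (\<Union>i. A i) = ?W" by (auto simp: V_def)
    have "(\<lambda>n. measure M (?U n)) \<longlonglongrightarrow> measure M (\<Union>n. ?U n)"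
      by (intro finite_Lim_measure_incseq) (auto simp: incseq_def intro: order_trans)
    moreover have UU: "(\<Union>n. ?U n) = ?W" by auto
    ultimately have "eventually (\<lambda>n. measure M ?W - \<epsilon> / 2 < measure M (?U n)) sequentially"
      using Union.prems by (intro order_tendstoD(1)) auto
    then obtain N where N: "measure M ?W - \<epsilon> / 2 < measure M (?U N)"
      by (auto simp: eventually_sequentially)
    have "\<exists>n B. saturated n B \<and> measure M (sym_diff (V i) B) < \<epsilon> / (2 * Suc N)" for i
      unfolding V_def using Union.prems by (intro Union.IH) auto
    then obtain n B where B: "\<And>i. saturated (n i) (B i)"
      "\<And>i. measure M (sym_diff (V i) (B i)) < \<epsilon> / (2 * Suc N)" by metis
    define n' where "n' = Max (n ` {..N})"
    have B': "saturated n' (B i)" if "i \<le> N" for i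
      using that by (intro saturated_mono[OF B(1)]) (auto simp: n'_def)
    have Bs [measurable]: "B i \<in> sets M" for i using B(1) by (simp add: saturated_def)
    let ?B = "\<Union>i\<le>N. B i"
    have "saturated n' ?B"
      unfolding saturated_def
    proof (intro conjI allI impI)
      fix w :: "nat list" assume w: "length w = n'"
      have "cyl w \<subseteq> B i \<or> cyl w \<inter> B i = {}" if "i \<le> N" for i
        using B'[OF that] w unfolding saturated_def by blast
      then show "cyl w \<subseteq> ?B \<or> cyl w \<inter> ?B = {}" by blast
    qed measurable
    moreover have "measure M (sym_diff ?W ?B) < \<epsilon>"
    proof -
      have "sym_diff ?W ?B \<subseteq> (?W - ?U N) \<union> (\<Union>i\<le>N. sym_diff (V i) (B i))" by auto
      then have "measure M (sym_diff ?W ?B) \<le> measure M ((?W - ?U N) \<union> (\<Union>i\<le>N. sym_diff (V i) (B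
          i)))"
        by (rule finite_measure_mono) measurable
      also have "\<dots> \<le> measure M (?W - ?U N) + measure M (\<Union>i\<le>N. sym_diff (V i) (B i))"
        by (intro measure_Un_le) measurable
      also have "measure M (?W - ?U N) = measure M ?W - measure M (?U N)"
        by (intro finite_measure_Diff) auto
      also have "measure M (\<Union>i\<le>N. sym_diff (V i) (B i)) \<le> (\<Sum>i\<le>N. measure M (sym_diff (V i) (B i)))"
        by (intro measure_UNION_le) auto
      also have "\<dots> \<le> (\<Sum>i\<le>N. \<epsilon> / (2 * Suc N))"
        using B(2) by (intro sum_mono less_imp_le)
      also have "\<dots> = \<epsilon> / 2" by (simp add: field_simps)
      finally show ?thesis using N by linarith
    qed
    ultimately show ?case unfolding W by blast
  qed
qed

lemma cyl_const_approx:
  fixes h :: "real \<Rightarrow> real"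
  assumes small: "\<And>\<epsilon>. 0 < \<epsilon> \<Longrightarrow> \<exists>n. \<forall>w. length w = n \<longrightarrow> measure M (cyl w) < \<epsilon>"
    and "integrable M h" "0 < \<epsilon>"
  shows "\<exists>n g. integrable M g \<and> (\<forall>w. length w = n \<longrightarrow> g constant_on cyl w) \<and> (\<integral>x. \<bar>h x - g x\<bar> \<partial>M) < \<epsilon>"
  using assms(2,3)
proof (induction h arbitrary: \<epsilon> rule: integrable_induct)
  case (base A c)
  obtain A0 where A0: "A0 \<in> sets borel" "A = space M \<inter> A0"
    using base(1) unfolding sets_borel by (auto simp: sets_restrict_space)
  obtain n B where B: "saturated n B" "measure M (sym_diff A B) < \<epsilon> / (\<bar>c\<bar> + 1)"
    using saturated_approx[OF small A0(1), of "\<epsilon> / (\<bar>c\<bar> + 1)"] base(3) A0 by auto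
  have Bs [measurable]: "B \<in> sets M" and A [measurable]: "A \<in> sets M" using B(1) base
      by (auto simp: saturated_def)
  have "(\<integral>x. \<bar>indicator A x *\<^sub>R c - indicator B x * c\<bar> \<partial>M)
      = (\<integral>x. \<bar>c\<bar> * indicator (sym_diff A B) x \<partial>M)"
    by (intro Bochner_Integration.integral_cong) (auto simp: indicator_def)
  also have "\<dots> = \<bar>c\<bar> * measure M (sym_diff A B)" by simp
  also have "\<dots> \<le> (\<bar>c\<bar> + 1) * measure M (sym_diff A B)" by (intro mult_right_mono) auto
  also have "\<dots> < \<epsilon>" using B(2) by (simp add: field_simps)
  finally have "(\<integral>x. \<bar>indicator A x *\<^sub>R c - indicator B x * c\<bar> \<partial>M) < \<epsilon>" .
  moreover have "(\<lambda>x. indicator B x * c) constant_on cyl w" if "length w = n" for w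
  proof -
    have "cyl w \<subseteq> B \<or> cyl w \<inter> B = {}" using B(1) that by (auto simp: saturated_def)
    then show ?thesis
      unfolding constant_on_def
    proof (elim disjE)
      assume "cyl w \<subseteq> B"
      then show "\<exists>y. \<forall>x\<in>cyl w. indicat_real B x * c = y" by (intro exI[of _ c]) auto
    next
      assume "cyl w \<inter> B = {}"
      then show "\<exists>y. \<forall>x\<in>cyl w. indicat_real B x * c = y"
          by (intro exI[of _ 0]) (auto simp: indicator_def)
    qed
  qed
  moreover have "integrable M (\<lambda>x. indicator B x * c)" by (simp add: emeasure_eq_measure)
  ultimately show ?case by blast
next
  case (add f1 f2)
  have e: "0 < \<epsilon> / 2" using add.prems by simp
  obtain n1 g1 where g1: "integrable M g1" "\<And>w. length w = n1
      \<Longrightarrow> g1 constant_on cyl w" "(\<integral>x. \<bar>f1 x - g1 x\<bar> \<partial>M) < \<epsilon> / 2"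
    using add.IH(1)[OF e] by blast
  obtain n2 g2 where g2: "integrable M g2" "\<And>w. length w = n2
      \<Longrightarrow> g2 constant_on cyl w" "(\<integral>x. \<bar>f2 x - g2 x\<bar> \<partial>M) < \<epsilon> / 2"
    using add.IH(2)[OF e] by blast
  have c1: "g1 constant_on cyl w" if "length w = max n1 n2" for w
    using g1(2)[of "take n1 w"] that cyl_take_subset[of w n1] by (auto simp: constant_on_def)
  have c2: "g2 constant_on cyl w" if "length w = max n1 n2" for w
    using g2(2)[of "take n2 w"] that cyl_take_subset[of w n2] by (auto simp: constant_on_def)
  have cc: "(\<lambda>x. g1 x + g2 x) constant_on cyl w" if "length w = max n1 n2" for w
    using c1[OF that] c2[OF that] by (auto simp: constant_on_def)
  have "(\<integral>x. \<bar>(f1 x + f2 x) - (g1 x + g2 x)\<bar> \<partial>M) \<le> (\<integral>x. \<bar>f1 x - g1 x\<bar> + \<bar>f2 x - g2 x\<bar> \<partial>M)"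
    using add.hyps g1(1) g2(1) by (intro integral_mono) auto
  also have "\<dots> = (\<integral>x. \<bar>f1 x - g1 x\<bar> \<partial>M) + (\<integral>x. \<bar>f2 x - g2 x\<bar> \<partial>M)"
    using add.hyps g1(1) g2(1) by (intro Bochner_Integration.integral_add) auto
  also have "\<dots> < \<epsilon>" using g1(3) g2(3) by linarith
  finally have "(\<integral>x. \<bar>(f1 x + f2 x) - (g1 x + g2 x)\<bar> \<partial>M) < \<epsilon>" .
  then show ?case using cc g1(1) g2(1)
    by (intro exI[of _ "max n1 n2"] exI[of _ "\<lambda>x. g1 x + g2 x"]) auto
next
  case (lim f s)
  have "(\<lambda>i. \<integral>x. \<bar>f x - s i x\<bar> \<partial>M) \<longlonglongrightarrow> (\<integral>x. 0 \<partial>M)"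
  proof (rule integral_dominated_convergence[where w = "\<lambda>x. 3 * norm (f x)"])
    show "integrable M (\<lambda>x. 3 * norm (f x))" using lim.hyps by auto
    show "AE x in M. (\<lambda>i. \<bar>f x - s i x\<bar>) \<longlonglongrightarrow> 0"
    proof (rule AE_I2)
      fix x assume "x \<in> space M"
      then have "(\<lambda>i. f x - s i x) \<longlonglongrightarrow> f x - f x" using lim.hyps by (intro tendsto_diff) auto
      then show "(\<lambda>i. \<bar>f x - s i x\<bar>) \<longlonglongrightarrow> 0" by (simp add: tendsto_rabs_zero)
    qed
    show "AE x in M. norm \<bar>f x - s i x\<bar> \<le> 3 * norm (f x)" for i
    proof (rule AE_I2)
      fix x assume "x \<in> space M"
      then have "norm (s i x) \<le> 2 * norm (f x)" using lim.hyps by auto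
      then show "norm \<bar>f x - s i x\<bar> \<le> 3 * norm (f x)" by (simp add: abs_if split: if_splits)
    qed
  qed (use lim.hyps in auto)
  then have "eventually (\<lambda>i. (\<integral>x. \<bar>f x - s i x\<bar> \<partial>M) < \<epsilon> / 2) sequentially"
    using lim.prems by (intro order_tendstoD(2)) auto
  then obtain i where i: "(\<integral>x. \<bar>f x - s i x\<bar> \<partial>M) < \<epsilon> / 2" by (auto simp: eventually_sequentially)
  obtain n g where g: "integrable M g" "\<forall>w. length w = n \<longrightarrow> g constant_on cyl w"
      "(\<integral>x. \<bar>s i x - g x\<bar> \<partial>M) < \<epsilon> / 2"
    using lim.IH[of "\<epsilon> / 2" i] lim.prems by auto
  have "(\<integral>x. \<bar>f x - g x\<bar> \<partial>M) \<le> (\<integral>x. \<bar>f x - s i x\<bar> + \<bar>s i x - g x\<bar> \<partial>M)"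
    using lim.hyps g(1) by (intro integral_mono) auto
  also have "\<dots> = (\<integral>x. \<bar>f x - s i x\<bar> \<partial>M) + (\<integral>x. \<bar>s i x - g x\<bar> \<partial>M)"
    using lim.hyps g(1) by (intro Bochner_Integration.integral_add) auto
  also have "\<dots> < \<epsilon>" using i g(3) by linarith
  finally show ?case using g by blast
qed

end

text \<open>
  A bounded density as a set function: the measure with density \<open>h\<close> is finite, and its values
  are the real integrals of \<open>h\<close>.
\<close>

lemma (in finite_measure) bounded_density:
  fixes h :: "'a \<Rightarrow> real"
  assumes h: "h \<in> borel_measurable M" and b: "\<And>x. x \<in> space M \<Longrightarrow> 0 \<le> h x \<and> h x \<le> b"
  shows "finite_measure (density M (\<lambda>x. ennreal (h x)))"
    and "\<And>A. A \<in> sets M \<Longrightarrow> measure (density M (\<lambda>x. ennreal (h x))) A = (LINT x:A|M. h x)"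
proof -
  let ?N = "density M (\<lambda>x. ennreal (h x))"
  show "finite_measure ?N"
  proof
    have "emeasure ?N (space M) = (\<integral>\<^sup>+x. ennreal (h x) \<partial>M)"
      using h by (simp add: emeasure_density cong: nn_integral_cong)
    also have "\<dots> \<le> (\<integral>\<^sup>+x. ennreal b \<partial>M)"
      using b by (intro nn_integral_mono) (auto intro: ennreal_leI)
    also have "\<dots> < \<infinity>" by (simp add: emeasure_eq_measure ennreal_mult_less_top)
    finally show "emeasure ?N (space ?N) \<noteq> \<infinity>" by simp
  qed
  show "measure ?N A = (LINT x:A|M. h x)" if "A \<in> sets M" for A
  proof -
    have "measure ?N A = enn2real (\<integral>\<^sup>+x. ennreal (h x) * indicator A x \<partial>M)"
      unfolding measure_def using that h by (simp add: emeasure_density)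
    also have "(\<integral>\<^sup>+x. ennreal (h x) * indicator A x \<partial>M) = (\<integral>\<^sup>+x. ennreal (indicator A x * h x) \<partial>M)"
      by (intro nn_integral_cong) (auto simp: indicator_def)
    also have "enn2real \<dots> = (LINT x|M. indicator A x * h x)"
      using b h that by (intro integral_eq_nn_integral[symmetric] AE_I2) (auto simp: indicator_def)
    finally show ?thesis by (simp add: set_lebesgue_integral_def)
  qed
qed

locale interval_distortion_system = distortion_system M T P \<tau> K + interval_branches M T P
  for M :: "real measure" and T P \<tau> K +
  fixes p :: real
  assumes p: "p < 1" "\<And>s. measure M (P s) \<le> p * measure M (space M)"
begin

lemma cyl_small:
  assumes "0 < \<epsilon>"
  shows "\<exists>n. \<forall>w. length w = n \<longrightarrow> measure M (cyl w) < \<epsilon>"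
proof -
  define \<gamma> where "\<gamma> = 1 - exp (- K1) * (1 - p)"
  have \<gamma>: "0 \<le> \<gamma>" "\<gamma> < 1"
    unfolding \<gamma>_def using shrink_rate[of p 0] p by auto
  have "(\<lambda>n. \<gamma> ^ n * measure M (space M)) \<longlonglongrightarrow> 0 * measure M (space M)"
    using \<gamma> by (intro tendsto_mult tendsto_const LIMSEQ_realpow_zero)
  then have "eventually (\<lambda>n. \<gamma> ^ n * measure M (space M) < \<epsilon>) sequentially"
    using assms by (intro order_tendstoD(2)) auto
  then obtain n where n: "\<gamma> ^ n * measure M (space M) < \<epsilon>" by (auto simp: eventually_sequentially)
  have "measure M (cyl w) < \<epsilon>" if w: "length w = Suc n" for w
  proof -
    obtain i w' where w': "w = i # w'" "length w' = n" using w by (cases w) auto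
    have "measure M (cyl w) \<le> \<gamma> ^ n * measure M (P i)"
      using cyl_shrink[of p i w'] p w' by (simp add: \<gamma>_def del: pull.simps)
    also have "\<dots> \<le> \<gamma> ^ n * measure M (space M)"
      using \<gamma> P_subset[of i] by (intro mult_left_mono finite_measure_mono) auto
    finally show ?thesis using n by simp
  qed
  then show ?thesis by blast
qed

text \<open>
  A density that is constant on cylinders of generation \<open>n\<close> does not oscillate on deeper
  cylinders; on the finitely many earlier generations the ratio \<open>b / a\<close> is absorbed by a large
  constant.
\<close>

lemma bounded_density_regular:
  assumes g: "g \<in> borel_measurable M" and b: "0 < a" "\<And>x. x \<in> space M \<Longrightarrow> a \<le> g x \<and> g x \<le> b"
    and const: "\<And>w. length w = n \<Longrightarrow> g constant_on cyl w"
  shows "regular (ln (b / a) / \<tau> ^ n) (\<lambda>A. LINT x:A|M. g x)"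
proof -
  have ab: "0 < a" "a \<le> b"
  proof -
    obtain x where "x \<in> space M" using mass_pos by (metis ex_in_conv measure_empty less_irrefl)
    with b(2)[OF this] show "a \<le> b" by linarith
  qed (rule b)
  have int: "set_integrable M A g" if "A \<in> sets M" for A
    unfolding set_integrable_def
  proof (rule integrable_const_bound[where B = b])
    show "AE x in M. norm (indicator A x *\<^sub>R g x) \<le> b"
    proof (rule AE_I2)
      fix x assume "x \<in> space M"
      then show "norm (indicator A x *\<^sub>R g x) \<le> b" using b(2)[of x] ab by (auto simp: indicator_def)
    qed
  qed (use that g in auto)
  have bounds: "a * measure M A \<le> (LINT x:A|M. g x)" "(LINT x:A|M. g x) \<le> b * measure M A"
    if A: "A \<in> sets M" for A
  proof -
    have "(LINT x:A|M. a) \<le> (LINT x:A|M. g x)"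
      using int[OF A] b A sets.sets_into_space[OF A]
          by (intro set_integral_mono) (auto simp: set_integrable_def emeasure_eq_measure)
    then show "a * measure M A \<le> (LINT x:A|M. g x)"
      using A by (simp add: set_lebesgue_integral_def mult.commute)
    have "(LINT x:A|M. g x) \<le> (LINT x:A|M. b)"
      using int[OF A] b A sets.sets_into_space[OF A]
          by (intro set_integral_mono) (auto simp: set_integrable_def emeasure_eq_measure)
    then show "(LINT x:A|M. g x) \<le> b * measure M A"
      using A by (simp add: set_lebesgue_integral_def mult.commute)
  qed
  show ?thesis
    unfolding regular_def
  proof (intro conjI allI impI ballI)
    fix A assume "A \<in> sets M"
    then show "0 \<le> (LINT x:A|M. g x)" using bounds(1)[of A] ab
        by (meson measure_nonneg mult_nonneg_nonneg less_imp_le order_trans)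
  next
    fix A :: "nat \<Rightarrow> real set" assume A: "range A \<subseteq> sets M \<and> disjoint_family A"
    have gb: "0 \<le> g x \<and> g x \<le> b" if "x \<in> space M" for x
      using b(2)[OF that] b(1) by linarith
    interpret G: finite_measure "density M (\<lambda>x. ennreal (g x))"
      by (rule bounded_density(1)[OF g gb])
    have "(\<lambda>i. measure (density M (\<lambda>x. ennreal (g x))) (A i))
        sums measure (density M (\<lambda>x. ennreal (g x))) (\<Union>i. A i)"
      using A by (intro G.finite_measure_UNION) auto
    moreover have "(\<Union>i. A i) \<in> sets M" "A i \<in> sets M" for i using A by auto
    ultimately show "(\<lambda>i. LINT x:A i|M. g x) sums (LINT x:(\<Union>i. A i)|M. g x)"
      using bounded_density(2)[OF g gb] by simp
  next
    fix v D E assume *: "D \<in> sets M \<and> E \<in> sets M \<and> D \<subseteq> cyl v \<and> E \<subseteq> cyl v"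
    let ?e = "exp (ln (b / a) / \<tau> ^ n * \<tau> ^ length v)"
    have ln: "0 \<le> ln (b / a)" using ab by simp
    show "(LINT x:D|M. g x) * measure M E \<le> ?e * ((LINT x:E|M. g x) * measure M D)"
    proof (cases "n \<le> length v")
      case True
      then have "length (take n v) = n" by simp
      then have "g constant_on cyl v"
        using const[of "take n v"] cyl_take_subset[of v n] by (auto simp: constant_on_def)
      then obtain q where q: "\<And>x. x \<in> cyl v \<Longrightarrow> g x = q" by (auto simp: constant_on_def)
      have eq: "(LINT x:A|M. g x) = q * measure M A" if "A \<in> sets M" "A \<subseteq> cyl v" for A
      proof -
        have "(LINT x:A|M. g x) = (LINT x:A|M. q)"
          using that q by (intro set_lebesgue_integral_cong) auto
        then show ?thesis using that by (simp add: set_lebesgue_integral_def mult.commute)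
      qed
      have "(LINT x:D|M. g x) * measure M E = (LINT x:E|M. g x) * measure M D"
        using * eq by simp
      moreover have "1 \<le> ?e" using ln \<tau> by simp
      moreover have "0 \<le> (LINT x:E|M. g x) * measure M D"
        using * bounds(1)[of E] ab by (meson measure_nonneg mult_nonneg_nonneg less_imp_le
            order_trans)
      ultimately show ?thesis by (simp add: mult_le_cancel_right1)
    next
      case False
      have "ln (b / a) * 1 \<le> ln (b / a) * (\<tau> ^ length v / \<tau> ^ n)"
        using ln \<tau> False by (intro mult_left_mono) (auto simp: power_decreasing)
      then have "exp (ln (b / a)) \<le> ?e" by simp
      then have "b / a \<le> ?e" using ab by simp
      have "(LINT x:D|M. g x) * measure M E \<le> (b * measure M D) * measure M E"
        using * bounds by (intro mult_right_mono) auto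
      also have "\<dots> = b / a * ((a * measure M E) * measure M D)" using ab by simp
      also have "\<dots> \<le> ?e * ((LINT x:E|M. g x) * measure M D)"
        using * bounds ab \<open>b / a \<le> ?e\<close> by (intro mult_mono mult_right_mono) auto
      finally show ?thesis .
    qed
  qed
qed

text \<open>
  An invariant measure agrees with its own images, and is \<open>L\<^sup>1\<close>-close to a regular \<open>\<rho>\<close> with some
  uncontrolled constant. High images of \<open>\<rho>\<close> are as close, and their constant is at most
  \<open>K1 + 1\<close>. Letting the approximation improve leaves this bound for the invariant measure
  itself.
\<close>

lemma invariant_density_regular:
  assumes N: "N = density M (\<lambda>x. ennreal (h x))" and h: "h \<in> borel_measurable M"
    and b: "0 < a" "\<And>x. x \<in> space M \<Longrightarrow> a \<le> h x \<and> h x \<le> b"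
    and inv: "\<And>A. A \<in> sets M \<Longrightarrow> measure N (T -` A \<inter> space M) = measure N A"
  shows "regular (K1 + 1) (measure N)"
proof -
  have int: "integrable M h"
    using b h by (intro integrable_const_bound[where B = b] AE_I2) force+
  have hb: "0 \<le> h x \<and> h x \<le> b" if "x \<in> space M" for x
    using b(2)[OF that] b(1) by linarith
  have N_eq: "measure N A = (LINT x:A|M. h x)" if "A \<in> sets M" for A
    unfolding N by (rule bounded_density(2)[OF h hb that])
  have [simp]: "sets N = sets M" "space N = space M" using N by auto
  interpret N: finite_measure N
    unfolding N by (rule bounded_density(1)[OF h hb])
  have invn: "measure N ((T ^^ n) -` A \<inter> space M) = measure N A" if "A \<in> sets M" for n A
    by (rule invariant_vimage_funpow[where \<rho> = "measure N", OF inv that])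
  show ?thesis
    unfolding regular_def
  proof (intro conjI allI impI ballI)
    fix A :: "nat \<Rightarrow> real set" assume "range A \<subseteq> sets M \<and> disjoint_family A"
    then show "(\<lambda>i. measure N (A i)) sums measure N (\<Union>i. A i)"
      by (intro N.finite_measure_UNION) auto
  next
    fix v D E assume *: "D \<in> sets M \<and> E \<in> sets M \<and> D \<subseteq> cyl v \<and> E \<subseteq> cyl v"
    let ?e = "exp ((K1 + 1) * \<tau> ^ length v)"
    let ?Q = "measure M E + ?e * measure M D"
    have Q: "0 \<le> ?Q" by simp
    have step: "measure N D * measure M E \<le> ?e * (measure N E * measure M D) + \<delta> * ?Q" if \<delta>: "0
        < \<delta>" for \<delta>
    proof -
      obtain n g0 where g0: "integrable M g0" "\<And>w. length w = n \<Longrightarrow> g0 constant_on cyl w"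
          "(\<integral>x. \<bar>h x - g0 x\<bar> \<partial>M) < \<delta>"
        using cyl_const_approx[OF cyl_small int \<delta>] by blast
      \<comment> \<open>clipping keeps the approximation within the bounds of \<open>h\<close>, which only brings it
        closer to \<open>h\<close>\<close>
      define g where "g x = max a (min b (g0 x))" for x
      have gm [measurable]: "g \<in> borel_measurable M" unfolding g_def using g0(1) by measurable
      have ab: "a \<le> b"
      proof -
        obtain x where "x \<in> space M" using mass_pos by (metis ex_in_conv measure_empty less_irrefl)
        with b(2)[OF this] show "a \<le> b" by linarith
      qed
      have gb: "a \<le> g x \<and> g x \<le> b" for x using ab by (auto simp: g_def)
      have gc: "g constant_on cyl w" if "length w = n" for w
        using g0(2)[OF that] by (auto simp: constant_on_def g_def)
      have gint: "integrable M g"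
      proof (intro integrable_const_bound[where B = b] AE_I2)
        show "norm (g x) \<le> b" for x using gb[of x] b(1) by simp
      qed measurable
      have "(\<integral>x. \<bar>h x - g x\<bar> \<partial>M) \<le> (\<integral>x. \<bar>h x - g0 x\<bar> \<partial>M)"
      proof (rule integral_mono)
        show "\<bar>h x - g x\<bar> \<le> \<bar>h x - g0 x\<bar>" if "x \<in> space M" for x
          using b(2)[OF that] by (auto simp: g_def max_def min_def)
      qed (use int gint g0(1) in auto)
      then have close: "(\<integral>x. \<bar>h x - g x\<bar> \<partial>M) < \<delta>" using g0(3) by simp
      define \<rho> where "\<rho> A = (LINT x:A|M. g x)" for A
      have diff: "\<bar>measure N A - \<rho> A\<bar> \<le> \<delta>" if "A \<in> sets M" for A
      proof -
        have iA: "integrable M (\<lambda>x. indicator A x * h x)" "integrable M (\<lambda>x. indicator A x * g x)"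
          using that int gint by (auto intro: integrable_real_mult_indicator simp: mult.commute)
        have "measure N A - \<rho> A = (\<integral>x. indicator A x * h x - indicator A x * g x \<partial>M)"
          unfolding N_eq[OF that] \<rho>_def set_lebesgue_integral_def using iA by simp
        also have "\<bar>\<dots>\<bar> \<le> (\<integral>x. \<bar>indicator A x * h x - indicator A x * g x\<bar> \<partial>M)"
          by (rule integral_abs_bound)
        also have "\<dots> \<le> (\<integral>x. \<bar>h x - g x\<bar> \<partial>M)"
          using iA int gint by (intro integral_mono) (auto simp: indicator_def)
        finally show ?thesis using close by simp
      qed
      let ?\<kappa> = "ln (b / a) / \<tau> ^ n"
      have reg: "regular ?\<kappa> \<rho>"
        unfolding \<rho>_def by (rule bounded_density_regular[OF gm b(1) gb gc])
      have "(\<lambda>k. ?\<kappa> * \<tau> ^ k) \<longlonglongrightarrow> ?\<kappa> * 0"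
        using \<tau> by (intro tendsto_mult tendsto_const LIMSEQ_realpow_zero) auto
      then have "eventually (\<lambda>k. ?\<kappa> * \<tau> ^ k < 1) sequentially"
        by (intro order_tendstoD(2)) auto
      then obtain k where k: "?\<kappa> * \<tau> ^ k < 1" by (auto simp: eventually_sequentially)
      have reg': "regular (K1 + 1) (\<lambda>A. \<rho> ((T ^^ k) -` A \<inter> space M))"
        by (rule regular_mono[OF regular_push_funpow[OF reg, of k]]) (use k in simp)
      let ?D = "(T ^^ k) -` D \<inter> space M" and ?E = "(T ^^ k) -` E \<inter> space M"
      have DE: "?D \<in> sets M" "?E \<in> sets M" using * by auto
      have "measure N D = measure N ?D" using invn[of D k] * by simp
      also have "\<dots> \<le> \<rho> ?D + \<delta>" using diff[OF DE(1)] by linarith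
      finally have "measure N D * measure M E \<le> (\<rho> ?D + \<delta>) * measure M E"
        by (intro mult_right_mono) auto
      also have "\<dots> \<le> ?e * (\<rho> ?E * measure M D) + \<delta> * measure M E"
        using regular_ineq[OF reg', of D E v] * by (simp add: algebra_simps)
      also have "\<rho> ?E \<le> measure N ?E + \<delta>" using diff[OF DE(2)] by linarith
      also have "measure N ?E = measure N E" using invn[of E k] * by simp
      finally show ?thesis by (simp add: algebra_simps mult_right_mono mult_left_mono)
    qed
    show "measure N D * measure M E \<le> ?e * (measure N E * measure M D)"
    proof (rule field_le_epsilon)
      fix \<epsilon> :: real assume "0 < \<epsilon>"
      then have "0 < \<epsilon> / (?Q + 1)" using Q by (intro divide_pos_pos) linarith+
      from step[OF this] have "measure N D * measure M E \<le> ?e * (measure N E * measure M D)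
          + \<epsilon> / (?Q + 1) * ?Q" .
      also have "\<epsilon> / (?Q + 1) * ?Q \<le> \<epsilon>"
      proof -
        have "\<epsilon> / (q + 1) * q \<le> \<epsilon>" if "0 \<le> q" for q
          using that \<open>0 < \<epsilon>\<close> by (simp add: field_simps)
        then show ?thesis using Q by blast
      qed
      finally show "measure N D * measure M E \<le> ?e * (measure N E * measure M D) + \<epsilon>" by simp
    qed
  qed simp
qed

end

section \<open>A Borel--Cantelli lemma under decay of correlations\<close>

text \<open>
  Summable correlations bound the variance of the partial sum \<open>S\<^sub>N\<close> by a multiple of its mean
  \<open>s\<^sub>N\<close>, so that the probability of a relative deviation is \<open>O (1 / s\<^sub>N)\<close>. Along times \<open>\<phi> k\<close>
  with \<open>s \<approx> k\<^sup>2\<close> these probabilities are summable. In between both sides are monotone, and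
  consecutive values of \<open>k\<^sup>2\<close> have ratio tending to 1.
\<close>

lemma (in prob_space) AE_liminf_sums:
  fixes X :: "nat \<Rightarrow> 'a \<Rightarrow> real"
  assumes meas [measurable]: "\<And>j. X j \<in> borel_measurable M"
    and bnd: "\<And>j x. x \<in> space M \<Longrightarrow> 0 \<le> X j x" "\<And>j x. x \<in> space M \<Longrightarrow> X j x \<le> H"
    and corr: "\<And>i j. i \<le> j \<Longrightarrow> expectation (\<lambda>x. X i x * X j x)
        \<le> expectation (X i) * expectation (X j) + C * \<theta> ^ (j - i) * expectation (X j)"
    and C: "0 \<le> C" "0 < \<theta>" "\<theta> < 1"
    and div: "\<not> summable (\<lambda>j. expectation (X j))"
    and \<eta>: "0 < \<eta>" "\<eta> < 1"
  shows "AE x in M. eventually (\<lambda>N. (1 - \<eta>) * (\<Sum>j<N. expectation (X j))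
      \<le> (\<Sum>j<N. X j x)) sequentially"
proof -
  define e where "e j = expectation (X j)" for j
  define s where "s N = (\<Sum>j<N. e j)" for N
  define S where "S N x = (\<Sum>j<N. X j x)" for N x
  have [measurable]: "S N \<in> borel_measurable M" for N unfolding S_def by measurable
  have H: "0 \<le> H"
  proof -
    obtain x where "x \<in> space M" using not_empty by blast
    from bnd[OF this, of 0] show ?thesis by linarith
  qed
  have intX [simp]: "integrable M (X j)" for j
    using bnd by (intro integrable_const_bound[where B = H] AE_I2) auto
  have intXX [simp]: "integrable M (\<lambda>x. X i x * X j x)" for i j
    using bnd H by (intro integrable_const_bound[where B = "H * H"] AE_I2)
      (auto intro!: mult_mono simp: abs_mult)
  have e: "0 \<le> e j" "e j \<le> H" for j
  proof -
    show "0 \<le> e j" unfolding e_def using bnd by (intro integral_nonneg_AE AE_I2) auto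
    have "e j \<le> expectation (\<lambda>_. H)" unfolding e_def using bnd by (intro integral_mono) auto
    then show "e j \<le> H" by (simp add: prob_space)
  qed
  have ES: "expectation (S N) = s N" for N
    by (simp add: S_def[abs_def] s_def e_def)
  have [simp]: "integrable M (\<lambda>x. S N x * S N x)" for N
    unfolding S_def sum_product by simp
  have [simp]: "integrable M (S N)" for N
    unfolding S_def[abs_def] by simp
  define D where "D = 2 * (C / (1 - \<theta>))"
  have D: "0 \<le> D" using C by (simp add: D_def)
  have ESS: "expectation (\<lambda>x. S N x * S N x) \<le> s N * s N + D * s N" for N
  proof -
    have "expectation (\<lambda>x. S N x * S N x) = (\<Sum>i<N. \<Sum>j<N. expectation (\<lambda>x. X i x * X j x))"
      unfolding S_def sum_product by simp
    also have "\<dots> \<le> (\<Sum>i<N. \<Sum>j<N. e i * e j + (C * \<theta> ^ (j - i) * e j * of_bool (i \<le> j)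
        + C * \<theta> ^ (i - j) * e i * of_bool (j \<le> i)))"
    proof (intro sum_mono)
      fix i j
      have nn: "0 \<le> C * \<theta> ^ (j - i) * e j" "0 \<le> C * \<theta> ^ (i - j) * e i"
        using C e by auto
      show "expectation (\<lambda>x. X i x * X j x) \<le> e i * e j + (C * \<theta> ^ (j - i) * e j * of_bool (i \<le> j)
          + C * \<theta> ^ (i - j) * e i * of_bool (j \<le> i))"
      proof (cases "i \<le> j")
        case True
        then show ?thesis using corr[OF True] nn by (auto simp: e_def)
      next
        case False
        then have "expectation (\<lambda>x. X i x * X j x) = expectation (\<lambda>x. X j x * X i x)"
          by (simp add: mult.commute)
        then show ?thesis using corr[of j i] False by (simp add: e_def mult_ac)
      qed
    qed
    also have "\<dots> = s N * s N + ((\<Sum>i<N. \<Sum>j<N. C * \<theta> ^ (j - i) * e j * of_bool (i \<le> j))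
        + (\<Sum>i<N. \<Sum>j<N. C * \<theta> ^ (i - j) * e i * of_bool (j \<le> i)))"
      by (simp add: sum.distrib s_def sum_product)
    also have "(\<Sum>i<N. \<Sum>j<N. C * \<theta> ^ (j - i) * e j * of_bool (i \<le> j))
        = (\<Sum>i<N. \<Sum>j<N. C * \<theta> ^ (i - j) * e i * of_bool (j \<le> i))"
      by (rule sum.swap)
    also have "(\<Sum>i<N. \<Sum>j<N. C * \<theta> ^ (i - j) * e i * of_bool (j \<le> i)) \<le> (\<Sum>i<N. C / (1 - \<theta>) * e i)"
    proof (intro sum_mono)
      fix i assume i: "i \<in> {..<N}"
      have "(\<Sum>j<N. C * \<theta> ^ (i - j) * e i * of_bool (j \<le> i)) = (\<Sum>j\<le>i. C * \<theta> ^ (i - j) * e i)"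
        using i by (intro sum.mono_neutral_cong_right) auto
      also have "\<dots> = C * e i * (\<Sum>j\<le>i. \<theta> ^ (i - j))"
        by (simp add: sum_distrib_left mult_ac)
      also have "(\<Sum>j\<le>i. \<theta> ^ (i - j)) = (\<Sum>j<Suc i. \<theta> ^ j)"
        by (rule sum.reindex_bij_witness[of _ "\<lambda>j. i - j" "\<lambda>j. i - j"]) auto
      also have "\<dots> = (1 - \<theta> ^ Suc i) / (1 - \<theta>)"
        using C by (subst sum_gp_strict) auto
      also have "C * e i * ((1 - \<theta> ^ Suc i) / (1 - \<theta>)) \<le> C * e i * (1 / (1 - \<theta>))"
        using C e by (intro mult_left_mono divide_right_mono) auto
      finally show "(\<Sum>j<N. C * \<theta> ^ (i - j) * e i * of_bool (j \<le> i)) \<le> C / (1 - \<theta>) * e i"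
        by (simp add: mult_ac)
    qed
    also have "(\<Sum>i<N. C / (1 - \<theta>) * e i) = D / 2 * s N"
    proof -
      have "C / (1 - \<theta>) = D / 2" unfolding D_def
          by (rule nonzero_mult_div_cancel_left[symmetric]) simp
      then show ?thesis by (simp only: s_def sum_distrib_left)
    qed
    finally show ?thesis by simp
  qed
  have cheb: "prob {x \<in> space M. S N x < (1 - \<delta>) * s N} \<le> D / (\<delta>\<^sup>2 * s N)"
    if \<delta>: "0 < \<delta>" and sN: "0 < s N" for N \<delta>
  proof -
    let ?u = "\<lambda>x. (S N x - s N) * (S N x - s N)"
    have u: "?u = (\<lambda>x. S N x * S N x - 2 * s N * S N x + s N * s N)"
      by (auto simp: algebra_simps)
    have "expectation ?u = expectation (\<lambda>x. S N x * S N x) - 2 * s N * s N + s N * s N"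
      unfolding u by (simp add: ES prob_space)
    also have "\<dots> \<le> D * s N" using ESS[of N] by simp
    finally have var: "expectation ?u \<le> D * s N" .
    have "{x \<in> space M. S N x < (1 - \<delta>) * s N} \<subseteq> {x \<in> space M. ?u x \<ge> (\<delta> * s N) * (\<delta> * s N)}"
    proof safe
      fix x assume "S N x < (1 - \<delta>) * s N"
      then have "\<delta> * s N \<le> s N - S N x" by (simp add: algebra_simps)
      then have "(\<delta> * s N) * (\<delta> * s N) \<le> (s N - S N x) * (s N - S N x)"
        using \<delta> sN mult_pos_pos[OF \<delta> sN] by (intro mult_mono) linarith+
      then show "\<delta> * s N * (\<delta> * s N) \<le> ?u x" by (simp add: algebra_simps)
    qed
    then have "prob {x \<in> space M. S N x < (1 - \<delta>) * s N}
        \<le> prob {x \<in> space M. ?u x \<ge> (\<delta> * s N) * (\<delta> * s N)}"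
      by (intro finite_measure_mono) measurable
    also have "\<dots> \<le> expectation ?u / ((\<delta> * s N) * (\<delta> * s N))"
    proof (rule integral_Markov_inequality_measure[where A = "{}"])
      show "integrable M ?u" unfolding u by simp
    qed (use \<delta> sN in auto)
    also have "\<dots> \<le> D * s N / ((\<delta> * s N) * (\<delta> * s N))"
      using \<delta> sN var by (intro divide_right_mono) auto
    also have "\<dots> = D / (\<delta>\<^sup>2 * s N)" using \<delta> sN by (simp add: power2_eq_square)
    finally show ?thesis .
  qed
  have smono: "s i \<le> s j" if "i \<le> j" for i j
    unfolding s_def using that e by (intro sum_mono2) auto
  have unbounded: "\<exists>N. B \<le> s N" for B
  proof (rule ccontr)
    assume "\<nexists>N. B \<le> s N"
    then have "s N \<le> B" for N by (meson linear)
    then have "summable e"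
      using e by (intro bounded_imp_summable[of e B]) (auto simp: s_def
          lessThan_Suc_atMost[symmetric] simp del: sum.lessThan_Suc)
    with div show False by (simp add: e_def[abs_def])
  qed
  \<comment> \<open>the partial means are unbounded, so every square is passed at some first time\<close>
  define \<phi> where "\<phi> k = (LEAST N. (real (Suc k))\<^sup>2 \<le> s N)" for k
  have \<phi>: "(real (Suc k))\<^sup>2 \<le> s (\<phi> k)" for k
    unfolding \<phi>_def using unbounded by (rule LeastI_ex)
  have \<phi>_least: "\<phi> k \<le> N \<longleftrightarrow> (real (Suc k))\<^sup>2 \<le> s N" for k N
  proof
    assume "\<phi> k \<le> N"
    then show "(real (Suc k))\<^sup>2 \<le> s N" using \<phi>[of k] smono by fastforce
  qed (auto simp: \<phi>_def intro: Least_le)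
  define \<delta> where "\<delta> = \<eta> / 2"
  have \<delta>: "0 < \<delta>" "\<delta> < 1" using \<eta> by (auto simp: \<delta>_def)
  have "AE x in M. eventually (\<lambda>k. x \<in> space M - {x \<in> space M. S (\<phi> k) x
      < (1 - \<delta>) * s (\<phi> k)}) sequentially"
  proof (rule borel_cantelli_AE1)
    have "summable (\<lambda>k. D / \<delta>\<^sup>2 * (1 / (real (Suc k))\<^sup>2))"
      using inverse_power_summable[of 2, where 'a = real]
      by (intro summable_mult) (subst summable_Suc_iff, simp add: field_simps)
    then show "summable (\<lambda>k. prob {x \<in> space M. S (\<phi> k) x < (1 - \<delta>) * s (\<phi> k)})"
    proof (rule summable_comparison_test'[where N = 0])
      fix k :: nat
      have k: "0 < (real (Suc k))\<^sup>2" by simp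
      have "prob {x \<in> space M. S (\<phi> k) x < (1 - \<delta>) * s (\<phi> k)} \<le> D / (\<delta>\<^sup>2 * s (\<phi> k))"
        using \<phi>[of k] k \<delta> by (intro cheb) linarith+
      also have "\<dots> \<le> D / (\<delta>\<^sup>2 * (real (Suc k))\<^sup>2)"
      proof -
        have pos: "0 < s (\<phi> k)" using less_le_trans[OF k \<phi>[of k]] .
        show ?thesis
          by (intro divide_left_mono mult_left_mono mult_pos_pos \<phi> pos D k) (use \<delta> in auto)
      qed
      finally show "norm (prob {x \<in> space M. S (\<phi> k) x < (1 - \<delta>) * s (\<phi> k)})
          \<le> D / \<delta>\<^sup>2 * (1 / (real (Suc k))\<^sup>2)"
        by simp
    qed
  qed (auto simp: emeasure_eq_measure)
  then show ?thesis
  proof (rule AE_mp, intro AE_I2 impI)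
    fix x assume x: "x \<in> space M"
      and ev: "eventually (\<lambda>k. x \<in> space M - {x \<in> space M. S (\<phi> k) x
          < (1 - \<delta>) * s (\<phi> k)}) sequentially"
    have Smono: "S i x \<le> S j x" if "i \<le> j" for i j
      unfolding S_def using that bnd x by (intro sum_mono2) auto
    have "(\<lambda>k. (1 - \<delta>) * (real (Suc k))\<^sup>2 / (real (Suc (Suc k)))\<^sup>2) \<longlonglongrightarrow> (1 - \<delta>) * 1"
    proof -
      have "(\<lambda>k. real (Suc k) / real (Suc (Suc k))) \<longlonglongrightarrow> 1"
        using LIMSEQ_Suc[OF LIMSEQ_n_over_Suc_n] by simp
      then have "(\<lambda>k. (1 - \<delta>) * (real (Suc k) / real (Suc (Suc k)))\<^sup>2) \<longlonglongrightarrow> (1 - \<delta>) * 1\<^sup>2"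
        by (intro tendsto_intros)
      then show ?thesis by (simp add: power_divide)
    qed
    moreover have "1 - \<eta> < (1 - \<delta>) * 1" using \<eta> by (simp add: \<delta>_def)
    ultimately have "eventually (\<lambda>k. 1 - \<eta> < (1 - \<delta>) * (real (Suc k))\<^sup>2 / (real (Suc (Suc k)))\<^sup>2)
        sequentially"
      by (rule order_tendstoD)
    with ev have "eventually (\<lambda>k. (1 - \<delta>) * (real (Suc k))\<^sup>2 \<le> S (\<phi> k) x \<and>
        (1 - \<eta>) * (real (Suc (Suc k)))\<^sup>2 \<le> (1 - \<delta>) * (real (Suc k))\<^sup>2) sequentially"
    proof eventually_elim
      case (elim k)
      then have "(1 - \<delta>) * s (\<phi> k) \<le> S (\<phi> k) x" using x by auto
      moreover have "(1 - \<delta>) * (real (Suc k))\<^sup>2 \<le> (1 - \<delta>) * s (\<phi> k)"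
        using \<delta> \<phi> by (intro mult_left_mono) auto
      ultimately show ?case using elim(2) by (auto simp: field_simps)
    qed
    then obtain k0 where k0: "\<And>k. k \<ge> k0 \<Longrightarrow> (1 - \<delta>) * (real (Suc k))\<^sup>2 \<le> S (\<phi> k) x \<and>
        (1 - \<eta>) * (real (Suc (Suc k)))\<^sup>2 \<le> (1 - \<delta>) * (real (Suc k))\<^sup>2"
      unfolding eventually_sequentially by blast
    have "(1 - \<eta>) * s N \<le> S N x" if N: "N \<ge> \<phi> k0" for N
    proof -
      have "\<exists>k. (real (Suc k))\<^sup>2 > s N"
      proof -
        obtain k where "s N < real k" using reals_Archimedean2 by blast
        also have "real k \<le> real (Suc k) ^ 2" by (simp add: power2_eq_square algebra_simps)
        finally show ?thesis by blast
      qed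
      then obtain k where k: "\<not> (real (Suc k))\<^sup>2 \<le> s N" "\<And>k'. k' < k \<Longrightarrow> (real (Suc k'))\<^sup>2 \<le> s N"
        using exists_least_iff[of "\<lambda>k. \<not> (real (Suc k))\<^sup>2 \<le> s N"] by (metis not_le)
      have "k0 < k"
      proof (rule ccontr)
        assume "\<not> k0 < k"
        then have "(real (Suc k))\<^sup>2 \<le> (real (Suc k0))\<^sup>2" by (intro power_mono) auto
        moreover have "(real (Suc k0))\<^sup>2 \<le> s N" using N \<phi>_least by blast
        ultimately show False using k(1) by (meson order_trans)
      qed
      then obtain k' where k': "k = Suc k'" "k0 \<le> k'" by (cases k) auto
      have le: "\<phi> k' \<le> N" using k(2)[of k'] \<phi>_least k' by simp
      have "(1 - \<eta>) * s N \<le> (1 - \<eta>) * (real (Suc (Suc k')))\<^sup>2"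
        using k(1) k' \<eta> by (intro mult_left_mono) auto
      also have "\<dots> \<le> S (\<phi> k') x" using k0[OF k'(2)] by linarith
      also have "\<dots> \<le> S N x" by (rule Smono[OF le])
      finally show ?thesis .
    qed
    then show "eventually (\<lambda>N. (1 - \<eta>) * (\<Sum>j<N. expectation (X j)) \<le> (\<Sum>j<N. X j x)) sequentially"
      unfolding eventually_sequentially s_def S_def e_def by blast
  qed
qed

section \<open>Growth of sums of variables with infinite mean\<close>

lemma powr_subadditive:
  fixes a b p :: real
  assumes "0 \<le> a" "0 \<le> b" "0 < p" "p \<le> 1"
  shows "(a + b) powr p \<le> a powr p + b powr p"
proof (cases "a + b = 0")
  case True
  then show ?thesis using assms by auto
next
  case False
  then have s: "0 < a + b" using assms by auto
  have le: "x / (a + b) \<le> x powr p / (a + b) powr p" if "0 \<le> x" "x \<le> a + b" for x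
  proof -
    have "(x / (a + b)) powr 1 \<le> (x / (a + b)) powr p"
      using that s assms by (intro powr_mono') auto
    then show ?thesis using that s by (simp add: powr_divide)
  qed
  have "1 = a / (a + b) + b / (a + b)" using s by (simp add: add_divide_distrib[symmetric])
  also have "\<dots> \<le> (a powr p + b powr p) / (a + b) powr p"
    using le[of a] le[of b] assms by (simp add: add_divide_distrib)
  finally show ?thesis using s by (simp add: field_simps)
qed

lemma sum_powr_subadditive:
  fixes f :: "'a \<Rightarrow> real"
  assumes "\<And>i. i \<in> A \<Longrightarrow> 0 \<le> f i" "0 < p" "p \<le> 1"
  shows "(\<Sum>i\<in>A. f i) powr p \<le> (\<Sum>i\<in>A. f i powr p)"
  using assms(1)
proof (induction A rule: infinite_finite_induct)
  case (insert x F)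
  have "(f x + sum f F) powr p \<le> f x powr p + sum f F powr p"
    using insert assms by (intro powr_subadditive sum_nonneg) auto
  also have "\<dots> \<le> f x powr p + (\<Sum>i\<in>F. f i powr p)" using insert by auto
  finally show ?case using insert by simp
qed auto

text \<open>
  For \<open>p \<le> 1\<close> the \<open>p\<close>-th power of a sum is at most the sum of the \<open>p\<close>-th powers, which has
  linear mean. Markov's inequality along powers of two gives summable probabilities because
  \<open>p * q > 1\<close>.
\<close>

lemma (in prob_space) AE_sum_le_powr:
  fixes Z :: "nat \<Rightarrow> 'a \<Rightarrow> real"
  assumes int: "\<And>j. integrable M (\<lambda>x. Z j x powr p)"
    and nonneg: "\<And>j x. x \<in> space M \<Longrightarrow> 0 \<le> Z j x"
    and E: "\<And>j. expectation (\<lambda>x. Z j x powr p) \<le> E"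
    and p: "0 < p" "p \<le> 1" "1 < p * q"
  shows "AE x in M. eventually (\<lambda>n. (\<Sum>j<n. Z j x) \<le> real n powr q) sequentially"
proof -
  define V where "V n x = (\<Sum>j<n. Z j x powr p)" for n x
  have Vint: "integrable M (V n)" for n unfolding V_def[abs_def] using int by simp
  then have [measurable]: "V n \<in> borel_measurable M" for n by auto
  have EV: "expectation (V n) \<le> real n * E" for n
  proof -
    have "expectation (V n) = (\<Sum>j<n. expectation (\<lambda>x. Z j x powr p))"
      unfolding V_def[abs_def] using int by simp
    also have "\<dots> \<le> (\<Sum>j<n. E)" by (intro sum_mono E)
    finally show ?thesis by simp
  qed
  let ?r = "2 powr (1 - p * q)"
  have r: "0 < ?r" "?r < 1" using p by (auto simp: powr_less_one)
  define B where "B k = {x \<in> space M. V (2 ^ Suc k) x \<ge> (2 ^ k) powr (p * q)}" for k :: nat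
  have "AE x in M. eventually (\<lambda>k. x \<in> space M - B k) sequentially"
  proof (rule borel_cantelli_AE1)
    show "summable (\<lambda>k. prob (B k))"
    proof (rule summable_comparison_test'[where N = 0])
      show "summable (\<lambda>k. 2 * E * ?r ^ k)" using r by (intro summable_mult summable_geometric) auto
      fix k :: nat
      have "prob (B k) \<le> expectation (V (2 ^ Suc k)) / (2 ^ k) powr (p * q)"
        unfolding B_def
      proof (rule integral_Markov_inequality_measure[where A = "{}"])
        show "integrable M (V (2 ^ Suc k))" by (rule Vint)
      qed (auto simp: V_def intro!: sum_nonneg)
      also have "\<dots> \<le> real (2 ^ Suc k) * E / (2 ^ k) powr (p * q)"
        by (intro divide_right_mono EV) auto
      also have "\<dots> = 2 * E * ?r ^ k"
      proof -
        have "(2 ^ k) powr (p * q) = (2 powr (p * q)) ^ k"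
          by (simp add: powr_realpow[symmetric] powr_powr mult_ac)
        then show ?thesis by (simp add: powr_diff power_divide)
      qed
      finally show "norm (prob (B k)) \<le> 2 * E * ?r ^ k" by simp
    qed
  qed (auto simp: B_def emeasure_eq_measure)
  then show ?thesis
  proof (rule AE_mp, intro AE_I2 impI)
    fix x assume x: "x \<in> space M" and ev: "eventually (\<lambda>k. x \<in> space M - B k) sequentially"
    obtain k0 where k0: "\<And>k. k \<ge> k0 \<Longrightarrow> V (2 ^ Suc k) x < (2 ^ k) powr (p * q)"
      using ev x unfolding eventually_sequentially B_def by (auto simp: not_le)
    have "(\<Sum>j<n. Z j x) \<le> real n powr q" if n: "n \<ge> 2 ^ Suc k0" for n
    proof -
      have "1 \<le> n" using n by (metis one_le_numeral one_le_power order_trans)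
      then obtain k where k: "2 ^ k \<le> n" "n < 2 ^ (k + 1)" using ex_power_ivl1[of 2 n] by auto
      have "k0 \<le> k"
      proof (rule ccontr)
        assume "\<not> k0 \<le> k"
        then have "(2::nat) ^ (k + 1) \<le> 2 ^ Suc k0" by (intro power_increasing) auto
        then show False using k n by linarith
      qed
      have "(\<Sum>j<n. Z j x) powr p \<le> V n x"
        unfolding V_def using nonneg x p by (intro sum_powr_subadditive) auto
      also have "\<dots> \<le> V (2 ^ Suc k) x"
        unfolding V_def using k by (intro sum_mono2) auto
      also have "\<dots> \<le> (2 ^ k) powr (p * q)" using k0[OF \<open>k0 \<le> k\<close>] by simp
      also have "\<dots> \<le> real n powr (p * q)"
      proof (rule powr_mono2)
        show "2 ^ k \<le> real n" using k(1) by (metis of_nat_le_iff of_nat_numeral of_nat_power)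
      qed (use p in auto)
      also have "\<dots> = (real n powr q) powr p" by (simp add: powr_powr mult.commute)
      finally have "(\<Sum>j<n. Z j x) powr p \<le> (real n powr q) powr p" .
      then show ?thesis
        using powr_less_mono2[of p "real n powr q" "\<Sum>j<n. Z j x"] p by fastforce
    qed
    then show "eventually (\<lambda>n. (\<Sum>j<n. Z j x) \<le> real n powr q) sequentially"
      unfolding eventually_sequentially by blast
  qed
qed

lemma (in prob_space) integrable_powr_of_tail:
  fixes R :: "'a \<Rightarrow> nat"
  assumes R [measurable]: "R \<in> measurable M (count_space UNIV)"
    and tail: "comparable (\<lambda>n. prob {x \<in> space M. R x = n}) (\<lambda>n. real n powr (- \<beta> - 1))"
    and p: "p < \<beta>"
  shows "integrable M (\<lambda>x. real (R x) powr p)"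
proof (rule integrableI_bounded)
  let ?m = "\<lambda>n. prob {x \<in> space M. R x = n}"
  obtain c where c: "c > 0" and ev: "eventually (\<lambda>n. inverse c \<le> ?m n / real n powr (- \<beta> - 1) \<and>
      ?m n / real n powr (- \<beta> - 1) \<le> c) sequentially"
    using tail unfolding comparable_def by blast
  have "summable (\<lambda>n. c * real n powr (p - \<beta> - 1))"
    using p by (intro summable_mult) (simp add: summable_real_powr_iff)
  moreover have "eventually (\<lambda>n. norm (real n powr p * ?m n)
      \<le> c * real n powr (p - \<beta> - 1)) sequentially"
    using ev eventually_gt_at_top[of 0]
  proof eventually_elim
    case (elim n)
    then have "?m n \<le> c * real n powr (- \<beta> - 1)" by (simp add: divide_le_eq)
    then have "real n powr p * ?m n \<le> real n powr p * (c * real n powr (- \<beta> - 1))"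
      by (intro mult_left_mono) auto
    also have "\<dots> = c * real n powr (p - \<beta> - 1)"
    proof -
      have "p - \<beta> - 1 = p + (- \<beta> - 1)" by simp
      then show ?thesis by (simp only: powr_add mult_ac)
    qed
    finally show ?case by simp
  qed
  ultimately have summ: "summable (\<lambda>n. real n powr p * ?m n)"
    by (rule summable_comparison_test_ev[rotated])
  have "(\<integral>\<^sup>+x. ennreal (real (R x) powr p) \<partial>M)
      = (\<integral>\<^sup>+x. (\<Sum>n. ennreal (real n powr p) * indicator {x \<in> space M. R x = n} x) \<partial>M)"
  proof (rule nn_integral_cong)
    fix x assume x: "x \<in> space M"
    have "(\<Sum>n. ennreal (real n powr p) * indicator {x \<in> space M. R x = n} x)
        = (\<Sum>n\<in>{R x}. ennreal (real n powr p) * indicator {x \<in> space M. R x = n} x)"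
      by (rule suminf_finite) auto
    then show "ennreal (real (R x) powr p) = (\<Sum>n. ennreal (real n powr p) * indicator {x \<in> space
        M. R x = n} x)"
      using x by simp
  qed
  also have "\<dots> = (\<Sum>n. ennreal (real n powr p) * emeasure M {x \<in> space M. R x = n})"
    by (subst nn_integral_suminf) (auto simp: nn_integral_cmult_indicator)
  also have "\<dots> = (\<Sum>n. ennreal (real n powr p * ?m n))"
    by (simp add: emeasure_eq_measure ennreal_mult)
  also have "\<dots> = ennreal (\<Sum>n. real n powr p * ?m n)"
    using summ by (intro suminf_ennreal2) auto
  also have "\<dots> < \<infinity>" by simp
  finally show "(\<integral>\<^sup>+x. ennreal (norm (real (R x) powr p)) \<partial>M) < \<infinity>" by simp
qed measurable

section \<open>A maximal inequality for intervals of the line\<close>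

text \<open>
  The interval reaching furthest to the left and the one reaching furthest to the right cover
  all three.
\<close>

lemma three_intervals:
  fixes x :: real
  assumes "x \<in> {a1<..<b1}" "x \<in> {a2<..<b2}" "x \<in> {a3<..<b3}"
  shows "{a1<..<b1} \<subseteq> {a2<..<b2} \<union> {a3<..<b3} \<or> {a2<..<b2} \<subseteq> {a1<..<b1} \<union> {a3<..<b3}
    \<or> {a3<..<b3} \<subseteq> {a1<..<b1} \<union> {a2<..<b2}"
proof (rule ccontr)
  assume "\<not> ?thesis"
  then obtain y1 y2 y3 where "y1 \<in> {a1<..<b1}" "y1 \<notin> {a2<..<b2}" "y1 \<notin> {a3<..<b3}"
    "y2 \<in> {a2<..<b2}" "y2 \<notin> {a1<..<b1}" "y2 \<notin> {a3<..<b3}"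
    "y3 \<in> {a3<..<b3}" "y3 \<notin> {a1<..<b1}" "y3 \<notin> {a2<..<b2}" by blast
  then show False using assms unfolding greaterThanLessThan_iff by linarith
qed

text \<open>
  In a subcover of least cardinality no member is covered by two others, so no point lies in
  three members.
\<close>

lemma subcover_overlap_two:
  fixes G :: "real set set"
  assumes "finite G" and int: "\<And>I. I \<in> G \<Longrightarrow> \<exists>a b. I = {a<..<b}"
  obtains H where "H \<subseteq> G" "\<Union>H = \<Union>G" "\<And>x. card {I \<in> H. x \<in> I} \<le> 2"
proof -
  obtain H where H: "H \<subseteq> G" "\<Union>H = \<Union>G"
    and min: "\<And>H'. H' \<subseteq> G \<Longrightarrow> \<Union>H' = \<Union>G \<Longrightarrow> card H \<le> card H'"
    using ex_has_least_nat[of "\<lambda>H. H \<subseteq> G \<and> \<Union>H = \<Union>G" G card] by auto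
  have fin: "finite H" using H(1) assms(1) finite_subset by blast
  \<comment> \<open>a member covered by two others could be dropped\<close>
  have irr: "\<not> I \<subseteq> J \<union> J'" if "I \<in> H" "J \<in> H" "J' \<in> H" "I \<noteq> J" "I \<noteq> J'" for I J J'
  proof
    assume "I \<subseteq> J \<union> J'"
    then have "\<Union>(H - {I}) = \<Union>H" using that by blast
    then have "card H \<le> card (H - {I})" using H by (intro min) auto
    then show False using fin \<open>I \<in> H\<close> using card_Diff1_less[of H I] by simp
  qed
  have "card {I \<in> H. x \<in> I} \<le> 2" for x
  proof (rule ccontr)
    assume "\<not> ?thesis"
    then have "3 \<le> card {I \<in> H. x \<in> I}" by simp
    then obtain S where S: "S \<subseteq> {I \<in> H. x \<in> I}" "card S = 3" by (meson obtain_subset_with_card_n)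
    then obtain I J J' where IJ: "S = {I, J, J'}" "I \<noteq> J" "I \<noteq> J'" "J \<noteq> J'"
      by (auto simp: card_3_iff)
    have mem: "I \<in> H" "J \<in> H" "J' \<in> H" "x \<in> I" "x \<in> J" "x \<in> J'" using S IJ by auto
    obtain a1 b1 a2 b2 a3 b3 where "I = {a1<..<b1}" "J = {a2<..<b2}" "J' = {a3<..<b3}"
      using int H(1) mem by (metis subsetD)
    then have "I \<subseteq> J \<union> J' \<or> J \<subseteq> I \<union> J' \<or> J' \<subseteq> I \<union> J"
      using three_intervals[of x a1 b1 a2 b2 a3 b3] mem(4-6) by (simp only:)
    then show False
      using mem IJ irr[of I J J'] irr[of J I J'] irr[of J' I J] by metis
  qed
  with H show ?thesis by (rule that)
qed

text \<open>
  The Hardy--Littlewood argument for two arbitrary measures on the line. The covering lemma with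
  overlap two, which is special to intervals, takes the place of a doubling condition on \<open>M\<close>.
\<close>

lemma maximal_inequality:
  fixes M \<kappa> :: "real measure"
  assumes sets [measurable_cong]: "sets M = sets borel" "sets \<kappa> = sets borel"
    and J: "J \<in> sets borel"
    and \<G>: "\<And>I. I \<in> \<G> \<Longrightarrow> \<exists>a b. I = {a<..<b}" "\<And>I. I \<in> \<G> \<Longrightarrow> I \<subseteq> J"
      "\<And>I. I \<in> \<G> \<Longrightarrow> emeasure M I \<le> r * emeasure \<kappa> I"
  shows "emeasure M (\<Union>\<G>) \<le> 2 * r * emeasure \<kappa> J"
proof -
  have op: "open I" if "I \<in> \<G>" for I using \<G>(1)[OF that] by auto
  obtain \<F>' where \<F>': "\<F>' \<subseteq> \<G>" "countable \<F>'" "\<Union>\<F>' = \<Union>\<G>"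
    using Lindelof[of \<G>] op by metis
  have fin: "emeasure M (\<Union>F) \<le> 2 * r * emeasure \<kappa> J" if F: "finite F" "F \<subseteq> \<G>" for F
  proof -
    have int: "\<exists>a b. I = {a<..<b}" if "I \<in> F" for I
      using \<G>(1) F(2) that by blast
    obtain H where H: "H \<subseteq> F" "\<Union>H = \<Union>F" "\<And>x. card {I \<in> H. x \<in> I} \<le> 2"
      using subcover_overlap_two[OF F(1) int] by blast
    have finH: "finite H" using H(1) F(1) finite_subset by blast
    have b: "I \<in> sets borel" if "I \<in> H" for I
      using that H(1) F(2) by (intro borel_open op) auto
    have "(\<Sum>I\<in>H. \<integral>\<^sup>+x. indicator I x \<partial>\<kappa>) = (\<integral>\<^sup>+x. (\<Sum>I\<in>H. indicator I x) \<partial>\<kappa>)"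
      using b sets by (intro nn_integral_sum[symmetric]) auto
    also have "\<dots> \<le> (\<integral>\<^sup>+x. 2 * indicator J x \<partial>\<kappa>)"
    proof (rule nn_integral_mono)
      fix x
      show "(\<Sum>I\<in>H. indicator I x) \<le> (2 * indicator J x :: ennreal)"
      proof (cases "x \<in> J")
        case True
        have "(\<Sum>I\<in>H. indicator I x) = (of_nat (card {I \<in> H. x \<in> I}) :: ennreal)"
          using finH by (simp add: indicator_def sum.If_cases Int_def)
        also have "\<dots> \<le> of_nat 2" by (intro of_nat_mono H)
        finally show ?thesis using True by simp
      next
        case False
        then have "(\<Sum>I\<in>H. indicator I x) = (\<Sum>I\<in>H. 0 :: ennreal)"
          using H(1) F(2) \<G>(2) by (intro sum.cong) (auto simp: indicator_def)
        then show ?thesis by simp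
      qed
    qed
    also have "\<dots> = 2 * emeasure \<kappa> J" using J sets by (simp add: nn_integral_cmult)
    finally have overlap: "(\<Sum>I\<in>H. \<integral>\<^sup>+x. indicator I x \<partial>\<kappa>) \<le> 2 * emeasure \<kappa> J" .
    have "emeasure M (\<Union>I\<in>H. I) \<le> (\<Sum>I\<in>H. emeasure M I)"
      using b finH sets by (intro emeasure_subadditive_finite) auto
    also have "\<dots> \<le> (\<Sum>I\<in>H. r * emeasure \<kappa> I)"
      using H(1) F(2) by (intro sum_mono \<G>(3)) auto
    also have "\<dots> = r * (\<Sum>I\<in>H. \<integral>\<^sup>+x. indicator I x \<partial>\<kappa>)"
      using b sets by (simp add: sum_distrib_left)
    also have "\<dots> \<le> r * (2 * emeasure \<kappa> J)" by (rule mult_left_mono[OF overlap]) simp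
    finally show ?thesis using H(2) by (simp add: mult_ac)
  qed
  show ?thesis
  proof (cases "\<F>' = {}")
    case True
    then have "\<Union>\<G> = {}" using \<F>'(3)[symmetric] by simp
    then show ?thesis by (simp only: emeasure_empty zero_le)
  next
    case False
    define e where "e = from_nat_into \<F>'"
    have e: "range e = \<F>'" unfolding e_def using False \<F>'(2) by simp
    have un: "(\<Union>n. \<Union>i\<in>{..n}. e i) = \<Union>\<G>" using e \<F>'(3) by auto
    have es: "e i \<in> sets borel" for i using e \<F>'(1) by (intro borel_open op) auto
    have "(\<lambda>n. emeasure M (\<Union>i\<in>{..n}. e i)) \<longlonglongrightarrow> emeasure M (\<Union>n. \<Union>i\<in>{..n}. e i)"
    proof (rule Lim_emeasure_incseq)
      show "range (\<lambda>n. \<Union>i\<in>{..n}. e i) \<subseteq> sets M" using es sets by auto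
      show "incseq (\<lambda>n. \<Union>i\<in>{..n}. e i)" unfolding incseq_def by (intro allI impI UN_mono) auto
    qed
    then have "emeasure M (\<Union>n. \<Union>i\<in>{..n}. e i) \<le> 2 * r * emeasure \<kappa> J"
    proof (rule LIMSEQ_le_const2, intro exI allI impI)
      fix n
      show "emeasure M (\<Union>i\<in>{..n}. e i) \<le> 2 * r * emeasure \<kappa> J"
        using fin[of "e ` {..n}"] e \<F>'(1) by auto
    qed
    then show ?thesis using un by simp
  qed
qed

section \<open>The base map of a Young tower\<close>

lemma image_measure_bounds:
  fixes T g :: "real \<Rightarrow> real"
  assumes S: "S \<in> lmeasurable" and TS: "T ` S \<in> lmeasurable"
    and der: "\<And>x. x \<in> S \<Longrightarrow> (T has_real_derivative g x) (at x within S)" and inj: "inj_on T S"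
  shows "(\<And>x. x \<in> S \<Longrightarrow> lo \<le> \<bar>g x\<bar>) \<Longrightarrow> lo * measure lebesgue S \<le> measure lebesgue (T ` S)"
    and "(\<And>x. x \<in> S \<Longrightarrow> \<bar>g x\<bar> \<le> hi) \<Longrightarrow> measure lebesgue (T ` S) \<le> hi * measure lebesgue S"
proof -
  have abs1: "(\<lambda>x. 1 :: real) absolutely_integrable_on A" if "A \<in> lmeasurable" for A :: "real set"
    using that by simp
  have "(\<lambda>x. \<bar>g x\<bar> * 1) absolutely_integrable_on S \<and> integral S (\<lambda>x. \<bar>g x\<bar> * 1)
      = measure lebesgue (T ` S)"
    using has_absolute_integral_change_of_variables_1'[of S T g "\<lambda>_. 1" "measure lebesgue (T ` S)"]
      S der inj abs1[OF TS] lmeasure_integral[OF TS] by auto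
  then have int: "(\<lambda>x. \<bar>g x\<bar>) integrable_on S" and eq: "integral S (\<lambda>x. \<bar>g x\<bar>)
      = measure lebesgue (T ` S)"
    by (auto dest: absolutely_integrable_on_def[THEN iffD1])
  have const: "integral S (\<lambda>x. k) = k * measure lebesgue S" "(\<lambda>x. k) integrable_on S" for k :: real
  proof -
    show "(\<lambda>x. k) integrable_on S" using integrable_on_const[OF S] .
    show "integral S (\<lambda>x. k) = k * measure lebesgue S"
      using integral_mult_right[of S k "\<lambda>_. 1"] lmeasure_integral[OF S] by simp
  qed
  show "lo * measure lebesgue S \<le> measure lebesgue (T ` S)" if "\<And>x. x \<in> S \<Longrightarrow> lo \<le> \<bar>g x\<bar>"
    unfolding eq[symmetric] const(1)[symmetric] by (intro integral_le const int that)
  show "measure lebesgue (T ` S) \<le> hi * measure lebesgue S" if "\<And>x. x \<in> S \<Longrightarrow> \<bar>g x\<bar> \<le> hi"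
    unfolding eq[symmetric] const(1)[symmetric] by (intro integral_le const int that)
qed

text \<open>
  By change of variables the measure of an image is the integral of the derivative. If the
  derivative on \<open>S\<close> exceeds that on \<open>W\<close> by at most the factor \<open>q\<close>, the infimum of the derivative
  over \<open>W\<close> separates the two estimates.
\<close>

lemma image_measure_distortion:
  fixes T g :: "real \<Rightarrow> real"
  assumes S: "S \<in> lmeasurable" "T ` S \<in> lmeasurable" and W: "W \<in> lmeasurable" "T ` W \<in> lmeasurable"
    and der: "\<And>x. x \<in> S \<union> W \<Longrightarrow> (T has_real_derivative g x) (at x within S \<union> W)"
        and inj: "inj_on T (S \<union> W)"
    and dist: "\<And>x y. x \<in> W \<Longrightarrow> y \<in> S \<Longrightarrow> \<bar>g y\<bar> \<le> q * \<bar>g x\<bar>" and q: "0 < q"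
  shows "measure lebesgue W * measure lebesgue (T ` S)
      \<le> q * (measure lebesgue S * measure lebesgue (T ` W))"
proof (cases "W = {}")
  case False
  \<comment> \<open>bounds the derivative from below on \<open>W\<close> and, up to the factor \<open>q\<close>, from above on \<open>S\<close>\<close>
  define lo where "lo = (INF x\<in>W. \<bar>g x\<bar>)"
  have lo: "lo \<le> \<bar>g x\<bar>" if "x \<in> W" for x
    unfolding lo_def using that by (intro cINF_lower bdd_belowI[of _ 0]) auto
  have hi: "\<bar>g y\<bar> \<le> q * lo" if "y \<in> S" for y
  proof -
    have "\<bar>g y\<bar> / q \<le> lo"
      unfolding lo_def using dist that q by (intro cINF_greatest False) (auto simp: field_simps)
    then show ?thesis using q by (simp add: field_simps)
  qed
  have 1: "lo * measure lebesgue W \<le> measure lebesgue (T ` W)"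
    by (rule image_measure_bounds(1)[of W T g])
      (use W der inj lo in \<open>auto intro: DERIV_subset inj_on_subset\<close>)
  have 2: "measure lebesgue (T ` S) \<le> q * lo * measure lebesgue S"
    by (rule image_measure_bounds(2)[of S T g])
      (use S der inj hi in \<open>auto intro: DERIV_subset inj_on_subset\<close>)
  have "measure lebesgue W * measure lebesgue (T ` S)
      \<le> measure lebesgue W * (q * lo * measure lebesgue S)"
    by (rule mult_left_mono[OF 2]) simp
  also have "\<dots> = q * (measure lebesgue S * (lo * measure lebesgue W))" by (simp add: mult_ac)
  also have "\<dots> \<le> q * (measure lebesgue S * measure lebesgue (T ` W))"
    using q by (intro mult_left_mono[OF mult_left_mono[OF 1]]) auto
  finally show ?thesis .
qed simp

text \<open>
  Two sets of positive measure that no partition element meets both keep the elements from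
  filling the space. They will be two level sets of the return time.
\<close>

lemma (in finite_measure) partition_bound:
  assumes A: "A0 \<in> sets M" "A1 \<in> sets M" and P: "\<And>s. P s \<in> sets M"
    and disj: "\<And>s. P s \<inter> A0 = {} \<or> P s \<inter> A1 = {}"
    and pos: "0 < measure M A0" "0 < measure M A1"
  shows "\<exists>p<1. \<forall>s. measure M (P s) \<le> p * measure M (space M)"
proof -
  define d where "d = min (measure M A0) (measure M A1)"
  have Z: "0 < measure M (space M)" using pos(1) bounded_measure[of A0] by linarith
  have "measure M (P s) \<le> (1 - d / measure M (space M)) * measure M (space M)" for s
  proof -
    have "\<exists>A\<in>{A0, A1}. P s \<inter> A = {}" using disj[of s] by auto
    then obtain A' where A': "A' \<in> {A0, A1}" "P s \<inter> A' = {}" by blast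
    have "measure M (P s) + measure M A' = measure M (P s \<union> A')"
      using A' A P by (intro finite_measure_Union[symmetric]) auto
    also have "\<dots> \<le> measure M (space M)" by (rule bounded_measure)
    finally have "measure M (P s) + d \<le> measure M (space M)" using A' by (auto simp: d_def)
    moreover have "(1 - d / measure M (space M)) * measure M (space M) = measure M (space M) - d"
      using Z by (simp add: left_diff_distrib)
    ultimately show ?thesis by linarith
  qed
  moreover have "1 - d / measure M (space M) < 1" using pos Z by (simp add: d_def)
  ultimately show ?thesis by blast
qed

context young_tower
begin

abbreviation leb where "leb \<equiv> restrict_space lborel L"
abbreviation T where "T \<equiv> base_map f R"

lemma sets_leb: "sets leb = sets m" and space_leb: "space leb = L"
  by (simp_all add: sets_m sets_restrict_space space_restrict_space)

lemma subset_sets_m: "A \<in> sets m \<longleftrightarrow> A \<in> sets borel \<and> A \<subseteq> L"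
  using base_sets(1) by (auto simp: sets_m sets_restrict_space_iff)

lemma emeasure_leb: "A \<in> sets m \<Longrightarrow> emeasure leb A = emeasure lborel A"
  using base_sets(1) by (subst emeasure_restrict_space) (auto simp: subset_sets_m)

lemma measure_leb: "A \<in> sets m \<Longrightarrow> measure leb A = measure lebesgue A"
  by (simp add: measure_def emeasure_leb subset_sets_m)

lemma density_ex:
  obtains h c K where "h \<in> borel_measurable borel" "0 < (c::real)" "\<And>x. x \<in> L \<Longrightarrow> c \<le> h x \<and> h x \<le> K"
    "m = density leb (\<lambda>x. ennreal (h x))"
proof -
  from base_density obtain h c K where "h \<in> borel_measurable borel" "0 < (c::real)" "\<forall>x\<in>L. c \<le> h x
      \<and> h x \<le> K"
    "m = density leb (\<lambda>x. ennreal (h x))" by metis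
  then show ?thesis by (intro that[of h c K]) auto
qed

lemma finite_leb: "finite_measure leb" and leb_pos: "0 < measure leb L"
  and leb_null: "A \<in> sets m \<Longrightarrow> measure leb A = 0 \<Longrightarrow> measure m A = 0"
proof -
  interpret m: prob_space m by (rule base_prob)
  obtain h c K where h: "h \<in> borel_measurable borel" "0 < (c::real)" "\<And>x. x \<in> L \<Longrightarrow> c \<le> h x \<and> h x \<le> K"
    "m = density leb (\<lambda>x. ennreal (h x))" using density_ex by metis
  have hm: "(\<lambda>x. ennreal (h x)) \<in> borel_measurable leb"
    using h(1) by (intro measurable_restrict_space1) auto
  have Lm: "L \<in> sets leb" using sets.top[of leb] by (simp add: space_leb)
  have "ennreal c * emeasure leb L \<le> 1"
  proof -
    have "ennreal c * emeasure leb L = (\<integral>\<^sup>+x. ennreal c * indicator L x \<partial>leb)"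
      using Lm by (simp add: nn_integral_cmult_indicator)
    also have "\<dots> \<le> (\<integral>\<^sup>+x. ennreal (h x) * indicator L x \<partial>leb)"
      using h(3) by (intro nn_integral_mono) (auto simp: indicator_def intro!: ennreal_leI)
    also have "\<dots> = emeasure m L" using hm Lm by (simp add: h(4) emeasure_density)
    also have "\<dots> = 1" using m.emeasure_space_1 by (simp add: space_m)
    finally show ?thesis .
  qed
  then have fin: "emeasure leb L < \<infinity>"
    using h(2) by (cases "emeasure leb L") (auto simp: ennreal_mult_top top_unique)
  show fm: "finite_measure leb" using fin by (intro finite_measureI) (simp add: space_leb)
  interpret leb: finite_measure leb by (rule fm)
  show null: "measure m A = 0" if A: "A \<in> sets m" "measure leb A = 0" for A
  proof -
    have "A \<in> null_sets leb" using A by (auto simp: null_sets_def sets_leb leb.emeasure_eq_measure)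
    then have "(\<integral>\<^sup>+x. ennreal (h x) * indicator A x \<partial>leb) = 0" by (rule nn_integral_null_set)
    moreover have "emeasure m A = (\<integral>\<^sup>+x. ennreal (h x) * indicator A x \<partial>leb)"
      unfolding h(4) using hm A(1)[folded sets_leb] by (rule emeasure_density)
    ultimately have "emeasure m A = 0" by simp
    then show ?thesis by (simp add: measure_def)
  qed
  show "0 < measure leb L"
  proof (rule ccontr)
    assume "\<not> ?thesis"
    then have "measure leb L = 0" using measure_nonneg[of leb L] by linarith
    then have "measure m L = 0" using Lm by (intro null) (auto simp: sets_leb)
    then show False using m.prob_space by (simp add: space_m)
  qed
qed

lemma T_measurable_m: "T \<in> measurable m m"
  using base_invariant by (simp add: measure_preserving_map_def)

lemma full_branch_leb: "full_branch_system leb T P"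
proof -
  interpret finite_measure leb by (rule finite_leb)
  show ?thesis
  proof
    show "T \<in> measurable leb leb"
      using T_measurable_m measurable_cong_sets[OF sets_leb sets_leb] by blast
    show "P i \<in> sets leb" for i
      using base_sets partition(2) unfolding sets_leb subset_sets_m by auto
  qed (use partition leb_pos in \<open>auto simp: space_leb\<close>)
qed

sublocale leb: full_branch_system leb T P
  by (rule full_branch_leb)

lemma cyl_in_cylinders: "leb.cyl (i # w) \<in> cylinders T L P (length w)"
proof -
  have "leb.cyl v = {x \<in> L. \<forall>k<length v. (T ^^ k) x \<in> P (v ! k)}" for v
  proof (induction v)
    case (Cons j v)
    show ?case
    proof (intro set_eqI)
      fix x
      have TL: "T x \<in> L" if "x \<in> P j"
        using full_branches[of j] that by (auto simp: bij_betw_def)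
      have "x \<in> P j \<Longrightarrow> x \<in> L" using partition(2) by auto
      then show "x \<in> leb.cyl (j # v) \<longleftrightarrow> x \<in> {x \<in> L. \<forall>k<length (j # v). (T ^^ k) x \<in> P ((j # v) ! k)}"
        using Cons TL by (auto simp: less_Suc_eq_0_disj funpow_swap1 simp del: funpow.simps(2)
            simp: funpow_Suc_right)
    qed
  qed (simp add: space_leb)
  then have "leb.cyl (i # w) = {x \<in> L. \<forall>k\<le>length w. (T ^^ k) x \<in> P ((i # w) ! k)}"
    by (simp add: less_Suc_eq_le del: full_branch_system.pull.simps)
  then show ?thesis unfolding cylinders_def by blast
qed

lemma P_in_cylinders: "P i \<in> cylinders T L P 0"
proof -
  have "P i = {x \<in> L. \<forall>k\<le>0. (T ^^ k) x \<in> P i}" using partition(2) by auto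
  then show ?thesis unfolding cylinders_def by (rule image_eqI[of _ _ "\<lambda>_. i"]) simp
qed

lemma gibbs_markov_branches:
  obtains D \<tau> C where "0 < \<tau>" "\<tau> < 1" "0 < C"
    and "\<And>x i. x \<in> P i \<Longrightarrow> (T has_real_derivative D x) (at x within P i)"
    and "\<And>x. x \<in> L \<Longrightarrow> 0 < \<bar>D x\<bar>"
    and "\<And>n \<omega> x y. \<omega> \<in> cylinders T L P n \<Longrightarrow> x \<in> \<omega> \<Longrightarrow> y \<in> \<omega> \<Longrightarrow> \<bar>ln (\<bar>D x\<bar> / \<bar>D y\<bar>)\<bar> \<le> C * \<tau> ^ n"
proof -
  obtain D where D0: "\<forall>n. \<forall>\<omega>\<in>cylinders T L P n. \<forall>x\<in>\<omega>. ((T ^^ Suc n) has_real_derivative D (Suc n)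
      x) (at x within \<omega>)"
    and ex: "\<exists>\<theta> \<tau> C. \<theta> > 1 \<and> 0 < \<tau> \<and> \<tau> < 1 \<and> C > 0 \<and>
             (\<forall>n\<ge>1. \<forall>x\<in>L. \<bar>D n x\<bar> \<ge> C * \<theta> ^ n) \<and>
             (\<forall>n. \<forall>\<omega>\<in>cylinders T L P n. \<forall>x\<in>\<omega>. \<forall>y\<in>\<omega>. \<bar>ln (\<bar>D 1 x\<bar> / \<bar>D 1 y\<bar>)\<bar> \<le> C * \<tau> ^ n)"
    using gibbs_markov[unfolded gibbs_markov_def]
        by (elim exE conjE) (rule that; assumption?; (intro exI conjI; assumption))
  obtain \<theta> \<tau> C where \<theta>: "\<theta> > 1" and \<tau>: "0 < \<tau>" "\<tau> < 1" and C: "C > 0"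
    and exp: "\<forall>n\<ge>1. \<forall>x\<in>L. \<bar>D n x\<bar> \<ge> C * \<theta> ^ n"
    and dist: "\<forall>n. \<forall>\<omega>\<in>cylinders T L P n. \<forall>x\<in>\<omega>. \<forall>y\<in>\<omega>. \<bar>ln (\<bar>D 1 x\<bar> / \<bar>D 1 y\<bar>)\<bar> \<le> C * \<tau> ^ n"
    using ex by (elim exE conjE) (rule that; assumption)
  have der: "(T has_real_derivative D 1 x) (at x within P i)" if "x \<in> P i" for x i
    using D0[rule_format, OF P_in_cylinders that] by simp
  have pos: "0 < \<bar>D 1 x\<bar>" if "x \<in> L" for x
  proof -
    have "C * \<theta> \<le> \<bar>D 1 x\<bar>" using exp[rule_format, of 1 x] that by simp
    moreover have "0 < C * \<theta>" using C \<theta> by simp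
    ultimately show ?thesis by linarith
  qed
  show ?thesis using dist by (intro that[OF \<tau> C der pos]) blast+
qed

lemma T_monotone: "mono_on (P i) T \<or> antimono_on (P i) T"
proof -
  obtain D where D: "\<And>x i. x \<in> P i \<Longrightarrow> (T has_real_derivative D x) (at x within P i)"
    using gibbs_markov_branches by metis
  have "continuous_on (P i) T"
    by (auto simp: continuous_on_eq_continuous_within intro!: DERIV_continuous D)
  moreover have "inj_on T (P i)" using full_branches by (auto simp: bij_betw_def)
  ultimately have "strict_mono_on (P i) T \<or> strict_antimono_on (P i) T"
    using injective_eq_monotone_map[OF partition_intervals] by blast
  then show ?thesis by (auto simp: monotone_on_def less_le)
qed

text \<open>
  A set in the cylinder of \<open>v\<close> has its preimage in the \<open>i\<close>-th branch inside the cylinder of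
  \<open>i # v\<close>, which is an element of the \<open>length v\<close>-th refinement of the partition; this is the
  generation at which the Gibbs--Markov condition bounds the oscillation of the logarithm of the
  derivative.
\<close>

lemma leb_distortion:
  "\<exists>\<tau> K. 0 < \<tau> \<and> \<tau> < 1 \<and> 0 < K \<and> distortion_system leb T P \<tau> K"
proof -
  obtain D \<tau> C where \<tau>: "0 < \<tau>" "\<tau> < 1" and C: "C > 0"
    and D: "\<And>x i. x \<in> P i \<Longrightarrow> (T has_real_derivative D x) (at x within P i)"
    and pos: "\<And>x. x \<in> L \<Longrightarrow> 0 < \<bar>D x\<bar>"
    and dist: "\<And>n \<omega> x y. \<omega> \<in> cylinders T L P n \<Longrightarrow> x \<in> \<omega> \<Longrightarrow> y \<in> \<omega> \<Longrightarrow> \<bar>ln (\<bar>D x\<bar> / \<bar>D y\<bar>)\<bar> \<le> C * \<tau> ^ n"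
    using gibbs_markov_branches by metis
  have "distortion_system leb T P \<tau> C"
  proof
    fix i v A B assume A: "A \<in> sets leb" and B: "B \<in> sets leb" and sub: "A \<subseteq> leb.cyl v" "B
        \<subseteq> leb.cyl v"
    let ?W = "P i \<inter> T -` A" and ?S = "P i \<inter> T -` B"
    have WS: "?W \<in> sets m" "?S \<in> sets m" "A \<in> sets m" "B \<in> sets m"
      using leb.branch_sets A B by (auto simp: sets_leb)
    have lm: "X \<in> lmeasurable" if "X \<in> sets m" for X
    proof -
      have "emeasure lborel X \<noteq> \<infinity>"
        using emeasure_leb[OF that] leb.emeasure_finite[of X] by simp
      then show ?thesis using that by (intro fmeasurableI) (auto simp: subset_sets_m less_top)
    qed
    have im: "T ` ?W = A" "T ` ?S = B"
      using full_branches[of i] A B sets.sets_into_space[OF A] sets.sets_into_space[OF B]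
      unfolding bij_betw_def space_leb by blast+
    have cyl: "?S \<union> ?W \<subseteq> leb.cyl (i # v)" using sub by auto
    have PL: "P i \<subseteq> L" using partition(2) by auto
    have "measure lebesgue ?W * measure lebesgue (T ` ?S)
        \<le> exp (C * \<tau> ^ length v) * (measure lebesgue ?S * measure lebesgue (T ` ?W))"
    proof (rule image_measure_distortion[where g = "D"])
      show "inj_on T (?S \<union> ?W)" using full_branches[of i]
          by (auto simp: bij_betw_def intro: inj_on_subset)
      show "(T has_real_derivative D x) (at x within ?S \<union> ?W)" if "x \<in> ?S \<union> ?W" for x
      proof -
        from D[of x i] show ?thesis using that by (auto intro: DERIV_subset)
      qed
      show "\<bar>D y\<bar> \<le> exp (C * \<tau> ^ length v) * \<bar>D x\<bar>" if "x \<in> ?W" "y \<in> ?S" for x y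
      proof -
        have "ln (\<bar>D y\<bar> / \<bar>D x\<bar>) \<le> C * \<tau> ^ length v"
        proof -
          have "y \<in> leb.cyl (i # v)" "x \<in> leb.cyl (i # v)" using cyl that by blast+
          from dist[OF cyl_in_cylinders this] show ?thesis by linarith
        qed
        moreover have "0 < \<bar>D x\<bar>" "0 < \<bar>D y\<bar>" using that PL pos by blast+
        ultimately have "\<bar>D y\<bar> / \<bar>D x\<bar> \<le> exp (C * \<tau> ^ length v)"
          by (metis divide_pos_pos exp_le_cancel_iff exp_ln)
        then show ?thesis using \<open>0 < \<bar>D x\<bar>\<close> by (simp add: field_simps)
      qed
    qed (use WS lm im in auto)
    then show "measure leb ?W * measure leb B \<le> exp (C * \<tau> ^ length v) * (measure leb ?S * measure
        leb A)"
      unfolding im using WS by (simp add: measure_leb)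
  qed (use \<tau> C in auto)
  then show ?thesis using \<tau> C by blast
qed

lemma return_level: "{x \<in> L. R x = n} \<in> sets m"
proof -
  have eq: "{x \<in> L. R x = n} = (if n = 0 then L else {x \<in> L. n - 1 < R x}) - {x \<in> L. n < R x}"
      by auto
  have "{x \<in> L. R x = n} \<in> sets borel"
    unfolding eq using return_level_sets base_sets(1) by (intro sets.Diff) auto
  then show ?thesis by (auto simp: subset_sets_m)
qed

lemma interval_branches_leb: "interval_branches leb T P"
proof
  show "sets leb = sets (restrict_space borel (space leb))"
      by (simp add: sets_restrict_space space_leb)
  show "is_interval (space leb)" using base_interval(1) by (simp add: space_leb)
qed (rule partition_intervals T_monotone)+

text \<open>
  Distortion is passed from Lebesgue measure to \<open>m\<close> through the regularity of the invariant
  density, after which the abstract mixing theorem applies with \<open>m\<close> as its own reference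
  measure. The two levels of the return time exclude a partition with a single essential
  element.
\<close>

theorem base_mixing:
  assumes n: "n0 \<noteq> n1" "0 < measure m {x \<in> L. R x = n0}" "0 < measure m {x \<in> L. R x = n1}"
  shows "\<exists>C\<ge>0. \<exists>\<theta>. 0 < \<theta> \<and> \<theta> < 1 \<and> (\<forall>A B k. A \<in> sets m \<longrightarrow>
    (\<forall>i x y z. x \<in> A \<inter> P i \<longrightarrow> y \<in> A \<inter> P i \<longrightarrow> z \<in> P i \<longrightarrow> x \<le> z \<longrightarrow> z \<le> y \<longrightarrow> z \<in> A) \<longrightarrow>
    B \<in> sets m \<longrightarrow>
    measure m (A \<inter> (T ^^ k) -` B) \<le> measure m A * measure m B + C * \<theta> ^ k * measure m B)"
proof -
  interpret m: prob_space m by (rule base_prob)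
  have Rc: "R x = R y" if "x \<in> P s" "y \<in> P s" for x y s
    using return_const[of s] that by (auto simp: constant_on_def)
  have disj: "P s \<inter> {x \<in> L. R x = n0} = {} \<or> P s \<inter> {x \<in> L. R x = n1} = {}" for s
    using Rc[of _ s] n(1) by blast
  have Ps: "P s \<in> sets m" for s using leb.P_sets by (simp add: sets_leb)
  have "0 < measure leb {x \<in> L. R x = k}" if "0 < measure m {x \<in> L. R x = k}" for k
    using leb_null[OF return_level, of k] that measure_nonneg[of leb "{x \<in> L. R x = k}"] by linarith
  with n have pl: "0 < measure leb {x \<in> L. R x = n0}" "0 < measure leb {x \<in> L. R x = n1}" by auto
  obtain p where p: "p < 1" "\<And>s. measure leb (P s) \<le> p * measure leb (space leb)"
    using leb.partition_bound[of "{x \<in> L. R x = n0}" "{x \<in> L. R x = n1}" P] return_level Ps disj pl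
    unfolding sets_leb by blast
  obtain p' where p': "p' < 1" "\<And>s. measure m (P s) \<le> p'"
    using m.partition_bound[of "{x \<in> L. R x = n0}" "{x \<in> L. R x = n1}" P] return_level Ps disj n
    unfolding m.prob_space by auto
  obtain \<tau> K where \<tau>: "0 < \<tau>" "\<tau> < 1" and K: "0 < K" and ds: "distortion_system leb T P \<tau> K"
    using leb_distortion by blast
  interpret lebd: distortion_system leb T P \<tau> K by (rule ds)
  interpret lebi: interval_branches leb T P by (rule interval_branches_leb)
  interpret lebp: interval_distortion_system leb T P \<tau> K p
    by unfold_locales (use p in auto)
  obtain h c b where h: "h \<in> borel_measurable borel" "0 < (c::real)" "\<And>x. x \<in> L \<Longrightarrow> c \<le> h x \<and> h x \<le> b"
    "m = density leb (\<lambda>x. ennreal (h x))" using density_ex by metis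
  have inv: "measure m (T -` A \<inter> L) = measure m A" if "A \<in> sets m" for A
  proof -
    have "measure m A = measure (distr m m T) A" using base_invariant
        by (simp add: measure_preserving_map_def)
    also have "\<dots> = measure m (T -` A \<inter> space m)" using that
        by (rule measure_distr[OF T_measurable_m])
    finally show ?thesis by (simp add: space_m)
  qed
  have reg: "lebd.regular (lebd.K1 + 1) (measure m)"
  proof (rule lebp.invariant_density_regular[OF h(4)])
    show "h \<in> borel_measurable leb" using h(1) by (intro measurable_restrict_space1) auto
    show "measure m (T -` A \<inter> space leb) = measure m A" if "A \<in> sets leb" for A
      using inv[of A] that by (simp add: sets_leb space_leb)
  qed (use h in \<open>auto simp: space_leb\<close>)
  define K' where "K' = (lebd.K1 + 1) * \<tau> + K + (lebd.K1 + 1)"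
  have K': "0 < K'" using lebd.K1(1) \<tau> K unfolding K'_def by (intro add_pos_pos mult_pos_pos) auto
  interpret mf: full_branch_system m T P
    by unfold_locales (use T_measurable_m Ps partition m.prob_space in \<open>auto simp: space_m\<close>)
  interpret md: distortion_system m T P \<tau> K'
  proof
    fix i v D E assume "D \<in> sets m" "E \<in> sets m" "D \<subseteq> mf.cyl v" "E \<subseteq> mf.cyl v"
    then show "measure m (P i \<inter> T -` D) * measure m E
        \<le> exp (K' * \<tau> ^ length v) * (measure m (P i \<inter> T -` E) * measure m D)"
      unfolding K'_def using lebd.regular_distortion[OF reg, of D E v i]
          by (simp add: sets_leb space_leb space_m)
  qed (use \<tau> K' in auto)
  interpret mm: mixing_system m T P \<tau> K'
  proof
    show "measure m (space m) = 1" by (rule m.prob_space)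
    show "measure m (T -` A \<inter> space m) = measure m A" if "A \<in> sets m" for A
      using inv[OF that] by (simp add: space_m)
  qed
  obtain C \<theta> where C: "0 \<le> C" "0 < \<theta>" "\<theta> < 1" and mix: "\<forall>A B k. A \<in> sets m \<longrightarrow> mm.few_boundary A
      \<longrightarrow> B \<in> sets m \<longrightarrow>
     measure m (A \<inter> (T ^^ k) -` B) \<le> measure m A * measure m B + C * \<theta> ^ k * measure m B"
    using mm.few_boundary_mixing[OF p'] by blast
  show ?thesis
  proof (rule exI[of _ C], intro conjI C, rule exI[of _ \<theta>], intro conjI C allI impI)
    fix A B k
    assume A: "A \<in> sets m" and B: "B \<in> sets m"
      and conv: "\<forall>i x y z. x \<in> A \<inter> P i \<longrightarrow> y \<in> A \<inter> P i \<longrightarrow> z \<in> P i \<longrightarrow> x \<le> z \<longrightarrow> z \<le> y \<longrightarrow> z \<in> A"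
    have "mm.few_boundary A"
      unfolding mm.few_boundary_def
    proof (intro allI)
      fix i n
      show "\<exists>u v. \<forall>w. length w = n \<and> mf.cyl (i # w) \<inter> A \<noteq> {} \<and> \<not> mf.cyl (i # w) \<subseteq> A \<longrightarrow> w = u \<or> w = v"
        using lebi.few_boundary_cylinders[of A i n] conv unfolding space_leb space_m by blast
    qed
    then show "measure m (A \<inter> (T ^^ k) -` B) \<le> measure m A * measure m B + C * \<theta> ^ k * measure m B"
      using mix A B by blast
  qed
qed

end

section \<open>The tower measure and its high floors\<close>

locale modelled_tower = young_tower +
  fixes \<mu> :: "real measure"
  assumes X_interval: "is_interval X"
    and sets_\<mu>: "sets \<mu> = sets (restrict_space borel X)"
    and f_measurable: "f \<in> measurable \<mu> \<mu>"
    and ac: "absolutely_continuous (restrict_space lborel X) \<mu>"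
    and model: "\<mu> = distr (tower_measure f L R m) (restrict_space borel X) (tower_proj f)"
begin

abbreviation tow where "tow \<equiv> tower_measure f L R m"

lemma X_sets: "X \<in> sets borel"
  using X_interval by (auto simp: is_interval_convex_1 intro: real_interval_borel_measurable)

lemma space_\<mu>: "space \<mu> = X"
  using sets_eq_imp_space_eq[OF sets_\<mu>] by (simp add: space_restrict_space)

lemma sets_\<mu>_iff: "A \<in> sets \<mu> \<longleftrightarrow> A \<in> sets borel \<and> A \<subseteq> X"
  using X_sets by (auto simp: sets_\<mu> sets_restrict_space_iff)

definition floor_part :: "nat \<Rightarrow> real set \<Rightarrow> real set" where
  "floor_part l B = {x \<in> L. l < R x \<and> (f ^^ l) x \<in> B}"

lemma funpow_f_measurable: "(f ^^ l) \<in> measurable \<mu> \<mu>"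
proof (induction l)
  case (Suc l)
  show ?case unfolding funpow.simps(2) by (rule measurable_comp[OF Suc f_measurable])
qed simp

lemma funpow_f_X: "x \<in> X \<Longrightarrow> (f ^^ l) x \<in> X"
  using measurable_space[OF funpow_f_measurable] by (simp add: space_\<mu>)

lemma floor_part_sets [measurable]: "B \<in> sets borel \<Longrightarrow> floor_part l B \<in> sets m"
proof -
  assume B: "B \<in> sets borel"
  have "(f ^^ l) -` (B \<inter> X) \<inter> X \<in> sets \<mu>"
    using measurable_sets[OF funpow_f_measurable, of "B \<inter> X" l] B X_sets
    by (auto simp: sets_\<mu>_iff space_\<mu>)
  then have "(f ^^ l) -` (B \<inter> X) \<inter> X \<in> sets borel" by (simp add: sets_\<mu>_iff)
  moreover have "floor_part l B = {x \<in> L. l < R x} \<inter> ((f ^^ l) -` (B \<inter> X) \<inter> X)"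
    using base_interval(2) funpow_f_X by (auto simp: floor_part_def)
  ultimately have "floor_part l B \<in> sets borel" using return_level_sets by auto
  then show ?thesis unfolding sets_m using base_sets(1)
    by (auto simp: sets_restrict_space_iff floor_part_def)
qed

definition upper :: "nat \<Rightarrow> real set \<Rightarrow> (real \<times> nat) set" where
  "upper H B = {z \<in> tower L R. H \<le> snd z \<and> tower_proj f z \<in> B}"

lemma upper_sets: "B \<in> sets borel \<Longrightarrow> upper H B \<in> sets tow"
proof -
  assume B: "B \<in> sets borel"
  have eq: "upper H B = (\<Union>l\<in>{H..}. floor_part l B \<times> {l})"
    by (auto simp: upper_def floor_part_def tower_def tower_proj_def)
  have "floor_part l B \<times> {l} \<in> sets (borel \<Otimes>\<^sub>M count_space UNIV)" for l
  proof -
    have "floor_part l B \<in> sets borel" using floor_part_sets[OF B, of l] base_sets(1)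
      by (auto simp: sets_m sets_restrict_space_iff)
    then show ?thesis by auto
  qed
  then have "upper H B \<in> sets (borel \<Otimes>\<^sub>M count_space UNIV)"
    unfolding eq by (intro sets.countable_UN') auto
  moreover have "upper H B \<subseteq> tower L R" by (auto simp: upper_def)
  ultimately show ?thesis
    unfolding sets_tower_measure sets_restrict_space by (auto intro!: image_eqI[of _ _ "upper H B"])
qed

lemma emeasure_upper:
  assumes "B \<in> sets borel"
  shows "emeasure tow (upper H B) = (\<Sum>l. if H \<le> l then emeasure m (floor_part l B) else 0)"
proof -
  have "{x \<in> L. l < R x \<and> (tower_map f R ^^ l) (x, 0) \<in> upper H B} = (if H
      \<le> l then floor_part l B else {})" for l
    by (auto simp: tower_map_base upper_def tower_def tower_proj_def floor_part_def)
  then show ?thesis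
    unfolding emeasure_tower_measure[OF upper_sets[OF assms]]
    by (intro suminf_cong) auto
qed

lemma proj_measurable: "tower_proj f \<in> measurable tow borel"
proof (rule measurableI)
  fix A :: "real set" assume "A \<in> sets borel"
  then have "upper 0 A \<in> sets tow" by (rule upper_sets)
  moreover have "tower_proj f -` A \<inter> space tow = upper 0 A"
      by (auto simp: upper_def space_tower_measure)
  ultimately show "tower_proj f -` A \<inter> space tow \<in> sets tow" by simp
qed simp

lemma proj_measurable_X: "tower_proj f \<in> measurable tow (restrict_space borel X)"
proof (rule measurable_restrict_space2[OF _ proj_measurable])
  show "tower_proj f \<in> space tow \<rightarrow> X" using proj_surj by (auto simp: space_tower_measure)
qed

text \<open>
  The projection to the line of the tower measure above height \<open>H\<close>; for \<open>H = 0\<close> this is \<open>\<mu>\<close>,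
  viewed as a measure on all Borel sets of the line.
\<close>

definition high :: "nat \<Rightarrow> real measure" where
  "high H = distr (density tow (indicator {z. H \<le> snd z})) borel (tower_proj f)"

lemma sets_high [simp, measurable_cong]: "sets (high H) = sets borel"
    and space_high [simp]: "space (high H) = UNIV"
  by (simp_all add: high_def)

lemma emeasure_high:
  assumes B: "B \<in> sets borel"
  shows "emeasure (high H) B = (\<Sum>l. if H \<le> l then emeasure m (floor_part l B) else 0)"
proof -
  have H: "{z \<in> space tow. H \<le> snd z} \<in> sets tow"
    using upper_sets[of UNIV H] by (simp add: upper_def space_tower_measure)
  then have ind: "(indicator {z. H \<le> snd z} :: _ \<Rightarrow> ennreal) \<in> borel_measurable tow"
    by (subst borel_measurable_indicator_iff) (simp add: Int_def conj_commute)
  have "emeasure (high H) B = emeasure (density tow (indicator {z. H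
      \<le> snd z})) (tower_proj f -` B \<inter> space tow)"
    unfolding high_def using B proj_measurable by (subst emeasure_distr) auto
  also have "\<dots> = (\<integral>\<^sup>+z. indicator {z. H \<le> snd z} z * indicator (tower_proj f -` B \<inter> space tow) z
      \<partial>tow)"
    by (intro emeasure_density ind measurable_sets[OF proj_measurable B])
  also have "\<dots> = (\<integral>\<^sup>+z. indicator (upper H B) z \<partial>tow)"
    by (intro nn_integral_cong) (auto simp: indicator_def upper_def space_tower_measure)
  also have "\<dots> = emeasure tow (upper H B)" using upper_sets[OF B] by simp
  finally show ?thesis using emeasure_upper[OF B] by simp
qed

lemma emeasure_\<mu>:
  assumes "B \<in> sets borel"
  shows "emeasure \<mu> (B \<inter> X) = emeasure (high 0) B"
proof -
  have "emeasure \<mu> (B \<inter> X) = emeasure tow (tower_proj f -` (B \<inter> X) \<inter> space tow)"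
    unfolding model using assms X_sets proj_measurable_X
        by (intro emeasure_distr) (auto simp: sets_restrict_space)
  also have "tower_proj f -` (B \<inter> X) \<inter> space tow = upper 0 B"
    using proj_surj by (auto simp: upper_def space_tower_measure)
  finally show ?thesis using assms by (simp add: emeasure_upper emeasure_high)
qed

lemma emeasure_\<mu>': "B \<in> sets borel \<Longrightarrow> B \<subseteq> X \<Longrightarrow> emeasure \<mu> B = emeasure (high 0) B"
  using emeasure_\<mu>[of B] by (simp add: Int_absorb2)

lemma high_le: "B \<in> sets borel \<Longrightarrow> emeasure (high H) B \<le> emeasure (high 0) B"
  unfolding emeasure_high by (intro suminf_le) auto

lemma high_split:
  assumes B: "B \<in> sets borel"
  shows "emeasure (high 0) B = (\<Sum>l<H. emeasure m (floor_part l B)) + emeasure (high H) B"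
proof -
  let ?g = "\<lambda>l. emeasure m (floor_part l B)"
  have "emeasure (high 0) B = (\<Sum>l. ?g l)" by (simp add: emeasure_high[OF B])
  also have "\<dots> = (\<Sum>l. (if l < H then ?g l else 0) + (if H \<le> l then ?g l else 0))"
    by (intro suminf_cong) auto
  also have "\<dots> = (\<Sum>l. if l < H then ?g l else 0) + (\<Sum>l. if H \<le> l then ?g l else 0)"
    by (intro suminf_add[symmetric]) auto
  also have "(\<Sum>l. if l < H then ?g l else 0) = (\<Sum>l<H. ?g l)"
    by (subst suminf_finite[of "{..<H}"]) auto
  finally show ?thesis by (simp add: emeasure_high[OF B])
qed

lemma high_tendsto_0:
  assumes B: "B \<in> sets borel" and fin: "emeasure (high 0) B < \<infinity>"
  shows "(\<lambda>H. emeasure (high H) B) \<longlonglongrightarrow> 0"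
proof -
  interpret m: prob_space m by (rule base_prob)
  let ?g = "\<lambda>l. emeasure m (floor_part l B)"
  let ?S = "emeasure (high 0) B"
  have S: "?S = (\<Sum>l. ?g l)" by (simp add: emeasure_high[OF B])
  have "(\<lambda>H. \<Sum>l<H. ?g l) \<longlonglongrightarrow> ?S" unfolding S by (rule summable_LIMSEQ) simp
  then have "(\<lambda>H. ?S - (\<Sum>l<H. ?g l)) \<longlonglongrightarrow> ?S - ?S"
    using fin by (intro tendsto_diff_ennreal tendsto_const) auto
  moreover have "?S - (\<Sum>l<H. ?g l) = emeasure (high H) B" for H
  proof -
    have "(\<Sum>l<H. ?g l) \<noteq> \<infinity>" by (simp add: m.emeasure_eq_measure sum_ennreal)
    then show ?thesis using high_split[OF B, of H] by (simp add: ennreal_add_diff_cancel_left)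
  qed
  ultimately show ?thesis using fin by simp
qed

lemma countable_null:
  assumes "countable A"
  shows "emeasure (high H) A = 0"
proof -
  have A: "A \<in> sets borel" by (rule sets.countable[OF _ assms]) simp 
  have "A \<inter> X \<in> null_sets (restrict_space lborel X)"
  proof -
    have "A \<inter> X \<in> null_sets lborel"
      using countable_imp_null_set_lborel[of "A \<inter> X"] assms by (simp add: countable_Int1)
    then show ?thesis using X_sets by (subst null_sets_restrict_space) auto
  qed
  then have "A \<inter> X \<in> null_sets \<mu>" using ac by (auto simp: absolutely_continuous_def)
  then have "emeasure (high 0) A = 0" using emeasure_\<mu>[OF A] by auto
  then show ?thesis using high_le[OF A, of H] by simp
qed

text \<open>
  Points at which the measure is locally infinite, but finite on one side. One-sided intervals
  of finite measure can shrink to them, and the maximal inequality, which is applied inside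
  neighbourhoods of finite measure, gives no information there.
\<close>

definition one_sided :: "real set" where
  "one_sided = {x. (\<forall>a b. a < x \<and> x < b \<longrightarrow> emeasure (high 0) {a<..<b} = \<infinity>) \<and>
     (\<exists>y. y \<noteq> x \<and> emeasure (high 0) ({min x y<..<max x y}) < \<infinity>)}"

text \<open>
  To such a point assign a rational number in the adjacent interval of finite measure, and the
  side on which it lies. Of two points with the same data, one would have a neighbourhood of
  finite measure.
\<close>

lemma one_sided_countable: "countable one_sided"
proof -
  let ?h = "emeasure (high 0)"
  have mono: "?h {c<..<d} < \<infinity>" if "?h {a<..<b} < \<infinity>" "a \<le> c" "d \<le> b" for a b c d
  proof -
    have "?h {c<..<d} \<le> ?h {a<..<b}" using that by (intro emeasure_mono) auto
    then show ?thesis using that(1) by simp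
  qed
  have "\<forall>x\<in>one_sided. \<exists>q. q \<in> \<rat> \<and> q \<noteq> x \<and> ?h {min x q<..<max x q} < \<infinity>"
  proof
    fix x assume "x \<in> one_sided"
    then obtain y where y: "y \<noteq> x" "?h {min x y<..<max x y} < \<infinity>"
      unfolding one_sided_def by blast
    then have "min x y < max x y" by (auto simp: min_def max_def)
    then obtain q where q: "q \<in> \<rat>" "min x y < q" "q < max x y" using Rats_dense_in_real by blast
    then have "q \<noteq> x" "min x y \<le> min x q" "max x q \<le> max x y"
        by (auto simp: min_def max_def split: if_splits)
    with q(1) mono[OF y(2)] show "\<exists>q. q \<in> \<rat> \<and> q \<noteq> x \<and> ?h {min x q<..<max x q} < \<infinity>" by blast
  qed
  from bchoice[OF this] obtain q where q: "\<And>x. x \<in> one_sided \<Longrightarrow> q x \<in> \<rat> \<and> q x \<noteq> x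
      \<and> ?h {min x (q x)<..<max x (q x)} < \<infinity>"
    by blast
  have bad: False if u: "u \<in> one_sided" and v: "v \<in> one_sided" and uv: "q u = q v" "(u < q u) = (v
      < q v)" "u < v" for u v
  proof (cases "u < q u")
    case True
    then have "?h {u<..<q u} = \<infinity>" using v uv unfolding one_sided_def by auto
    then show False using q[OF u] True by (simp add: min_def max_def)
  next
    case False
    then have "q v < u" using q[OF u] uv by auto
    then have "?h {q v<..<v} = \<infinity>" using u uv unfolding one_sided_def by auto
    then show False using q[OF v] \<open>q v < u\<close> uv(3) by (simp add: min_def max_def)
  qed
  have "inj_on (\<lambda>x. (q x, x < q x)) one_sided"
  proof (rule inj_onI)
    fix x y assume "x \<in> one_sided" "y \<in> one_sided" "(q x, x < q x) = (q y, y < q y)"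
    then show "x = y" using bad[of x y] bad[of y x] by (cases x y rule: linorder_cases) auto
  qed
  moreover have "countable ((\<lambda>x. (q x, x < q x)) ` one_sided)"
  proof (rule countable_subset)
    show "(\<lambda>x. (q x, x < q x)) ` one_sided \<subseteq> \<rat> \<times> UNIV" using q by auto
    show "countable (\<rat> \<times> (UNIV :: bool set) :: (real \<times> bool) set)" using countable_rat by auto
  qed
  ultimately show ?thesis by (rule countable_image_inj_on[rotated])
qed

text \<open>
  The level set \<open>\<ge> 1 / (k + 1)\<close> of the maximal function of the mass above height \<open>H\<close> relative to
  the whole mass, the maximal function being taken over the open intervals inside \<open>J\<close>.
\<close>

definition heavy :: "nat \<Rightarrow> real set \<Rightarrow> nat \<Rightarrow> real set" where
  "heavy k J H = \<Union>{I. (\<exists>a b. I = {a<..<b}) \<and> I \<subseteq> J \<and> emeasure (high 0) I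
      \<le> of_nat (Suc k) * emeasure (high H) I}"

lemma heavy_borel: "heavy k J H \<in> sets borel"
  unfolding heavy_def by (intro borel_open open_Union) auto

text \<open>
  By the maximal inequality the measure of \<open>heavy k J H\<close> is at most \<open>2 * (k + 1)\<close> times the mass
  above height \<open>H\<close> in \<open>J\<close>, which tends to 0 as \<open>J\<close> has finite measure.
\<close>

lemma heavy_null:
  assumes J: "J \<in> sets borel" and fin: "emeasure (high 0) J < \<infinity>"
  shows "emeasure (high 0) (\<Inter>H. heavy k J H) = 0"
proof -
  let ?c = "2 * of_nat (Suc k) :: ennreal"
  have le: "emeasure (high 0) (\<Inter>H. heavy k J H) \<le> ?c * emeasure (high H) J" for H
  proof -
    have "emeasure (high 0) (\<Inter>H. heavy k J H) \<le> emeasure (high 0) (heavy k J H)"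
      using heavy_borel by (intro emeasure_mono) auto
    also have "\<dots> \<le> ?c * emeasure (high H) J"
      unfolding heavy_def by (rule maximal_inequality) (use J in auto)
    finally show ?thesis .
  qed
  have "(\<lambda>H. ?c * emeasure (high H) J) \<longlonglongrightarrow> ?c * 0"
    by (intro ennreal_tendsto_cmult high_tendsto_0[OF J fin]) (simp add: ennreal_mult_less_top
        of_nat_less_top)
  then have "emeasure (high 0) (\<Inter>H. heavy k J H) \<le> ?c * 0"
    by (rule LIMSEQ_le_const) (use le in blast)
  then show ?thesis by simp
qed

definition exceptional :: "real set" where
  "exceptional = one_sided \<union> (\<Union>(a, b, k)\<in>{(a, b, k). a \<in> \<rat> \<and> b \<in> \<rat> \<and> emeasure (high 0) {a<..<b}
      < \<infinity>}.
      \<Inter>H. heavy k {a<..<b} H)"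

lemma exceptional_null: "exceptional \<in> null_sets (high 0)"
proof -
  have one: "one_sided \<in> null_sets (high 0)"
    using countable_null[OF one_sided_countable] one_sided_countable
    by (intro null_setsI) (simp_all add: sets.countable)
  have cnt: "countable {(a :: real, b :: real, k :: nat). a \<in> \<rat> \<and> b \<in> \<rat>
      \<and> emeasure (high 0) {a<..<b} < \<infinity>}"
  proof (rule countable_subset)
    show "countable (\<rat> \<times> \<rat> \<times> (UNIV :: nat set) :: (real \<times> real \<times> nat) set)"
      using countable_rat by auto
  qed auto
  show ?thesis
    unfolding exceptional_def
  proof (intro null_sets.Un one null_sets_UN' cnt, clarify)
    fix a b :: real and k assume "emeasure (high 0) {a<..<b} < \<infinity>"
    then have "emeasure (high 0) (\<Inter>H. heavy k {a<..<b} H) = 0" by (intro heavy_null) auto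
    then show "(\<Inter>H. heavy k {a<..<b} H) \<in> null_sets (high 0)"
      using heavy_borel by (intro null_setsI) auto
  qed
qed

lemma exceptional_null_\<mu>: "X \<inter> exceptional \<in> null_sets \<mu>"
proof -
  have b: "exceptional \<in> sets borel" using exceptional_null by (auto simp: null_sets_def)
  then have "emeasure \<mu> (exceptional \<inter> X) = 0"
    using emeasure_\<mu>[OF b] exceptional_null by auto
  moreover have "X \<inter> exceptional \<in> sets \<mu>" using b X_sets by (auto simp: sets_\<mu>_iff)
  ultimately show ?thesis by (auto simp: Int_commute)
qed

lemma interval_borel: "is_interval (B :: real set) \<Longrightarrow> B \<in> sets borel"
  by (auto simp: is_interval_convex_1 intro: real_interval_borel_measurable)

text \<open>
  Outside the exceptional set a centre of intervals of finite positive measure has a two-sided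
  neighbourhood \<open>J\<close> of finite measure and is not heavy in \<open>J\<close> for some height. This speaks of
  open intervals; an arbitrary interval \<open>B n\<close> is reached by letting open ones decrease to its
  closure, which adds at most two points.
\<close>

theorem high_part_small:
  assumes x: "x \<in> X - exceptional"
    and B: "decseq B" "\<And>n. is_interval (B n)" "\<And>n. B n \<subseteq> X" "\<And>n. emeasure \<mu> (B n) < \<infinity>" "(\<Inter>n. B n)
        = {x}"
    and pos: "\<And>n. emeasure \<mu> (B n) \<noteq> 0"
  shows "\<exists>H. eventually (\<lambda>n. of_nat (Suc k) * emeasure (high H) (B n)
      \<le> emeasure (high 0) (B n)) sequentially"
proof -
  let ?h = "emeasure (high 0)"
  have Bb: "B n \<in> sets borel" for n using B(2) by (rule interval_borel)
  have h\<mu>: "emeasure \<mu> (B n) = ?h (B n)" for n using emeasure_\<mu>'[OF Bb B(3)] .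
  have xB: "x \<in> B n" for n using B(5) by auto
  have null_pt: "?h {y} = 0" for y using countable_null[of "{y}" 0] by simp
  have "B 0 \<noteq> {x}" using pos[of 0] null_pt h\<mu> by metis
  then obtain y where y: "y \<in> B 0" "y \<noteq> x" using xB by blast
  have "{min x y<..<max x y} \<subseteq> B 0"
  proof
    fix z assume "z \<in> {min x y<..<max x y}"
    then have "x \<le> z \<and> z \<le> y \<or> y \<le> z \<and> z \<le> x" by (auto simp: min_def max_def split: if_splits)
    then show "z \<in> B 0" using B(2)[of 0] y(1) xB[of 0] unfolding is_interval_1 by blast
  qed
  then have "?h {min x y<..<max x y} \<le> ?h (B 0)" using Bb by (intro emeasure_mono) auto
  also have "\<dots> < \<infinity>" using B(4)[of 0] h\<mu> by simp
  finally have "?h {min x y<..<max x y} < \<infinity>" .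
  moreover have "x \<notin> one_sided" using x by (auto simp: exceptional_def)
  ultimately obtain a0 b0 where ab0: "a0 < x" "x < b0" "?h {a0<..<b0} < \<infinity>"
    using y(2) unfolding one_sided_def by (auto simp: less_top)
  obtain a where a: "a \<in> \<rat>" "a0 < a" "a < x" using Rats_dense_in_real ab0 by blast
  obtain b where b: "b \<in> \<rat>" "x < b" "b < b0" using Rats_dense_in_real ab0 by blast
  have "?h {a<..<b} \<le> ?h {a0<..<b0}" using a b by (intro emeasure_mono) auto
  then have fin: "?h {a<..<b} < \<infinity>" using ab0(3) by simp
  have "x \<notin> (\<Inter>H. heavy k {a<..<b} H)" using x a b fin unfolding exceptional_def by blast
  then obtain H where H: "x \<notin> heavy k {a<..<b} H" by blast
  have light: "of_nat (Suc k) * emeasure (high H) {c<..<d} \<le> ?h {c<..<d}" if "a \<le> c" "c < x" "x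
      < d" "d \<le> b" for c d
  proof (rule ccontr)
    assume "\<not> ?thesis"
    then have "?h {c<..<d} \<le> of_nat (Suc k) * emeasure (high H) {c<..<d}" by simp
    moreover have "{c<..<d} \<subseteq> {a<..<b}" using that by auto
    moreover have "x \<in> {c<..<d}" using that by simp
    ultimately show False using H unfolding heavy_def by blast
  qed
  define a' b' where "a' = (a + x) / 2" and "b' = (x + b) / 2"
  have ab': "a < a'" "a' < x" "x < b'" "b' < b" using a b by (auto simp: a'_def b'_def)
  have "a' \<notin> (\<Inter>n. B n)" "b' \<notin> (\<Inter>n. B n)" using B(5) ab' by auto
  then obtain n1 n2 where n12: "a' \<notin> B n1" "b' \<notin> B n2" by auto
  have main: "of_nat (Suc k) * emeasure (high H) (B n) \<le> ?h (B n)" if n: "n \<ge> max n1 n2" for n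
  proof -
    have "B n \<subseteq> B n1" "B n \<subseteq> B n2" using n B(1) unfolding decseq_def by auto
    then have "a' \<notin> B n" "b' \<notin> B n" using n12 by auto
    have sub: "B n \<subseteq> {a'..b'}"
    proof
      fix z assume z: "z \<in> B n"
      have "\<not> z < a'"
      proof
        assume "z < a'"
        then have "z \<le> a' \<and> a' \<le> x" using ab' by simp
        then show False using B(2)[of n] z xB[of n] \<open>a' \<notin> B n\<close> unfolding is_interval_1 by blast
      qed
      moreover have "\<not> b' < z"
      proof
        assume "b' < z"
        then have "x \<le> b' \<and> b' \<le> z" using ab' by simp
        then show False using B(2)[of n] z xB[of n] \<open>b' \<notin> B n\<close> unfolding is_interval_1 by blast
      qed
      ultimately show "z \<in> {a'..b'}" by simp
    qed
    have bdd: "bdd_below (B n)" "bdd_above (B n)" using sub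
        by (auto intro: bdd_below_mono bdd_above_mono)
    define l u where "l = Inf (B n)" and "u = Sup (B n)"
    have Blu: "B n \<subseteq> {l..u}" using bdd by (auto simp: l_def u_def intro: cInf_lower cSup_upper)
    have lu: "a' \<le> l" "l \<le> x" "x \<le> u" "u \<le> b'"
      using sub xB[of n] bdd by (auto simp: l_def u_def intro!: cInf_greatest cSup_least
          cInf_lower cSup_upper)
    have mid: "{l<..<u} \<subseteq> B n"
    proof
      fix z assume z: "z \<in> {l<..<u}"
      obtain c where c: "c \<in> B n" "c < z" using z xB[of n] cInf_lessD[of "B n" z]
          by (auto simp: l_def)
      obtain d where d: "d \<in> B n" "z < d" using z xB[of n] less_cSupD[of "B n" z]
          by (auto simp: u_def)
      show "z \<in> B n" using B(2)[of n] c d unfolding is_interval_1 by (meson less_imp_le)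
    qed
    define \<eta> where "\<eta> = min (a' - a) (b - b')"
    have \<eta>: "0 < \<eta>" using ab' by (simp add: \<eta>_def)
    let ?I = "\<lambda>j. {l - \<eta> / real (Suc j)<..<u + \<eta> / real (Suc j)}"
    have small: "\<eta> / real (Suc j) \<le> \<eta>" "0 < \<eta> / real (Suc j)" for j using \<eta>
        by (auto simp: field_simps)
    have step: "of_nat (Suc k) * emeasure (high H) (B n) \<le> ?h (?I j)" for j
    proof -
      have "emeasure (high H) (B n) \<le> emeasure (high H) (?I j)"
        using Blu small(2)[of j] by (intro emeasure_mono) (auto dest!: subsetD)
      then have "of_nat (Suc k) * emeasure (high H) (B n)
          \<le> of_nat (Suc k) * emeasure (high H) (?I j)"
        by (rule mult_left_mono) simp
      also have "\<dots> \<le> ?h (?I j)"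
      proof (rule light)
        have "\<eta> \<le> a' - a" "\<eta> \<le> b - b'" by (auto simp: \<eta>_def)
        then show "a \<le> l - \<eta> / real (Suc j)" "u + \<eta> / real (Suc j) \<le> b" "l - \<eta> / real (Suc j)
            < x" "x < u + \<eta> / real (Suc j)"
          using lu small[of j] by linarith+
      qed
      finally show ?thesis .
    qed
    have "(\<lambda>j. ?h (?I j)) \<longlonglongrightarrow> ?h (\<Inter>j. ?I j)"
    proof (rule Lim_emeasure_decseq)
      show "decseq ?I"
      proof (rule decseq_SucI, clarsimp)
        fix j z assume "l - \<eta> / (2 + real j) < z" "z < u + \<eta> / (2 + real j)"
        moreover have "\<eta> / (2 + real j) \<le> \<eta> / (1 + real j)" using \<eta> by (intro divide_left_mono) auto
        ultimately show "l - \<eta> / (1 + real j) < z \<and> z < u + \<eta> / (1 + real j)" by linarith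
      qed
      fix j
      have "\<eta> \<le> a' - a" "\<eta> \<le> b - b'" by (auto simp: \<eta>_def)
      then have "?h (?I j) \<le> ?h {a<..<b}"
        using lu small[of j] by (intro emeasure_mono) auto
      then show "?h (?I j) \<noteq> \<infinity>" using fin by (auto simp: less_top)
    qed auto
    then have "of_nat (Suc k) * emeasure (high H) (B n) \<le> ?h (\<Inter>j. ?I j)"
      by (rule LIMSEQ_le_const) (use step in blast)
    also have "(\<Inter>j. ?I j) \<subseteq> {l..u}"
    proof
      fix z assume z: "z \<in> (\<Inter>j. ?I j)"
      have lim: "(\<lambda>j. \<eta> / real (Suc j)) \<longlonglongrightarrow> 0" by (rule LIMSEQ_Suc[OF lim_const_over_n])
      have liml: "(\<lambda>j. l - \<eta> / real (Suc j)) \<longlonglongrightarrow> l - 0" and limu: "(\<lambda>j. u + \<eta> / real (Suc j)) \<longlonglongrightarrow> u + 0"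
        by (intro tendsto_intros lim)+
      have le: "l - \<eta> / real (Suc j) \<le> z" "z \<le> u + \<eta> / real (Suc j)" for j using z
          by (auto simp: less_imp_le)
      have "l - 0 \<le> z" by (rule LIMSEQ_le_const2[OF liml]) (use le in blast)
      moreover have "z \<le> u + 0" by (rule LIMSEQ_le_const[OF limu]) (use le in blast)
      ultimately show "z \<in> {l..u}" by simp
    qed
    then have "?h (\<Inter>j. ?I j) \<le> ?h {l..u}" by (intro emeasure_mono) auto
    also have "\<dots> \<le> ?h (B n \<union> {l, u})" using mid Bb by (intro emeasure_mono) (auto simp: less_le)
    also have "\<dots> \<le> ?h (B n) + ?h {l, u}" using Bb by (intro emeasure_subadditive) auto
    also have "?h {l, u} = 0" by (rule countable_null) simp
    finally show ?thesis by simp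
  qed
  then show ?thesis unfolding eventually_sequentially by blast
qed

end

section \<open>Visits to shrinking intervals\<close>

context young_tower
begin

definition return_sum :: "nat \<Rightarrow> real \<Rightarrow> nat" where
  "return_sum j x = (\<Sum>i<j. R ((T ^^ i) x))"

lemma funpow_T_L: "x \<in> L \<Longrightarrow> (T ^^ j) x \<in> L"
  using measurable_space[OF leb.funpow_measurable] by (simp add: space_leb)

lemma funpow_T_eq: "(T ^^ j) x = (f ^^ return_sum j x) x"
proof (induction j)
  case (Suc j)
  have "(T ^^ Suc j) x = (f ^^ R ((T ^^ j) x)) ((T ^^ j) x)" by (simp add: base_map_def)
  also have "\<dots> = (f ^^ (R ((T ^^ j) x) + return_sum j x)) x"
      by (simp add: Suc[symmetric] funpow_add)
  finally show ?case by (simp add: return_sum_def add.commute)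
qed (simp add: return_sum_def)

lemma excursion_point: "(f ^^ l) ((T ^^ j) x) = (f ^^ (return_sum j x + l)) x"
  unfolding funpow_T_eq by (simp add: funpow_add add.commute)

lemma return_sum_ge: "x \<in> L \<Longrightarrow> j \<le> return_sum j x"
proof (induction j)
  case (Suc j)
  then show ?case using return_pos[OF funpow_T_L[of x j]] by (simp add: return_sum_def)
qed simp

lemma R_measurable: "R \<in> measurable m (count_space UNIV)"
proof (rule measurable_count_space_eq2_countable[THEN iffD2])
  show "R \<in> space m \<rightarrow> UNIV \<and> (\<forall>a\<in>UNIV. R -` {a} \<inter> space m \<in> sets m)"
  proof (intro conjI ballI)
    fix a
    have "R -` {a} \<inter> space m = {x \<in> L. R x = a}" by (auto simp: space_m)
    then show "R -` {a} \<inter> space m \<in> sets m" using return_level by simp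
  qed simp
qed

lemma funpow_T_measurable: "(T ^^ j) \<in> measurable m m"
  using leb.funpow_measurable[of j] measurable_cong_sets[OF sets_leb sets_leb] by blast

lemma distr_funpow_T: "distr m m (T ^^ j) = m"
proof (induction j)
  case 0
  show ?case using distr_id2[of m m] by (simp add: id_def)
next
  case (Suc j)
  have "distr m m (T ^^ Suc j) = distr (distr m m (T ^^ j)) m T"
    unfolding funpow.simps(2) by (intro distr_distr[symmetric] T_measurable_m funpow_T_measurable)
  also have "\<dots> = m" unfolding Suc using base_invariant by (simp add: measure_preserving_map_def)
  finally show ?case .
qed

lemma measure_vimage_T:
  assumes "A \<in> sets m"
  shows "measure m ((T ^^ j) -` A \<inter> L) = measure m A"
  using measure_distr[OF funpow_T_measurable[of j] assms] by (simp add: distr_funpow_T space_m)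

text \<open>
  Choose \<open>p\<close> strictly between \<open>1 / a\<close> and \<open>\<beta>\<close>: then the \<open>p\<close>-th moment of the return time is
  finite and \<open>p * a > 1\<close>.
\<close>

lemma AE_return_sum_le:
  assumes \<beta>: "0 < \<beta>" "\<beta> < 1" and a: "1 / \<beta> < a"
    and tail: "comparable (\<lambda>n. measure m {x \<in> L. R x = n}) (\<lambda>n. real n powr (- \<beta> - 1))"
  shows "AE x in m. eventually (\<lambda>n. real (return_sum n x) \<le> real n powr a) sequentially"
proof -
  interpret m: prob_space m by (rule base_prob)
  have "0 < a" using a \<beta> by (meson divide_pos_pos less_trans zero_less_one)
  then have "1 / a < \<beta>" using a \<beta> by (simp add: field_simps)
  then obtain p where p: "1 / a < p" "p < \<beta>" using dense by blast
  have p0: "0 < p" using p(1) \<open>0 < a\<close> by (meson divide_pos_pos less_trans zero_less_one)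
  have pa: "1 < p * a" using p(1) \<open>0 < a\<close> by (simp add: field_simps)
  have int: "integrable m (\<lambda>x. real (R x) powr p)"
    using tail p by (intro m.integrable_powr_of_tail[OF R_measurable _ p(2)]) (simp add: space_m)
  have Rp: "(\<lambda>x. real (R x) powr p) \<in> borel_measurable m" using int by auto
  have "AE x in m. eventually (\<lambda>n. (\<Sum>j<n. real (R ((T ^^ j) x))) \<le> real n powr a) sequentially"
  proof (rule m.AE_sum_le_powr[OF _ _ _ p0 _ pa])
    fix j
    have i: "integrable (distr m m (T ^^ j)) (\<lambda>x. real (R x) powr p)" using int
        by (simp add: distr_funpow_T)
    show "integrable m (\<lambda>x. real (R ((T ^^ j) x)) powr p)"
      using integrable_distr[OF funpow_T_measurable i] .
    show "m.expectation (\<lambda>x. real (R ((T ^^ j) x)) powr p) \<le> m.expectation (\<lambda>x. real (R x) powr p)"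
      using integral_distr[OF funpow_T_measurable Rp, of j] by (simp add: distr_funpow_T)
  qed (use p \<beta> in auto)
  then show ?thesis by (simp add: return_sum_def)
qed

lemma tail_levels:
  assumes tail: "comparable (\<lambda>n. measure m {x \<in> L. R x = n}) (\<lambda>n. real n powr (- \<beta> - 1))"
  obtains n0 n1 where "n0 \<noteq> n1" "0 < measure m {x \<in> L. R x = n0}" "0 < measure m {x \<in> L. R x = n1}"
proof -
  let ?m = "\<lambda>n. measure m {x \<in> L. R x = n}"
  obtain c where c: "c > 0" and ev: "eventually (\<lambda>n. inverse c \<le> ?m n / real n powr (- \<beta> - 1) \<and>
      ?m n / real n powr (- \<beta> - 1) \<le> c) sequentially"
    using tail unfolding comparable_def by blast
  have "eventually (\<lambda>n. 0 < ?m n) sequentially"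
    using ev
  proof eventually_elim
    case (elim n)
    then have "?m n \<noteq> 0" using c by auto
    then show ?case using measure_nonneg[of m "{x \<in> L. R x = n}"] by linarith
  qed
  then obtain k where "\<And>n. n \<ge> k \<Longrightarrow> 0 < ?m n" unfolding eventually_sequentially by blast
  then show ?thesis using that[of k "Suc k"] by simp
qed

end

lemma ipart_le: "0 \<le> x \<Longrightarrow> real (ipart x) \<le> x"
  by (simp add: ipart_def)

lemma le_ipart: "real n \<le> x \<Longrightarrow> n \<le> ipart x"
  by (simp add: ipart_def le_nat_floor)

lemma ipart_mono: "x \<le> y \<Longrightarrow> ipart x \<le> ipart y"
  unfolding ipart_def by (intro nat_mono floor_mono)

lemma ipart_powr_at_top:
  assumes "0 < a"
  shows "filterlim (\<lambda>n. ipart (real n powr a)) at_top sequentially"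
  unfolding filterlim_at_top
proof
  fix K
  have "filterlim (\<lambda>n. real n powr a) at_top sequentially"
    using assms by real_asymp
  then have "eventually (\<lambda>n. real K \<le> real n powr a) sequentially"
    by (simp add: filterlim_at_top)
  then show "eventually (\<lambda>n. K \<le> ipart (real n powr a)) sequentially"
    by eventually_elim (rule le_ipart)
qed

context modelled_tower
begin

text \<open>
  The number of visits to \<open>C\<close> during the first \<open>H\<close> steps of the excursion that starts at \<open>x\<close>.
\<close>

definition trunc :: "nat \<Rightarrow> real set \<Rightarrow> real \<Rightarrow> real" where
  "trunc H C x = (\<Sum>l<H. indicator (floor_part l C) x)"

definition hits :: "(nat \<Rightarrow> real set) \<Rightarrow> nat \<Rightarrow> real \<Rightarrow> real" where
  "hits B n x = (\<Sum>k=1..n. indicator (B k) ((f ^^ k) x))"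

lemma trunc_le: "0 \<le> trunc H C x" "trunc H C x \<le> real H"
proof -
  show "0 \<le> trunc H C x" unfolding trunc_def by (intro sum_nonneg) auto
  have "trunc H C x \<le> (\<Sum>l<H. 1)" unfolding trunc_def by (intro sum_mono) (auto simp: indicator_def)
  then show "trunc H C x \<le> real H" by simp
qed

text \<open>
  During an excursion that ends before the sets \<open>B k\<close> have shrunk below \<open>C\<close>, a visit to \<open>C\<close> is a
  hit of the current \<open>B k\<close>.
\<close>

lemma trunc_le_excursion:
  assumes x: "x \<in> L" and C: "\<And>k. k < return_sum (Suc j) x \<Longrightarrow> C \<subseteq> B k"
  shows "trunc H C ((T ^^ j) x) \<le> (\<Sum>k = return_sum j x..<return_sum (Suc j) x. indicator (B k) ((f
      ^^ k) x))"
proof -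
  let ?r = "R ((T ^^ j) x)"
  have rs: "return_sum (Suc j) x = return_sum j x + ?r" by (simp add: return_sum_def)
  have "trunc H C ((T ^^ j) x) \<le> (\<Sum>l<H. indicator {..<?r} l * indicator C ((f ^^ l) ((T ^^ j) x)))"
    unfolding trunc_def by (intro sum_mono) (auto simp: indicator_def floor_part_def)
  also have "\<dots> = (\<Sum>l<H. if l \<in> {..<?r} then indicator C ((f ^^ l) ((T ^^ j) x)) else 0)"
    by (intro sum.cong) auto
  also have "\<dots> = (\<Sum>l\<in>{..<H} \<inter> {..<?r}. indicator C ((f ^^ l) ((T ^^ j) x)))"
    by (rule sum.inter_restrict[symmetric]) simp
  also have "\<dots> \<le> (\<Sum>l<?r. indicator C ((f ^^ l) ((T ^^ j) x)))"
    by (intro sum_mono2) auto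
  also have "\<dots> \<le> (\<Sum>l<?r. indicator (B (return_sum j x + l)) ((f ^^ (return_sum j x + l)) x))"
  proof (rule sum_mono)
    fix l assume "l \<in> {..<?r}"
    then have "C \<subseteq> B (return_sum j x + l)" by (intro C) (simp add: rs)
    then show "indicator C ((f ^^ l) ((T ^^ j) x)) \<le> (indicator (B (return_sum j x
        + l)) ((f ^^ (return_sum j x + l)) x) :: real)"
      by (auto simp: indicator_def excursion_point)
  qed
  also have "\<dots> = (\<Sum>k = return_sum j x..<return_sum (Suc j) x. indicator (B k) ((f ^^ k) x))"
    by (rule sum.reindex_bij_witness[of _ "\<lambda>k. k - return_sum j x" "\<lambda>l. return_sum j x
        + l"]) (auto simp: rs)
  finally show ?thesis .
qed

text \<open>
  The excursions occupy disjoint blocks of time. The first \<open>j0\<close> of them, for which the bound on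
  the return times may fail, are discarded at the cost of at most \<open>H\<close> visits each.
\<close>

lemma trunc_sum_le_hits:
  assumes x: "x \<in> L" and B: "decseq B" and j0: "1 \<le> j0"
    and idx: "\<And>j. j0 \<le> j \<Longrightarrow> return_sum j x \<le> idx j" and n: "return_sum N x \<le> n"
  shows "(\<Sum>j<N. trunc H (B (idx (Suc j))) ((T ^^ j) x)) \<le> hits B n x + real (j0 * H)"
proof (cases "j0 \<le> N")
  case True
  let ?g = "\<lambda>k. indicator (B k) ((f ^^ k) x) :: real" and ?t
      = "\<lambda>j. trunc H (B (idx (Suc j))) ((T ^^ j) x)"
  have mid: "(\<Sum>j=j0..<N. ?t j) \<le> (\<Sum>k=return_sum j0 x..<return_sum N x. ?g k)"
    using True
  proof (induction N rule: dec_induct)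
    case (step i)
    have le: "return_sum j0 x \<le> return_sum i x" "return_sum i x \<le> return_sum (Suc i) x"
      unfolding return_sum_def using step by (auto intro: sum_mono2)
    have "?t i \<le> (\<Sum>k=return_sum i x..<return_sum (Suc i) x. ?g k)"
    proof (rule trunc_le_excursion[OF x])
      fix k assume "k < return_sum (Suc i) x"
      moreover have "return_sum (Suc i) x \<le> idx (Suc i)" using step by (intro idx) auto
      ultimately show "B (idx (Suc i)) \<subseteq> B k" using B by (auto simp: decseq_def)
    qed
    then have "(\<Sum>j=j0..<Suc i. ?t j) \<le> (\<Sum>k=return_sum j0 x..<return_sum i x. ?g k)
        + (\<Sum>k=return_sum i x..<return_sum (Suc i) x. ?g k)"
      using step by simp
    also have "\<dots> = (\<Sum>k=return_sum j0 x..<return_sum (Suc i) x. ?g k)"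
      by (rule sum.atLeastLessThan_concat[OF le])
    finally show ?case .
  qed simp
  have "1 \<le> return_sum j0 x" using return_sum_ge[OF x, of j0] j0 by linarith
  then have "(\<Sum>k=return_sum j0 x..<return_sum N x. ?g k) \<le> hits B n x"
    unfolding hits_def using n by (intro sum_mono2) auto
  moreover have "(\<Sum>j<j0. ?t j) \<le> real (j0 * H)"
  proof -
    have "(\<Sum>j<j0. ?t j) \<le> (\<Sum>j<j0. real H)" by (intro sum_mono trunc_le)
    then show ?thesis by simp
  qed
  moreover have "(\<Sum>j<N. ?t j) = (\<Sum>j<j0. ?t j) + (\<Sum>j=j0..<N. ?t j)"
    using sum.atLeastLessThan_concat[of 0 j0 N ?t] True by (simp add: atLeast0LessThan)
  ultimately show ?thesis using mid by linarith
next
  case False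
  have "(\<Sum>j<N. trunc H (B (idx (Suc j))) ((T ^^ j) x)) \<le> (\<Sum>j<N. real H)"
      by (intro sum_mono trunc_le)
  also have "\<dots> \<le> real (j0 * H)" using False by (simp add: mult_right_mono)
  also have "\<dots> \<le> hits B n x + real (j0 * H)" unfolding hits_def by (simp add: sum_nonneg)
  finally show ?thesis .
qed

text \<open>
  Passing from \<open>x\<close> to \<open>f\<^sup>l x\<close> delays the targets by \<open>l\<close> steps, which only enlarges them, and
  loses the first \<open>l\<close> times.
\<close>

lemma hits_shift:
  assumes B: "decseq B"
  shows "hits B n x \<le> hits B n ((f ^^ l) x) + real l"
proof -
  have "hits B n x \<le> (\<Sum>k\<in>{1..l} \<union> {l+1..n+l}. indicator (B k) ((f ^^ k) x))"
    unfolding hits_def by (intro sum_mono2) auto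
  also have "\<dots> = (\<Sum>k=1..l. indicator (B k) ((f ^^ k) x))
      + (\<Sum>k=l+1..n+l. indicator (B k) ((f ^^ k) x))"
    by (intro sum.union_disjoint) auto
  also have "(\<Sum>k=1..l. indicator (B k) ((f ^^ k) x)) \<le> (\<Sum>k=1..l. 1 :: real)"
    by (intro sum_mono) (auto simp: indicator_def)
  also have "(\<Sum>k=l+1..n+l. indicator (B k) ((f ^^ k) x)) = (\<Sum>k=1..n. indicator (B (k
      + l)) ((f ^^ (k + l)) x) :: real)"
    by (rule sum.reindex_bij_witness[of _ "\<lambda>k. k + l" "\<lambda>k. k - l"]) auto
  also have "\<dots> \<le> (\<Sum>k=1..n. indicator (B k) ((f ^^ k) ((f ^^ l) x)))"
  proof (rule sum_mono)
    fix k
    have "B (k + l) \<subseteq> B k" using B by (auto simp: decseq_def)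
    then show "indicator (B (k + l)) ((f ^^ (k + l)) x)
        \<le> (indicator (B k) ((f ^^ k) ((f ^^ l) x)) :: real)"
      by (auto simp: indicator_def funpow_add)
  qed
  finally show ?thesis by (simp add: hits_def)
qed

end

lemma sum_at_top_of_not_summable:
  fixes u :: "nat \<Rightarrow> real"
  assumes nonneg: "\<And>j. 0 \<le> u j" and div: "\<not> summable u"
  shows "filterlim (\<lambda>N. \<Sum>j<N. u j) at_top sequentially"
proof -
  have mono: "(\<Sum>j<i. u j) \<le> (\<Sum>j<k. u j)" if "i \<le> k" for i k
    using that nonneg by (intro sum_mono2) auto
  have "\<exists>N. \<forall>n\<ge>N. Z \<le> (\<Sum>j<n. u j)" for Z
  proof (rule ccontr)
    assume "\<nexists>N. \<forall>n\<ge>N. Z \<le> (\<Sum>j<n. u j)"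
    then have "(\<Sum>j<n. u j) \<le> Z" for n using mono by (meson linear order_trans)
    then have "summable u"
      using nonneg by (intro bounded_imp_summable[of _ Z]) (auto simp:
          lessThan_Suc_atMost[symmetric] simp del: sum.lessThan_Suc)
    with div show False by blast
  qed
  then show ?thesis by (simp add: filterlim_at_top eventually_sequentially)
qed

context modelled_tower
begin

lemma trunc_expectation_sum:
  assumes C: "C \<in> sets borel"
  shows "(LINT x|m. trunc H C ((T ^^ j) x)) = (\<Sum>l<H. measure m (floor_part l C))"
    and "integrable m (\<lambda>x. trunc H C ((T ^^ j) x))"
proof -
  interpret m: prob_space m by (rule base_prob)
  have s: "(T ^^ j) -` floor_part l C \<inter> L \<in> sets m" for l
    using measurable_sets[OF funpow_T_measurable floor_part_sets[OF C]] by (simp add: space_m)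
  have eq: "trunc H C ((T ^^ j) x) = (\<Sum>l<H. indicator ((T ^^ j) -` floor_part l C \<inter> L) x)"
      if "x \<in> space m" for x
    unfolding trunc_def using that by (intro sum.cong) (auto simp: indicator_def space_m)
  have i: "integrable m (\<lambda>x. \<Sum>l<H. indicator ((T ^^ j) -` floor_part l C \<inter> L) x :: real)"
    using s by (intro Bochner_Integration.integrable_sum) (simp add: m.emeasure_eq_measure)
  show "integrable m (\<lambda>x. trunc H C ((T ^^ j) x))"
    using i by (subst Bochner_Integration.integrable_cong[OF refl eq])
  have "(LINT x|m. trunc H C ((T ^^ j) x)) = (LINT x|m. (\<Sum>l<H. indicator ((T ^^ j) -` floor_part l
      C \<inter> L) x))"
    by (intro Bochner_Integration.integral_cong refl eq)
  also have "\<dots> = (\<Sum>l<H. measure m ((T ^^ j) -` floor_part l C \<inter> L))"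
    using s by (subst Bochner_Integration.integral_sum) (auto simp: m.emeasure_eq_measure)
  also have "\<dots> = (\<Sum>l<H. measure m (floor_part l C))"
    by (intro sum.cong refl measure_vimage_T floor_part_sets C)
  finally show "(LINT x|m. trunc H C ((T ^^ j) x)) = (\<Sum>l<H. measure m (floor_part l C))" .
qed

text \<open>
  The projection of every floor is monotone on each branch domain, so the pullback of an
  interval is order-convex there. This is the hypothesis of the mixing theorem for the base map.
\<close>

lemma floor_part_convex:
  assumes B: "is_interval B" and x: "x \<in> floor_part l B \<inter> P i" "y \<in> floor_part l B \<inter> P i"
    and z: "z \<in> P i" "x \<le> z" "z \<le> y"
  shows "z \<in> floor_part l B"
proof -
  have R: "R z = R x" using return_const[of i] x z by (auto simp: constant_on_def)
  have "mono_on (P i) (f ^^ l) \<or> antimono_on (P i) (f ^^ l)"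
    using branch_mono[of x i l] x by (auto simp: floor_part_def)
  then have "(f ^^ l) x \<le> (f ^^ l) z \<and> (f ^^ l) z \<le> (f ^^ l) y \<or> (f ^^ l) y \<le> (f ^^ l) z
      \<and> (f ^^ l) z \<le> (f ^^ l) x"
    using x z by (auto simp: monotone_on_def)
  then have "(f ^^ l) z \<in> B" using B x unfolding is_interval_1 floor_part_def by blast
  then show ?thesis using R x z partition(2) by (auto simp: floor_part_def)
qed

lemma trunc_correlation:
  assumes tail: "comparable (\<lambda>n. measure m {x \<in> L. R x = n}) (\<lambda>n. real n powr (- \<beta> - 1))"
    and C: "\<And>j. is_interval (C j)"
  shows "\<exists>K\<ge>0. \<exists>\<theta>. 0 < \<theta> \<and> \<theta> < 1 \<and> (\<forall>i j. i \<le> j \<longrightarrow>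
    (LINT x|m. trunc H (C i) ((T ^^ i) x) * trunc H (C j) ((T ^^ j) x))
      \<le> (LINT x|m. trunc H (C i) ((T ^^ i) x)) * (LINT x|m. trunc H (C j) ((T ^^ j) x))
        + K * \<theta> ^ (j - i) * (LINT x|m. trunc H (C j) ((T ^^ j) x)))"
proof -
  interpret m: prob_space m by (rule base_prob)
  obtain n0 n1 where n: "n0 \<noteq> n1" "0 < measure m {x \<in> L. R x = n0}" "0 < measure m {x \<in> L. R x
      = n1}"
    using tail_levels[OF tail] by blast
  obtain K \<theta> where K: "0 \<le> K" "0 < \<theta>" "\<theta> < 1" and mix: "\<forall>A B k. A \<in> sets m \<longrightarrow>
    (\<forall>i x y z. x \<in> A \<inter> P i \<longrightarrow> y \<in> A \<inter> P i \<longrightarrow> z \<in> P i \<longrightarrow> x \<le> z \<longrightarrow> z \<le> y \<longrightarrow> z \<in> A) \<longrightarrow>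
    B \<in> sets m \<longrightarrow>
    measure m (A \<inter> (T ^^ k) -` B) \<le> measure m A * measure m B + K * \<theta> ^ k * measure m B"
    using base_mixing[OF n] by blast
  have Cb: "C j \<in> sets borel" for j by (rule interval_borel[OF C])
  let ?A = "\<lambda>j l. floor_part l (C j)"
  have As: "?A j l \<in> sets m" for j l by (rule floor_part_sets[OF Cb])
  have pair: "measure m ((T ^^ i) -` ?A i l \<inter> (T ^^ j) -` ?A j l' \<inter> L)
      \<le> measure m (?A i l) * measure m (?A j l') + K * \<theta> ^ (j - i) * measure m (?A j l')" if "i
          \<le> j" for i j l l'
  proof -
    let ?k = "j - i"
    have AL: "?A i l \<subseteq> L" by (auto simp: floor_part_def)
    have j: "(T ^^ j) x = (T ^^ ?k) ((T ^^ i) x)" for x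
      using that funpow_add[of ?k i T] by simp
    have sets: "?A i l \<inter> (T ^^ ?k) -` ?A j l' \<in> sets m"
    proof -
      have "?A i l \<inter> ((T ^^ ?k) -` ?A j l' \<inter> space m) \<in> sets m"
        by (rule sets.Int[OF As measurable_sets[OF funpow_T_measurable As]])
      moreover have "?A i l \<inter> ((T ^^ ?k) -` ?A j l' \<inter> space m) = ?A i l \<inter> (T ^^ ?k) -` ?A j l'"
        using AL by (auto simp: space_m)
      ultimately show ?thesis by simp
    qed
    have "(T ^^ i) -` ?A i l \<inter> (T ^^ j) -` ?A j l' \<inter> L
        = (T ^^ i) -` (?A i l \<inter> (T ^^ ?k) -` ?A j l') \<inter> L"
      by (auto simp: j)
    then have "measure m ((T ^^ i) -` ?A i l \<inter> (T ^^ j) -` ?A j l' \<inter> L)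
        = measure m (?A i l \<inter> (T ^^ ?k) -` ?A j l')"
      using measure_vimage_T[OF sets, of i] by simp
    also have "\<dots> \<le> measure m (?A i l) * measure m (?A j l') + K * \<theta> ^ ?k * measure m (?A j l')"
      using floor_part_convex[OF C] by (intro mix[rule_format] As) blast
    finally show ?thesis .
  qed
  have main: "(LINT x|m. trunc H (C i) ((T ^^ i) x) * trunc H (C j) ((T ^^ j) x))
      \<le> (LINT x|m. trunc H (C i) ((T ^^ i) x)) * (LINT x|m. trunc H (C j) ((T ^^ j) x))
        + (real H * K) * \<theta> ^ (j - i) * (LINT x|m. trunc H (C j) ((T ^^ j) x))" if ij: "i \<le> j"
            for i j
  proof -
    let ?S = "\<lambda>l l'. (T ^^ i) -` ?A i l \<inter> (T ^^ j) -` ?A j l' \<inter> L"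
    have S: "?S l l' \<in> sets m" for l l'
    proof -
      have "((T ^^ i) -` ?A i l \<inter> space m) \<inter> ((T ^^ j) -` ?A j l' \<inter> space m) \<in> sets m"
        by (intro sets.Int measurable_sets[OF funpow_T_measurable As])
      moreover have "((T ^^ i) -` ?A i l \<inter> space m) \<inter> ((T ^^ j) -` ?A j l' \<inter> space m) = ?S l l'"
          by (auto simp: space_m)
      ultimately show ?thesis by simp
    qed
    have "(LINT x|m. trunc H (C i) ((T ^^ i) x) * trunc H (C j) ((T ^^ j) x))
        = (LINT x|m. (\<Sum>l<H. \<Sum>l'<H. indicator (?S l l') x))"
      unfolding trunc_def sum_product
      by (intro Bochner_Integration.integral_cong refl sum.cong) (auto simp: indicator_def space_m)
    also have "\<dots> = (\<Sum>l<H. \<Sum>l'<H. measure m (?S l l'))"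
      using S by (subst Bochner_Integration.integral_sum) (auto simp: m.emeasure_eq_measure)
    also have "\<dots> \<le> (\<Sum>l<H. \<Sum>l'<H. measure m (?A i l) * measure m (?A j l')
        + K * \<theta> ^ (j - i) * measure m (?A j l'))"
      by (intro sum_mono pair ij)
    also have "\<dots> = (\<Sum>l<H. measure m (?A i l)) * (\<Sum>l<H. measure m (?A j l))
        + (real H * K) * \<theta> ^ (j - i) * (\<Sum>l<H. measure m (?A j l))"
      by (simp add: sum.distrib sum_distrib_left[symmetric] sum_distrib_right[symmetric])
    finally show ?thesis unfolding trunc_expectation_sum(1)[OF Cb] .
  qed
  show ?thesis
    by (rule exI[of _ "real H * K"], intro conjI, use K in simp, rule exI[of _ \<theta>])
        (use K main in auto)
qed

text \<open>
  Three losses of relative size \<open>\<delta> = \<eta> / 3\<close> are admitted: the mass above height \<open>H\<close>, the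
  deviation in the Borel--Cantelli lemma, and the contribution of finitely many excursions,
  which is negligible since the means diverge.
\<close>

lemma AE_hits:
  assumes \<beta>: "0 < \<beta>" "\<beta> < 1" and a: "1 / \<beta> < a"
    and tail: "comparable (\<lambda>n. measure m {x \<in> L. R x = n}) (\<lambda>n. real n powr (- \<beta> - 1))"
    and B: "decseq B" "\<And>n. is_interval (B n)" "\<And>n. B n \<subseteq> X" "\<And>n. emeasure \<mu> (B n) < \<infinity>" "(\<Inter>n. B n)
        = {y}"
    and y: "y \<in> X - exceptional" and pos: "\<And>n. emeasure \<mu> (B n) \<noteq> 0"
    and div: "\<not> summable (\<lambda>j. measure \<mu> (B (ipart (real (Suc j) powr a))))"
    and \<eta>: "0 < \<eta>" "\<eta> < 1"
  shows "AE x in m. eventually (\<lambda>n. (1 - \<eta>) * (\<Sum>j<ipart (real n powr (1 / a)). measure \<mu> (B (ipart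
      (real (Suc j) powr a))))
      \<le> hits B n x) sequentially"
proof -
  interpret m: prob_space m by (rule base_prob)
  have a0: "0 < a" using a \<beta> by (meson divide_pos_pos less_trans zero_less_one)
  define idx where "idx j = ipart (real j powr a)" for j
  define C where "C j = B (idx (Suc j))" for j
  define s where "s N = (\<Sum>j<N. measure \<mu> (C j))" for N
  define \<delta> where "\<delta> = \<eta> / 3"
  have \<delta>: "0 < \<delta>" "\<delta> < 1" using \<eta> by (auto simp: \<delta>_def)
  have Bb: "B n \<in> sets borel" for n by (rule interval_borel[OF B(2)])
  have Cb: "C j \<in> sets borel" for j by (simp add: C_def Bb)
  have idx_top: "filterlim (\<lambda>j. idx (Suc j)) at_top sequentially"
    using filterlim_compose[OF ipart_powr_at_top[OF a0] filterlim_Suc] by (simp add: idx_def)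
  obtain k :: nat where k: "1 / real (Suc k) < \<delta>" using nat_approx_posE[OF \<delta>(1)] by (metis)
  obtain H where H: "eventually (\<lambda>n. of_nat (Suc k) * emeasure (high H) (B n)
      \<le> emeasure (high 0) (B n)) sequentially"
    using high_part_small[OF y B pos] by blast
  define e where "e j = (\<Sum>l<H. measure m (floor_part l (C j)))" for j
  have e_low: "(1 - \<delta>) * measure \<mu> (B n) \<le> (\<Sum>l<H. measure m (floor_part l (B n)))"
    if le: "of_nat (Suc k) * emeasure (high H) (B n) \<le> emeasure (high 0) (B n)" for n
  proof -
    have fin: "emeasure (high 0) (B n) < \<infinity>" using B(4)[of n] emeasure_\<mu>'[OF Bb B(3)] by simp
    have finH: "emeasure (high H) (B n) < \<infinity>" using high_le[OF Bb, of H n] fin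
        by (rule le_less_trans)
    have \<mu>: "measure \<mu> (B n) = measure (high 0) (B n)" using emeasure_\<mu>'[OF Bb B(3)]
        by (simp add: measure_def)
    have e0: "emeasure (high 0) (B n) = ennreal (measure (high 0) (B n))"
      and eH: "emeasure (high H) (B n) = ennreal (measure (high H) (B n))"
      using fin finH by (auto intro!: emeasure_eq_ennreal_measure simp: less_top)
    have split: "measure (high 0) (B n) = (\<Sum>l<H. measure m (floor_part l (B n)))
        + measure (high H) (B n)"
      using high_split[OF Bb, of n H] unfolding e0 eH
      by (simp add: m.emeasure_eq_measure sum_nonneg ennreal_plus[symmetric] del: ennreal_plus)
    have "ennreal (real (Suc k) * measure (high H) (B n)) \<le> ennreal (measure (high 0) (B n))"
      using le unfolding e0 eH by (simp add: ennreal_mult ennreal_of_nat_eq_real_of_nat del: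
          of_nat_Suc)
    then have "real (Suc k) * measure (high H) (B n) \<le> measure (high 0) (B n)"
      by (subst (asm) ennreal_le_iff) auto
    then have "measure (high H) (B n) \<le> 1 / real (Suc k) * measure (high 0) (B n)"
      by (simp add: field_simps)
    also have "\<dots> \<le> \<delta> * measure (high 0) (B n)"
      using k by (intro mult_right_mono) auto
    finally show ?thesis using split \<mu> by (simp add: algebra_simps)
  qed
  have "eventually (\<lambda>j. (1 - \<delta>) * measure \<mu> (C j) \<le> e j) sequentially"
  proof -
    have "eventually (\<lambda>j. of_nat (Suc k) * emeasure (high H) (B (idx (Suc j)))
        \<le> emeasure (high 0) (B (idx (Suc j)))) sequentially"
      using eventually_compose_filterlim[OF H idx_top] .
    then show ?thesis by eventually_elim (simp add: e_def C_def e_low)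
  qed
  then obtain j1 where j1: "\<And>j. j \<ge> j1 \<Longrightarrow> (1 - \<delta>) * measure \<mu> (C j) \<le> e j"
    by (auto simp: eventually_sequentially)
  have e0: "0 \<le> e j" for j by (simp add: e_def sum_nonneg)
  have notsum: "\<not> summable e"
  proof
    assume "summable e"
    then have "summable (\<lambda>j. (1 - \<delta>) * measure \<mu> (C j))"
      by (rule summable_comparison_test') (use j1 \<delta> in auto)
    then have "summable (\<lambda>j. measure \<mu> (C j))" using \<delta> by (simp add: summable_cmult_iff)
    with div show False by (simp add: C_def idx_def)
  qed
  let ?X = "\<lambda>j x. trunc H (C j) ((T ^^ j) x)"
  have EX: "m.expectation (?X j) = e j" for j
    using trunc_expectation_sum(1)[OF Cb] by (simp add: e_def)
  obtain K \<theta> where K: "0 \<le> K" "0 < \<theta>" "\<theta> < 1" and corr: "\<forall>i j. i \<le> j \<longrightarrow>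
    m.expectation (\<lambda>x. ?X i x * ?X j x) \<le> m.expectation (?X i) * m.expectation (?X j)
        + K * \<theta> ^ (j - i) * m.expectation (?X j)"
    using trunc_correlation[OF tail, of C H] B(2) unfolding C_def by blast
  have "AE x in m. eventually (\<lambda>N. (1 - \<delta>) * (\<Sum>j<N. m.expectation (?X j))
      \<le> (\<Sum>j<N. ?X j x)) sequentially"
  proof (rule m.AE_liminf_sums[where H = "real H" and C = K and \<theta> = \<theta>])
    show "?X j \<in> borel_measurable m" for j using trunc_expectation_sum(2)[OF Cb] by auto
    show "\<not> summable (\<lambda>j. m.expectation (?X j))" using notsum by (simp add: EX)
  qed (use corr K \<delta> in \<open>auto intro: trunc_le\<close>)
  moreover have "AE x in m. eventually (\<lambda>n. real (return_sum n x) \<le> real n powr a) sequentially"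
    by (rule AE_return_sum_le[OF \<beta> a tail])
  moreover have "AE x in m. x \<in> L" by (rule AE_I2) (simp add: space_m)
  ultimately show ?thesis
  proof eventually_elim
    case (elim x)
    obtain N1 where N1: "\<And>N. N \<ge> N1 \<Longrightarrow> (1 - \<delta>) * (\<Sum>j<N. e j) \<le> (\<Sum>j<N. ?X j x)"
      using elim(1) by (auto simp: eventually_sequentially EX)
    obtain j0 where j0: "\<And>j. j \<ge> j0 \<Longrightarrow> real (return_sum j x) \<le> real j powr a"
      using elim(2) by (auto simp: eventually_sequentially)
    define J where "J = max 1 j0"
    have idx: "return_sum j x \<le> idx j" if "J \<le> j" for j
      unfolding idx_def using j0[of j] that by (intro le_ipart) (simp add: J_def)
    define D where "D = (1 - \<delta>) * (1 - \<delta>) * s j1 + real (J * H)"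
    have s_top: "filterlim s at_top sequentially"
      unfolding s_def using div by (intro sum_at_top_of_not_summable) (simp_all add: C_def idx_def)
    have N_top: "filterlim (\<lambda>n. ipart (real n powr (1 / a))) at_top sequentially"
      using a0 by (intro ipart_powr_at_top) simp
    have "eventually (\<lambda>N. D / \<delta> \<le> s N) sequentially" using s_top by (simp add: filterlim_at_top)
    then have "eventually (\<lambda>N. D / \<delta> \<le> s N \<and> N1 \<le> N \<and> J \<le> N \<and> j1 \<le> N) sequentially"
      using eventually_ge_at_top[of N1] eventually_ge_at_top[of J] eventually_ge_at_top[of j1]
          by eventually_elim auto
    from eventually_compose_filterlim[OF this N_top]
    have "eventually (\<lambda>n. (1 - \<eta>) * s (ipart (real n powr (1 / a))) \<le> hits B n x) sequentially"
    proof eventually_elim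
      case (elim n)
      let ?N = "ipart (real n powr (1 / a))"
      have "return_sum ?N x \<le> n"
      proof -
        have "real (return_sum ?N x) \<le> real ?N powr a" using elim by (intro j0) (simp add: J_def)
        also have "\<dots> \<le> (real n powr (1 / a)) powr a"
          using a0 by (intro powr_mono2 ipart_le) auto
        also have "\<dots> = real n" using a0 by (simp add: powr_powr)
        finally show ?thesis by simp
      qed
      then have "(\<Sum>j<?N. ?X j x) \<le> hits B n x + real (J * H)"
        unfolding C_def using \<open>x \<in> L\<close> idx by (intro trunc_sum_le_hits B) (auto simp: J_def)
      moreover have "(1 - \<delta>) * (\<Sum>j<?N. e j) \<le> (\<Sum>j<?N. ?X j x)" using elim by (intro N1) auto
      moreover have "(1 - \<delta>) * ((1 - \<delta>) * (s ?N - s j1)) \<le> (1 - \<delta>) * (\<Sum>j<?N. e j)"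
      proof (rule mult_left_mono)
        have "s ?N - s j1 = (\<Sum>j=j1..<?N. measure \<mu> (C j))"
          unfolding s_def using elim sum.atLeastLessThan_concat[of 0 j1 ?N "\<lambda>j. measure \<mu> (C j)"]
          by (simp add: atLeast0LessThan)
        then have "(1 - \<delta>) * (s ?N - s j1) = (\<Sum>j=j1..<?N. (1 - \<delta>) * measure \<mu> (C j))"
          by (simp add: sum_distrib_left)
        also have "\<dots> \<le> (\<Sum>j=j1..<?N. e j)" using j1 by (intro sum_mono) auto
        also have "\<dots> \<le> (\<Sum>j<?N. e j)" using e0 by (intro sum_mono2) auto
        finally show "(1 - \<delta>) * (s ?N - s j1) \<le> (\<Sum>j<?N. e j)" .
      qed (use \<delta> in simp)
      moreover have "D \<le> \<delta> * s ?N" using elim \<delta> by (simp add: field_simps)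
      moreover have "(1 - \<eta>) * s ?N \<le> (1 - \<delta>) * (1 - \<delta>) * s ?N - \<delta> * s ?N"
      proof -
        have "0 \<le> s ?N" by (simp add: s_def sum_nonneg)
        moreover have "(1 - \<delta>) * (1 - \<delta>) * s ?N - \<delta> * s ?N - (1 - \<eta>) * s ?N = \<delta> * \<delta> * s ?N"
          by (simp add: \<delta>_def algebra_simps)
        moreover have "0 \<le> \<delta> * \<delta> * s ?N" using \<delta> by (simp add: s_def sum_nonneg)
        ultimately show ?thesis by linarith
      qed
      ultimately show ?case by (simp add: D_def algebra_simps)
    qed
    then show ?case by (simp add: s_def C_def idx_def)
  qed
qed

text \<open>
  The tower measure of the part above a null set of the base is a series of zeros.
\<close>

lemma AE_tower:
  assumes "AE x in m. Q x"
  shows "AE z in tow. Q (fst z)"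
proof -
  obtain A where A: "A \<in> null_sets m" "{x \<in> space m. \<not> Q x} \<subseteq> A"
    using assms unfolding eventually_ae_filter by blast
  have Am: "A \<in> sets m" "A \<subseteq> L" using A(1) sets.sets_into_space[of A m]
      by (auto simp: null_sets_def space_m)
  let ?A = "{z \<in> tower L R. fst z \<in> A}"
  have eq: "?A = (\<Union>l. ({x \<in> L. l < R x} \<inter> A) \<times> {l})" by (auto simp: tower_def)
  have "A \<in> sets borel" using Am by (simp add: subset_sets_m)
  then have "?A \<in> sets (borel \<Otimes>\<^sub>M count_space UNIV)"
    unfolding eq using return_level_sets by (intro sets.countable_UN') auto
  then have As: "?A \<in> sets tow"
    unfolding sets_tower_measure sets_restrict_space by (auto intro!: image_eqI[of _ _ ?A])
  have "emeasure m {x \<in> L. l < R x \<and> (tower_map f R ^^ l) (x, 0) \<in> ?A} = 0" for l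
  proof -
    have "emeasure m {x \<in> L. l < R x \<and> (tower_map f R ^^ l) (x, 0) \<in> ?A} \<le> emeasure m A"
      using Am by (intro emeasure_mono) (auto simp: tower_map_base)
    then show ?thesis using A(1) by auto
  qed
  then have "?A \<in> null_sets tow" using As by (intro null_setsI) (simp_all add:
      emeasure_tower_measure)
  moreover have "{z \<in> space tow. \<not> Q (fst z)} \<subseteq> ?A"
    using A(2) by (auto simp: space_tower_measure tower_def space_m)
  ultimately show ?thesis by (rule AE_I')
qed

lemma hits_measurable:
  assumes "\<And>k. B k \<in> sets \<mu>"
  shows "hits B n \<in> borel_measurable \<mu>"
proof -
  have "(\<lambda>x. indicator (B k) ((f ^^ k) x) :: real) \<in> borel_measurable \<mu>" for k
    by (rule measurable_compose[OF funpow_f_measurable borel_measurable_indicator[OF assms]])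
  then show ?thesis unfolding hits_def[abs_def] by (intro borel_measurable_sum)
qed

text \<open>
  Almost every point of \<open>X\<close> is the projection of a tower point above a typical base point; being
  \<open>l\<close> floors higher changes the hit count by at most \<open>l\<close>, which is negligible against the
  divergent denominator.
\<close>

theorem AE_liminf_hits:
  assumes \<beta>: "0 < \<beta>" "\<beta> < 1" and a: "1 / \<beta> < a"
    and tail: "comparable (\<lambda>n. measure m {x \<in> L. R x = n}) (\<lambda>n. real n powr (- \<beta> - 1))"
    and B: "decseq B" "\<And>n. is_interval (B n)" "\<And>n. B n \<subseteq> X" "\<And>n. emeasure \<mu> (B n) < \<infinity>" "(\<Inter>n. B n)
        = {y}"
    and y: "y \<in> X - exceptional" and pos: "\<And>n. emeasure \<mu> (B n) \<noteq> 0"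
    and div: "\<not> summable (\<lambda>j. measure \<mu> (B (ipart (real (Suc j) powr a))))"
  shows "AE x in \<mu>. 1 \<le> liminf (\<lambda>n. ereal (hits B n x /
    (\<Sum>j<ipart (real n powr (1 / a)). measure \<mu> (B (ipart (real (Suc j) powr a))))))"
proof -
  have a0: "0 < a" using a \<beta> by (meson divide_pos_pos less_trans zero_less_one)
  define s where "s n = (\<Sum>j<ipart (real n powr (1 / a)). measure \<mu> (B (ipart (real (Suc j) powr
      a))))" for n
  define Q where "Q x \<longleftrightarrow> 1 \<le> liminf (\<lambda>n. ereal (hits B n x / s n))" for x
  have s_top: "filterlim s at_top sequentially"
    unfolding s_def using a0
    by (intro filterlim_compose[OF sum_at_top_of_not_summable[OF _ div] ipart_powr_at_top]) auto
  have "AE x in m. \<forall>k. eventually (\<lambda>n. (1 - 1 / real (k + 2)) * s n \<le> hits B n x) sequentially"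
    unfolding AE_all_countable s_def
    by (intro allI AE_hits[OF \<beta> a tail B y pos div]) auto
  then have "AE z in tow. \<forall>k. eventually (\<lambda>n. (1 - 1 / real (k + 2)) * s n
      \<le> hits B n (fst z)) sequentially"
    by (rule AE_tower)
  then have tow: "AE z in tow. Q (tower_proj f z)"
  proof (rule AE_mp, intro AE_I2 impI)
    fix z :: "real \<times> nat" assume z: "\<forall>k. eventually (\<lambda>n. (1 - 1 / real (k + 2)) * s n
        \<le> hits B n (fst z)) sequentially"
    obtain x l where xl: "z = (x, l)" by (cases z)
    show "Q (tower_proj f z)"
      unfolding Q_def le_Liminf_iff
    proof (intro allI impI)
      fix t :: ereal assume t: "t < 1"
      obtain r :: real where tr: "t < ereal r" and r1: "ereal r < 1"
        using ereal_dense2[OF t] by blast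
      have r: "t \<le> ereal r" "r < 1" using tr r1 by (simp_all add: less_imp_le)
      obtain k :: nat where k: "1 / real (Suc k) < (1 - r) / 2"
        using nat_approx_posE[of "(1 - r) / 2"] r(2) by auto
      define \<eta> where "\<eta> = 1 / real (k + 2)"
      have \<eta>: "0 < \<eta>" "2 * \<eta> < 1 - r"
      proof -
        have "\<eta> \<le> 1 / real (Suc k)" unfolding \<eta>_def by (intro divide_left_mono) auto
        also note k
        finally show "2 * \<eta> < 1 - r" by simp
      qed (simp add: \<eta>_def)
      have "eventually (\<lambda>n. max 1 (real l / \<eta>) \<le> s n) sequentially"
        using s_top unfolding filterlim_at_top by blast
      with z[rule_format, of k, folded \<eta>_def] show "eventually (\<lambda>n. t
          < ereal (hits B n (tower_proj f z) / s n)) sequentially"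
      proof eventually_elim
        case (elim n)
        have sn: "0 < s n" "real l \<le> \<eta> * s n"
          using elim(2) \<eta>(1) by (auto simp: field_simps)
        have "(1 - \<eta>) * s n \<le> hits B n (tower_proj f z) + real l"
          using elim(1) hits_shift[OF B(1), of n x l] by (simp add: xl tower_proj_def)
        then have "(1 - 2 * \<eta>) * s n \<le> hits B n (tower_proj f z)"
          using sn(2) by (simp add: algebra_simps)
        moreover have "r * s n < (1 - 2 * \<eta>) * s n" using \<eta>(2) sn(1)
            by (intro mult_strict_right_mono) auto
        ultimately have "r * s n < hits B n (tower_proj f z)" by (meson less_le_trans)
        then have "r < hits B n (tower_proj f z) / s n" using sn(1) by (simp add: less_divide_eq)
        then show ?case using r(1) by (meson le_less_trans ereal_less(2) less_ereal.simps(1))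
      qed
    qed
  qed
  have Bs: "B k \<in> sets \<mu>" for k using interval_borel[OF B(2)] B(3) by (simp add: sets_\<mu>_iff)
  have "(\<lambda>x. liminf (\<lambda>n. ereal (hits B n x / s n))) \<in> borel_measurable \<mu>"
    using hits_measurable[OF Bs] by (intro borel_measurable_liminf borel_measurable_ereal
        borel_measurable_divide) auto
  then have "{x \<in> space \<mu>. Q x} \<in> sets \<mu>" unfolding Q_def by measurable
  then have Qs: "{x \<in> space (restrict_space borel X). Q x} \<in> sets (restrict_space borel X)"
    by (simp add: sets_\<mu> space_\<mu> space_restrict_space)
  have "AE x in distr tow (restrict_space borel X) (tower_proj f). Q x"
    using AE_distr_iff[OF proj_measurable_X Qs] tow by simp
  then have "AE x in \<mu>. Q x" unfolding model[symmetric] .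
  then show ?thesis unfolding Q_def s_def .
qed

end

theorem theorem9p1:
  fixes X :: "real set" and f :: "real \<Rightarrow> real" and \<mu> :: "real measure"
    and L :: "real set" and P :: "nat \<Rightarrow> real set" and R :: "real \<Rightarrow> nat" and m :: "real measure"
    and \<alpha> \<beta> :: real
  assumes "is_interval X"
    and "space \<mu> = X" and "sets \<mu> = sets (restrict_space borel X)"
    and "measure_preserving_map \<mu> f" and "ergodic_map \<mu> f" and "conservative_map \<mu> f"
    and "absolutely_continuous (restrict_space lborel X) \<mu>"
    and "modelled_by_tower \<mu> f X L P R m"
    and "0 < \<beta>" and "\<beta> < 1"
    and "comparable (\<lambda>n. measure m {x \<in> L. R x = n}) (\<lambda>n. real n powr (- \<beta> - 1))"
    and "sigma_finite_measure \<mu>"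
    and "\<alpha> = 1 / \<beta>"
  shows "\<exists>X' \<subseteq> X. X - X' \<in> null_sets \<mu> \<and>
    (\<forall>(B :: nat \<Rightarrow> real set) xt \<epsilon>1.
       decseq B \<and> (\<forall>n. is_interval (B n) \<and> B n \<subseteq> X \<and> emeasure \<mu> (B n) < \<infinity>) \<and>
       (\<Inter>n. B n) = {xt} \<and> xt \<in> X' \<and> \<epsilon>1 > 0 \<and>
       (\<Sum>k. emeasure \<mu> (B (ipart (real (Suc k) powr (\<alpha> + \<epsilon>1))))) = \<infinity> \<longrightarrow>
       (\<forall>\<epsilon>. 0 < \<epsilon> \<and> \<epsilon> \<le> \<epsilon>1 \<longrightarrow>
          (AE x in \<mu>.
             liminf (\<lambda>n. ereal
               ((\<Sum>k=1..n. indicat_real (B k) ((f ^^ k) x)) /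
                (\<Sum>k=1..ipart (real n powr (1 / (\<alpha> + \<epsilon>))).
                    measure \<mu> (B (ipart (real k powr (\<alpha> + \<epsilon>)))))))
             \<ge> 1)))"
proof -
  interpret modelled_tower X f L P R m \<mu>
    using assms(1,3,4,7,8)
    by (auto simp: modelled_by_tower_def measure_preserving_map_def
        intro!: modelled_tower.intro modelled_tower_axioms.intro)
  show ?thesis
  proof (rule exI[of _ "X - exceptional"], intro conjI allI impI)
    have "X - (X - exceptional) = X \<inter> exceptional" by auto
    then show "X - (X - exceptional) \<in> null_sets \<mu>" using exceptional_null_\<mu> by simp
  next
    fix B :: "nat \<Rightarrow> real set" and xt \<epsilon>1 \<epsilon>
    assume hyp: "decseq B \<and> (\<forall>n. is_interval (B n) \<and> B n \<subseteq> X \<and> emeasure \<mu> (B n) < \<infinity>) \<and>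
       (\<Inter>n. B n) = {xt} \<and> xt \<in> X - exceptional \<and> \<epsilon>1 > 0 \<and>
       (\<Sum>k. emeasure \<mu> (B (ipart (real (Suc k) powr (\<alpha> + \<epsilon>1))))) = \<infinity>"
      and \<epsilon>: "0 < \<epsilon> \<and> \<epsilon> \<le> \<epsilon>1"
    then have B: "decseq B" "\<And>n. is_interval (B n)" "\<And>n. B n \<subseteq> X" "\<And>n. emeasure \<mu> (B n)
        < \<infinity>" "(\<Inter>n. B n) = {xt}"
      and xt: "xt \<in> X - exceptional"
      and div: "(\<Sum>k. emeasure \<mu> (B (ipart (real (Suc k) powr (\<alpha> + \<epsilon>1))))) = \<infinity>" by auto
    have Bs: "B k \<in> sets \<mu>" for k using interval_borel[OF B(2)] B(3) by (simp add: sets_\<mu>_iff)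
    have \<alpha>: "0 < \<alpha>" using assms by simp
    have mono: "emeasure \<mu> (B j) \<le> emeasure \<mu> (B i)" if "i \<le> j" for i j
      using B(1) that Bs by (intro emeasure_mono) (auto simp: decseq_def)
    \<comment> \<open>a null set among the nested sets would leave only finitely many nonzero terms in the
      divergent series\<close>
    have pos: "emeasure \<mu> (B n) \<noteq> 0" for n
    proof
      assume z: "emeasure \<mu> (B n) = 0"
      have "eventually (\<lambda>k. n \<le> ipart (real (Suc k) powr (\<alpha> + \<epsilon>1))) sequentially"
        using filterlim_compose[OF ipart_powr_at_top filterlim_Suc, of "\<alpha> + \<epsilon>1"] \<alpha> \<epsilon>
        by (simp add: filterlim_at_top)
      then obtain K where K: "\<And>k. k \<ge> K \<Longrightarrow> n \<le> ipart (real (Suc k) powr (\<alpha> + \<epsilon>1))"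
        by (auto simp: eventually_sequentially)
      have "(\<Sum>k. emeasure \<mu> (B (ipart (real (Suc k) powr (\<alpha> + \<epsilon>1)))))
          = (\<Sum>k<K. emeasure \<mu> (B (ipart (real (Suc k) powr (\<alpha> + \<epsilon>1)))))"
      proof (rule suminf_finite)
        fix k assume "k \<notin> {..<K}"
        then show "emeasure \<mu> (B (ipart (real (Suc k) powr (\<alpha> + \<epsilon>1)))) = 0"
          using mono[OF K, of k] z by simp
      qed simp
      also have "\<dots> < \<infinity>" using B(4) by simp
      finally show False using div by simp
    qed
    \<comment> \<open>a smaller exponent selects larger sets, so divergence persists\<close>
    have ndiv: "\<not> summable (\<lambda>j. measure \<mu> (B (ipart (real (Suc j) powr (\<alpha> + \<epsilon>)))))"
    proof
      assume summ: "summable (\<lambda>j. measure \<mu> (B (ipart (real (Suc j) powr (\<alpha> + \<epsilon>)))))"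
      have em: "emeasure \<mu> (B n) = ennreal (measure \<mu> (B n))" for n
        using B(4)[of n] by (intro emeasure_eq_ennreal_measure) (auto simp: less_top)
      have "(\<Sum>k. emeasure \<mu> (B (ipart (real (Suc k) powr (\<alpha> + \<epsilon>1)))))
          \<le> (\<Sum>k. emeasure \<mu> (B (ipart (real (Suc k) powr (\<alpha> + \<epsilon>)))))"
        using \<epsilon> by (intro suminf_le mono ipart_mono powr_mono) auto
      also have "\<dots> = ennreal (\<Sum>k. measure \<mu> (B (ipart (real (Suc k) powr (\<alpha> + \<epsilon>)))))"
        unfolding em by (rule suminf_ennreal2[OF _ summ]) simp
      also have "\<dots> < \<infinity>" by simp
      finally show False using div by simp
    qed
    have a: "1 / \<beta> < \<alpha> + \<epsilon>" using assms(13) \<epsilon> by simp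
    show "AE x in \<mu>. liminf (\<lambda>n. ereal ((\<Sum>k=1..n. indicat_real (B k) ((f ^^ k) x)) /
        (\<Sum>k=1..ipart (real n powr (1 / (\<alpha> + \<epsilon>))). measure \<mu> (B (ipart (real k powr (\<alpha>
            + \<epsilon>))))))) \<ge> 1"
      using AE_liminf_hits[OF assms(9,10) a assms(11) B xt pos ndiv]
      by (simp add: hits_def sum.atLeast1_atMost_eq)
  qed auto
qed

end
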